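(* For each $n\ge1$ let $\mathbf{p}^{(n)}=(p_i^{(n)})_{i\in\mathbb{I}}$ be a probability distribution on $\mathbb{I}$ and let $G=(G_1,\dots,G_n)$ be i.i.d. with $\mathbb{P}(G_j=i)=p_i^{(n)}$. Let $R\in(0,1)$ and suppose that $p_i^{(n)}\le R$ for all $n\ge1$ and $i\in\mathbb{I}$. Let $\lambda_j^{(n)}$ be the size of the $j$-th greatest cycle of $\mathrm{std}(G)$. Then the vector $$\frac{\lambda^{(n)}}{n}=n^{-1}\left(\lambda_1^{(n)},\lambda_2^{(n)},\dots\right)$$ converges in distribution in $\Delta^\infty$, as $n\to+\infty$, to the Poisson-Dirichlet process with parameter $1$.
   Context: $\mathbb{I}\subset\mathbb{R}$ is a countable set. For $g=(g_1,\dots,g_n)\in\mathbb{R}^n$, the standardized permutation $\sigma=\mathrm{std}(g)\in\mathfrak{S}_n$ is defined by: $\sigma(j)<\sigma(k)$ if and only if $g_j<g_k$, or $g_j=g_k$ and $j<k$. The sequence $\lambda^{(n)}$ lists the cycle lengths (fixed points included) in non-increasing order with multiplicity, completed by zeros. $\Delta^\infty=\left\{x\in[0,1]^{\mathbb{N}^*}\ \middle|\ x_1\ge x_2\ge\cdots\text{ and }\sum_{j\in\mathbb{N}^*}x_j\le1\right\}$, where $\mathbb{N}^*=\{1,2,\dots\}$, endowed with the topology of pointwise convergence. The Poisson-Dirichlet process with parameter $1$ is the random element $Z$ of $\Delta^\infty$ obtained as follows: let $(U_k)_{k\ge1}$ be i.i.d. uniform on $(0,1)$, set $R_0=1$, $Y_k=R_{k-1}U_k$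 and $R_k=R_{k-1}(1-U_k)$ for $k\ge1$, and let $Z$ be the sequence $(Y_k)_{k\ge1}$ rearranged in decreasing order. *)

theory Defs
  imports "HOL-Probability.Probability" "HOL-Combinatorics.Orbits" "HOL-Library.More_List"
begin

text \<open>
  Infinite sequences indexed by \<open>{1, 2, ...}\<close> are functions on \<^typ>\<open>nat\<close> shifted by one: \<open>x j\<close> is
  the entry of index \<open>j + 1\<close>. The library topology on \<^typ>\<open>nat \<Rightarrow> real\<close> is that of pointwise
  convergence. Words \<open>g\<close> of length \<open>n\<close> and permutations of \<open>n\<close> letters keep the indices
  \<open>{1..n}\<close>.
\<close>

definition Delta_infty :: "(nat \<Rightarrow> real) set" where
  "Delta_infty = {x. (\<forall>j. 0 \<le> x j \<and> x j \<le> 1) \<and> decseq x \<and> summable x \<and> (\<Sum>j. x j) \<le> 1}"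

definition std_perm :: "nat \<Rightarrow> (nat \<Rightarrow> real) \<Rightarrow> nat \<Rightarrow> nat" where
  "std_perm n g = (THE \<sigma>. \<sigma> permutes {1..n} \<and>
     (\<forall>j\<in>{1..n}. \<forall>k\<in>{1..n}. \<sigma> j < \<sigma> k \<longleftrightarrow> g j < g k \<or> (g j = g k \<and> j < k)))"

text \<open>The orbits form a set, so each cycle contributes exactly once to the multiset of sizes.\<close>

definition cycle_sizes :: "nat \<Rightarrow> (nat \<Rightarrow> nat) \<Rightarrow> nat list" where
  "cycle_sizes n \<sigma> =
     rev (sorted_list_of_multiset (image_mset card (mset_set (orbit \<sigma> ` {1..n}))))"

definition cycle_seq :: "nat \<Rightarrow> (nat \<Rightarrow> nat) \<Rightarrow> nat \<Rightarrow> nat" where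
  "cycle_seq n \<sigma> j = nth_default 0 (cycle_sizes n \<sigma>) j"

primrec stick_rest :: "(nat \<Rightarrow> real) \<Rightarrow> nat \<Rightarrow> real" where
  "stick_rest U 0 = 1"
| "stick_rest U (Suc k) = stick_rest U k * (1 - U k)"

definition stick_piece :: "(nat \<Rightarrow> real) \<Rightarrow> nat \<Rightarrow> real" where
  "stick_piece U k = stick_rest U k * U k"

definition decreasing_rearrangement :: "(nat \<Rightarrow> real) \<Rightarrow> nat \<Rightarrow> real" where
  "decreasing_rearrangement y = (THE z. decseq z \<and> (\<exists>\<pi>. bij \<pi> \<and> z = y \<circ> \<pi>))"

text \<open>
  The law of the Poisson-Dirichlet process with parameter 1. The uniform distribution is carried by
  the open interval itself, not by the whole real line, so that at every sample point the pieces are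
  positive with sum at most 1; hence the rearrangement exists and lies in \<^const>\<open>Delta_infty\<close> everywhere,
  not merely almost everywhere.
\<close>

definition poisson_dirichlet_1 :: "(nat \<Rightarrow> real) measure" where
  "poisson_dirichlet_1 =
     distr (\<Pi>\<^sub>M k\<in>UNIV. restrict_space lborel {0<..<1}) (restrict_space borel Delta_infty)
       (\<lambda>U. decreasing_rearrangement (stick_piece U))"

text \<open>
  Convergence in distribution in the subspace \<open>S\<close>, stated for laws. The Borel sets of \<open>S\<close> are those of
  \<^term>\<open>restrict_space borel S\<close>. Requiring the laws to be probability measures rules out the null
  measure which \<^const>\<open>distr\<close> returns for a non-measurable map; finitely many laws of the sequence
  are irrelevant.
\<close>

definition converges_in_distribution ::
    "'b::topological_space set \<Rightarrow> (nat \<Rightarrow> 'b measure) \<Rightarrow> 'b measure \<Rightarrow> bool" where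
  "converges_in_distribution S \<mu> \<nu> \<longleftrightarrow>
     (\<forall>\<^sub>F n in sequentially. prob_space (\<mu> n) \<and> sets (\<mu> n) = sets (restrict_space borel S)) \<and>
     prob_space \<nu> \<and> sets \<nu> = sets (restrict_space borel S) \<and>
     (\<forall>f :: 'b \<Rightarrow> real. continuous_on S f \<and> bounded (f ` S) \<longrightarrow>
        (\<lambda>n. \<integral>x. f x \<partial>\<mu> n) \<longlonglongrightarrow> (\<integral>x. f x \<partial>\<nu>))"

end

theory Submission
  imports Defs
begin

text \<open>
  Remove from the standardization of a random word the cycle through a uniformly chosen position.
  What is left is the standardization of the remaining letters, and this turns into an exact recursion.
  A variant of the Gessel-Reutenauer bijection is a self-bijection of the pairs of a word of
  length \<open>n\<close> and a number \<open>j < n\<close>. It permutes the letters of the word, and the cycle type of the image is that of the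
  first \<open>j\<close> letters together with \<open>(n - j) / d\<close> cycles of length \<open>d\<close>, where \<open>d\<close> is the cyclic period of
  the last \<open>n - j\<close> letters. As all letters have probability at most \<open>R < 1\<close>, a random word of length
  \<open>l\<close> has \<open>d < l\<close> with probability at most \<open>l * sqrt R ^ l\<close>. So, up to a small error, one removes a
  single cycle of uniform length and starts again with \<open>j\<close> letters.

  The stick-breaking process satisfies the same recursion, with an integral over \<open>(0, 1)\<close> in place of
  the mean over \<open>j\<close>. For bounded Lipschitz functions of finitely many of the sums
  \<open>\<Sum>\<^sub>j max 0 (x\<^sub>j - c)\<close>, which do not depend on the order of the entries and are dense by the
  Stone-Weierstrass theorem, comparing the two recursions bounds the difference of the expectations by a
  constant times \<open>harm n / n\<close>.
\<close>

section \<open>Sorting the positions of a word along a permutation\<close>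

text \<open>The bijection only moves letters, so it preserves the product law of the word together
  with the uniform law of the number, whatever the letter distribution. The number must be
  transformed too. A cyclic word may occur several times among the cycles, and the sorted word alone
  does not tell which copies came from the tail; the new place of the first tail letter does. A tail
  that is a proper power of a shorter word cannot form a single cycle: rotating it would break the
  order of tied positions. It therefore becomes several copies of its root, and this is the only
  deviation from removing one cycle of uniform length. Such tails are not rare when they are short.
  What saves the estimate is that a tail of length \<open>l\<close> changes a profile by at most
  \<open>l / N\<close>, so only \<open>l\<close> times the probability of a periodic tail has to be
  bounded. Each step then costs a constant over \<open>N\<close>, as does the passage from the mean
  over \<open>j\<close> to the integral, and averaging these costs over all later steps produces the
  harmonic number.\<close>

definition lexless :: "(nat \<Rightarrow> real) \<Rightarrow> (nat \<Rightarrow> real) \<Rightarrow> bool" where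
  "lexless a b \<longleftrightarrow> (\<exists>i. (\<forall>i'<i. a i' = b i') \<and> a i < b i)"

lemma lexless_irrefl: "\<not> lexless a a"
  by (auto simp: lexless_def)

lemma lexless_trans:
  assumes "lexless a b" "lexless b c" shows "lexless a c"
proof -
  obtain i where i: "\<forall>i'<i. a i' = b i'" "a i < b i" using assms(1) unfolding lexless_def by blast
  obtain k where k: "\<forall>i'<k. b i' = c i'" "b k < c k" using assms(2) unfolding lexless_def by blast
  show ?thesis unfolding lexless_def
  proof (rule exI[of _ "min i k"], intro conjI)
    show "\<forall>i'<min i k. a i' = c i'" using i k by auto
    show "a (min i k) < c (min i k)"
      using i k by (cases i k rule: linorder_cases) (auto simp: min_def)
  qed
qed

lemma lexless_total:
  assumes "a \<noteq> b" shows "lexless a b \<or> lexless b a"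
proof -
  obtain k where "a k \<noteq> b k" using assms by auto
  then obtain i where i: "a i \<noteq> b i" "\<forall>i'<i. \<not> a i' \<noteq> b i'"
    using exists_least_iff[of "\<lambda>i. a i \<noteq> b i"] by auto
  then have "a i < b i \<or> b i < a i" "\<forall>i'<i. a i' = b i'" "\<forall>i'<i. b i' = a i'" by auto
  then show ?thesis unfolding lexless_def by blast
qed

lemma lexless_Suc_iff:
  "lexless a b \<longleftrightarrow> a 0 < b 0 \<or> (a 0 = b 0 \<and> lexless (\<lambda>i. a (Suc i)) (\<lambda>i. b (Suc i)))"
proof
  assume "lexless a b"
  then obtain i where i: "\<forall>i'<i. a i' = b i'" "a i < b i" unfolding lexless_def by blast
  show "a 0 < b 0 \<or> (a 0 = b 0 \<and> lexless (\<lambda>i. a (Suc i)) (\<lambda>i. b (Suc i)))"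
  proof (cases i)
    case 0 then show ?thesis using i by simp
  next
    case (Suc k)
    then show ?thesis using i unfolding lexless_def by (metis Suc_mono zero_less_Suc)
  qed
next
  assume R: "a 0 < b 0 \<or> (a 0 = b 0 \<and> lexless (\<lambda>i. a (Suc i)) (\<lambda>i. b (Suc i)))"
  show "lexless a b"
  proof (cases "a 0 < b 0")
    case True then show ?thesis unfolding lexless_def by blast
  next
    case False
    then obtain i where "\<forall>i'<i. a (Suc i') = b (Suc i')" "a (Suc i) < b (Suc i)" "a 0 = b 0"
      using R unfolding lexless_def by blast
    then have "\<forall>i'<Suc i. a i' = b i'" by (metis less_Suc_eq_0_disj)
    then show ?thesis unfolding lexless_def using \<open>a (Suc i) < b (Suc i)\<close> by blast
  qed
qed

lemma nat_seq_eq_Suc_iff: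
  "a = b \<longleftrightarrow> a 0 = b 0 \<and> (\<lambda>i. a (Suc i)) = (\<lambda>i. b (Suc i))"
proof
  assume R: "a 0 = b 0 \<and> (\<lambda>i. a (Suc i)) = (\<lambda>i. b (Suc i))"
  show "a = b"
  proof
    fix i show "a i = b i" using R by (cases i) (auto simp: fun_eq_iff)
  qed
qed auto

text \<open>The inverse \<open>\<tau>\<close> of the standardization: its defining condition on \<open>\<sigma> j < \<sigma> k\<close> is read at
  \<open>j = \<tau> y\<close> and \<open>k = \<tau> z\<close>, and the positions are \<open>{..<n}\<close> in place of \<open>{1..n}\<close>.\<close>

definition inv_std :: "nat \<Rightarrow> (nat \<Rightarrow> real) \<Rightarrow> (nat \<Rightarrow> nat) \<Rightarrow> bool" where
  "inv_std n w \<tau> \<longleftrightarrow> \<tau> permutes {..<n} \<and>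
     (\<forall>y<n. \<forall>z<n. y < z \<longleftrightarrow> w (\<tau> y) < w (\<tau> z) \<or> (w (\<tau> y) = w (\<tau> z) \<and> \<tau> y < \<tau> z))"

text \<open>The letters read along the cycle of \<open>y\<close>, starting one step ahead: the
  condition in \<open>inv_std\<close> at \<open>y\<close> compares \<open>w (\<tau> y)\<close>, so
  this letter has to come first.\<close>

definition label_seq :: "(nat \<Rightarrow> real) \<Rightarrow> (nat \<Rightarrow> nat) \<Rightarrow> nat \<Rightarrow> nat \<Rightarrow> real" where
  "label_seq x \<tau> y i = x ((\<tau> ^^ Suc i) y)"

lemma label_seq_0: "label_seq x \<tau> y 0 = x (\<tau> y)"
  by (simp add: label_seq_def)

lemma label_seq_Suc: "label_seq x \<tau> y (Suc i) = label_seq x \<tau> (\<tau> y) i"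
  by (simp only: label_seq_def funpow_Suc_right o_apply)

lemma label_seq_eq_iff:
  "label_seq x \<tau> y = label_seq x \<tau> z \<longleftrightarrow>
     x (\<tau> y) = x (\<tau> z) \<and> label_seq x \<tau> (\<tau> y) = label_seq x \<tau> (\<tau> z)"
  by (subst nat_seq_eq_Suc_iff) (auto simp: label_seq_0 label_seq_Suc[abs_def] fun_eq_iff)

lemma lexless_label_seq_iff:
  "lexless (label_seq x \<tau> y) (label_seq x \<tau> z) \<longleftrightarrow>
     x (\<tau> y) < x (\<tau> z) \<or> (x (\<tau> y) = x (\<tau> z) \<and> lexless (label_seq x \<tau> (\<tau> y)) (label_seq x \<tau> (\<tau> z)))"
  by (subst lexless_Suc_iff) (simp add: label_seq_0 label_seq_Suc[abs_def])

lemma permutes_lessThan_less: "\<tau> permutes {..<n} \<Longrightarrow> y < n \<Longrightarrow> \<tau> y < (n::nat)"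
  using permutes_in_image[of \<tau> "{..<n}" y] by simp

lemma permutes_funpow_less: "\<tau> permutes {..<n} \<Longrightarrow> y < n \<Longrightarrow> (\<tau> ^^ i) y < (n::nat)"
  by (induction i) (auto intro: permutes_lessThan_less)

text \<open>Iterating that condition shows that the positions of a word are ordered by the letters met along
  the cycles of \<open>\<tau>\<close>, lexicographically; for an arbitrary permutation this order is imposed below.\<close>

definition seq_before :: "(nat \<Rightarrow> real) \<Rightarrow> (nat \<Rightarrow> nat) \<Rightarrow> nat \<Rightarrow> nat \<Rightarrow> bool" where
  "seq_before x \<tau> y z \<longleftrightarrow> lexless (label_seq x \<tau> y) (label_seq x \<tau> z) \<or>
     (label_seq x \<tau> y = label_seq x \<tau> z \<and> y < z)"

lemma seq_before_irrefl: "\<not> seq_before x \<tau> y y"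
  by (simp add: seq_before_def lexless_irrefl)

lemma seq_before_trans: "seq_before x \<tau> y z \<Longrightarrow> seq_before x \<tau> z u \<Longrightarrow> seq_before x \<tau> y u"
  unfolding seq_before_def using lexless_trans by (metis order_less_trans)

lemma seq_before_total: "y \<noteq> z \<Longrightarrow> seq_before x \<tau> y z \<or> seq_before x \<tau> z y"
  unfolding seq_before_def using lexless_total by (metis linorder_less_linear)

text \<open>Induction on the first index of disagreement: when the first letters tie, the condition
  in \<open>inv_std\<close> passes to the comparison of \<open>\<tau> y\<close> and
  \<open>\<tau> z\<close>, whose sequences are shifted by one.\<close>

lemma inv_std_lexless_imp_less:
  assumes "inv_std n w \<tau>" "y < n" "z < n" "lexless (label_seq w \<tau> y) (label_seq w \<tau> z)"
  shows "y < z"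
proof -
  obtain i where i: "\<forall>i'<i. label_seq w \<tau> y i' = label_seq w \<tau> z i'" "label_seq w \<tau> y i < label_seq w \<tau> z i"
    using assms(4) unfolding lexless_def by blast
  show ?thesis using i assms(2,3)
  proof (induction i arbitrary: y z)
    case 0
    then show ?case using assms(1) unfolding inv_std_def by (auto simp: label_seq_0)
  next
    case (Suc i)
    have perm: "\<tau> permutes {..<n}" using assms(1) by (simp add: inv_std_def)
    have "\<tau> y < \<tau> z"
    proof (rule Suc.IH)
      show "\<forall>i'<i. label_seq w \<tau> (\<tau> y) i' = label_seq w \<tau> (\<tau> z) i'"
        using Suc.prems(1) by (metis Suc_mono label_seq_Suc)
      show "label_seq w \<tau> (\<tau> y) i < label_seq w \<tau> (\<tau> z) i"
        using Suc.prems(2) by (simp add: label_seq_Suc)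
    qed (use perm Suc.prems permutes_lessThan_less in auto)
    moreover have "w (\<tau> y) = w (\<tau> z)" using Suc.prems(1) by (metis label_seq_0 zero_less_Suc)
    ultimately show ?case using assms(1) Suc.prems unfolding inv_std_def by blast
  qed
qed

lemma inv_std_seq_before_iff:
  assumes "inv_std n w \<tau>" "y < n" "z < n"
  shows "seq_before w \<tau> y z \<longleftrightarrow> y < z"
proof
  assume "seq_before w \<tau> y z"
  then show "y < z" using inv_std_lexless_imp_less[OF assms] unfolding seq_before_def by blast
next
  assume "y < z"
  then show "seq_before w \<tau> y z" using inv_std_lexless_imp_less[OF assms(1,3,2)] lexless_total
    unfolding seq_before_def by (metis order_less_asym)
qed

section \<open>Ranking finitely many positions by a strict total order\<close>

definition order_rank :: "(nat \<Rightarrow> nat \<Rightarrow> bool) \<Rightarrow> nat \<Rightarrow> nat \<Rightarrow> nat" where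
  "order_rank b n y = (if y < n then card {z. z < n \<and> b z y} else y)"

context
  fixes b :: "nat \<Rightarrow> nat \<Rightarrow> bool"
  assumes trans: "b y z \<Longrightarrow> b z u \<Longrightarrow> b y u"
    and total: "y \<noteq> z \<Longrightarrow> b y z \<or> b z y"
    and irrefl: "\<not> b y y"
begin

lemma order_rank_mono:
  assumes "b y z" "y < n" "z < n"
  shows "order_rank b n y < order_rank b n z"
proof -
  have "{u. u < n \<and> b u y} \<subset> {u. u < n \<and> b u z}" using trans irrefl assms by blast
  then show ?thesis
    using psubset_card_mono[of "{u. u < n \<and> b u z}"] assms by (simp add: order_rank_def)
qed

lemma order_rank_less_iff:
  assumes "y < n" "z < n"
  shows "order_rank b n y < order_rank b n z \<longleftrightarrow> b y z"
  using order_rank_mono[of y z n] order_rank_mono[of z y n] total[of y z] assms by force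

lemma order_rank_permutes: "order_rank b n permutes {..<n}"
proof (rule inj_imp_permutes)
  show "inj_on (order_rank b n) {..<n}"
  proof (rule inj_onI)
    fix y z assume "y \<in> {..<n}" "z \<in> {..<n}" "order_rank b n y = order_rank b n z"
    then show "y = z"
      using total[of y z] order_rank_mono[of y z n] order_rank_mono[of z y n] by auto
  qed
next
  fix y assume y: "y \<in> {..<n}"
  then have "{z. z < n \<and> b z y} \<subset> {..<n}" using irrefl by auto
  then show "order_rank b n y \<in> {..<n}"
    using psubset_card_mono[of "{..<n}" "{z. z < n \<and> b z y}"] y by (simp add: order_rank_def)
qed (auto simp: order_rank_def)

end

definition sort_perm :: "nat \<Rightarrow> (nat \<Rightarrow> real) \<Rightarrow> (nat \<Rightarrow> nat) \<Rightarrow> nat \<Rightarrow> nat" where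
  "sort_perm n x \<tau> = order_rank (seq_before x \<tau>) n"

lemma sort_perm_permutes: "sort_perm n x \<tau> permutes {..<n}"
  unfolding sort_perm_def
  by (rule order_rank_permutes) (use seq_before_trans seq_before_total seq_before_irrefl in blast)+

lemma sort_perm_less_iff:
  "y < n \<Longrightarrow> z < n \<Longrightarrow> sort_perm n x \<tau> y < sort_perm n x \<tau> z \<longleftrightarrow> seq_before x \<tau> y z"
  unfolding sort_perm_def
  by (rule order_rank_less_iff) (use seq_before_trans seq_before_total seq_before_irrefl in blast)+

text \<open>Positions with equal label sequences are ordered by their index in
  \<open>seq_before\<close>. The relabelled word has \<open>\<tau>\<close> as its inverse
  standardization only if \<open>\<tau>\<close> carries this tie-break along.\<close>

definition keeps_ties :: "nat \<Rightarrow> (nat \<Rightarrow> real) \<Rightarrow> (nat \<Rightarrow> nat) \<Rightarrow> bool" where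
  "keeps_ties n x \<tau> \<longleftrightarrow> \<tau> permutes {..<n} \<and>
     (\<forall>y<n. \<forall>z<n. label_seq x \<tau> y = label_seq x \<tau> z \<longrightarrow> y < z \<longrightarrow> \<tau> y < \<tau> z)"

text \<open>This is the defining condition of \<open>inv_std\<close>, with \<open>seq_before\<close>
  in the role of the order on positions.\<close>

lemma seq_before_step:
  assumes "keeps_ties n x \<tau>" "y < n" "z < n"
  shows "seq_before x \<tau> y z \<longleftrightarrow> x (\<tau> y) < x (\<tau> z) \<or> (x (\<tau> y) = x (\<tau> z) \<and> seq_before x \<tau> (\<tau> y) (\<tau> z))"
proof -
  have inj: "\<tau> y = \<tau> z \<longleftrightarrow> y = z"
    using assms(1) permutes_inj[of \<tau>] by (auto simp: keeps_ties_def inj_eq)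
  have tie: "y < z \<longleftrightarrow> \<tau> y < \<tau> z" if eq: "label_seq x \<tau> y = label_seq x \<tau> z"
  proof -
    have "y < z \<Longrightarrow> \<tau> y < \<tau> z" "z < y \<Longrightarrow> \<tau> z < \<tau> y"
      using assms eq eq[symmetric] unfolding keeps_ties_def by blast+
    then show ?thesis using inj by (cases y z rule: linorder_cases) auto
  qed
  show ?thesis
    unfolding seq_before_def using tie lexless_label_seq_iff[of x \<tau> y z] label_seq_eq_iff[of x \<tau> y z] by argo
qed

text \<open>Relabelling every position by its rank turns \<open>seq_before\<close> into
  \<open><\<close>, and \<open>seq_before_step\<close> then becomes the condition in
  \<open>inv_std\<close> for the relabelled word.\<close>

lemma inv_std_sorted:
  assumes "keeps_ties n x \<tau>"
  defines "\<theta> \<equiv> sort_perm n x \<tau>"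
  shows "inv_std n (x \<circ> inv \<theta>) (\<theta> \<circ> \<tau> \<circ> inv \<theta>)"
proof -
  have \<theta>: "\<theta> permutes {..<n}" unfolding \<theta>_def by (rule sort_perm_permutes)
  have \<tau>: "\<tau> permutes {..<n}" using assms(1) by (simp add: keeps_ties_def)
  have perm: "\<theta> \<circ> \<tau> \<circ> inv \<theta> permutes {..<n}"
    by (intro permutes_compose permutes_inv \<theta> \<tau>)
  have "u < v \<longleftrightarrow> x (\<tau> (inv \<theta> u)) < x (\<tau> (inv \<theta> v)) \<or>
      (x (\<tau> (inv \<theta> u)) = x (\<tau> (inv \<theta> v)) \<and> \<theta> (\<tau> (inv \<theta> u)) < \<theta> (\<tau> (inv \<theta> v)))"
    if uv: "u < n" "v < n" for u v
  proof -
    have lt: "inv \<theta> u < n" "inv \<theta> v < n"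
      using permutes_lessThan_less[OF permutes_inv[OF \<theta>]] uv by auto
    have "u < v \<longleftrightarrow> \<theta> (inv \<theta> u) < \<theta> (inv \<theta> v)" by (simp add: permutes_inverses(1)[OF \<theta>])
    also have "\<dots> \<longleftrightarrow> seq_before x \<tau> (inv \<theta> u) (inv \<theta> v)"
      unfolding \<theta>_def using lt sort_perm_less_iff \<theta>_def by blast
    also have "\<dots> \<longleftrightarrow> x (\<tau> (inv \<theta> u)) < x (\<tau> (inv \<theta> v)) \<or>
      (x (\<tau> (inv \<theta> u)) = x (\<tau> (inv \<theta> v)) \<and> seq_before x \<tau> (\<tau> (inv \<theta> u)) (\<tau> (inv \<theta> v)))"
      by (rule seq_before_step[OF assms(1) lt])
    also have "seq_before x \<tau> (\<tau> (inv \<theta> u)) (\<tau> (inv \<theta> v)) \<longleftrightarrow> \<theta> (\<tau> (inv \<theta> u)) < \<theta> (\<tau> (inv \<theta> v))"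
      unfolding \<theta>_def using lt permutes_lessThan_less[OF \<tau>] sort_perm_less_iff \<theta>_def by blast
    finally show ?thesis .
  qed
  then show ?thesis unfolding inv_std_def using perm permutes_inverses(2)[OF \<theta>] by simp
qed

lemma strict_mono_bij_lessThan_unique:
  fixes f g :: "nat \<Rightarrow> nat"
  assumes "\<And>y z. y < z \<Longrightarrow> z < n \<Longrightarrow> f y < f z" "\<And>y z. y < z \<Longrightarrow> z < n \<Longrightarrow> g y < g z"
    and "f ` {..<n} = g ` {..<n}" and "y < n"
  shows "f y = g y"
proof -
  have s: "sorted_wrt (<) (map h [0..<n])" if "\<And>y z. y < z \<Longrightarrow> z < n \<Longrightarrow> h y < h z" for h :: "nat \<Rightarrow> nat"
    using that by (auto simp: sorted_wrt_iff_nth_less)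
  have "map f [0..<n] = map g [0..<n]"
    using s[of f] s[of g] assms strict_sorted_equal[of "map f [0..<n]" "map g [0..<n]"]
    by (simp add: atLeast0LessThan)
  then show ?thesis using assms(4) by simp
qed

section \<open>Existence and uniqueness of the inverse standardization\<close>

lemma inv_std_exists: "\<exists>\<tau>. inv_std n w \<tau>"
proof -
  define b where "b y z \<longleftrightarrow> w y < w z \<or> (w y = w z \<and> y < z)" for y z :: nat
  define r where "r = order_rank b n"
  have perm: "r permutes {..<n}"
    unfolding r_def by (rule order_rank_permutes) (auto simp: b_def)
  have riff: "r y < r z \<longleftrightarrow> b y z" if "y < n" "z < n" for y z
    unfolding r_def by (rule order_rank_less_iff) (use that in \<open>auto simp: b_def\<close>)
  have "inv_std n w (inv r)"
    unfolding inv_std_def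
  proof (intro conjI allI impI)
    show "inv r permutes {..<n}" by (rule permutes_inv[OF perm])
    fix y z assume "y < n" "z < n"
    then have "inv r y < n" "inv r z < n" using permutes_lessThan_less[OF permutes_inv[OF perm]] by auto
    then show "y < z \<longleftrightarrow> w (inv r y) < w (inv r z) \<or> w (inv r y) = w (inv r z) \<and> inv r y < inv r z"
      using riff[of "inv r y" "inv r z"] permutes_inverses(1)[OF perm] by (simp add: b_def)
  qed
  then show ?thesis by blast
qed

text \<open>Both permutations list the positions in the same order, so
  \<open>inv \<tau>' \<circ> \<tau>\<close> is increasing on \<open>{..<n}\<close> and hence the
  identity.\<close>

lemma inv_std_unique:
  assumes "inv_std n w \<tau>" "inv_std n w \<tau>'" shows "\<tau> = \<tau>'"
proof -
  have p: "\<tau> permutes {..<n}" "\<tau>' permutes {..<n}" using assms by (auto simp: inv_std_def)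
  define \<rho> where "\<rho> = inv \<tau>' \<circ> \<tau>"
  have \<rho>: "\<rho> permutes {..<n}" unfolding \<rho>_def by (intro permutes_compose permutes_inv p)
  have mono: "\<rho> y < \<rho> z" if "y < z" "z < n" for y z
  proof -
    have lt: "\<tau> y < n" "\<tau> z < n" "\<rho> y < n" "\<rho> z < n"
      using that permutes_lessThan_less[OF p(1)] permutes_lessThan_less[OF \<rho>] by auto
    have "w (\<tau> y) < w (\<tau> z) \<or> (w (\<tau> y) = w (\<tau> z) \<and> \<tau> y < \<tau> z)"
      using assms(1) that unfolding inv_std_def by (meson order_less_trans)
    moreover have "\<tau>' (\<rho> u) = \<tau> u" for u by (simp add: \<rho>_def permutes_inverses(1)[OF p(2)])
    ultimately show ?thesis using assms(2) lt unfolding inv_std_def by metis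
  qed
  have "\<rho> y = y" if "y < n" for y
    using strict_mono_bij_lessThan_unique[of n \<rho> "\<lambda>y. y" y] mono that permutes_image[OF \<rho>] by simp
  then have "\<tau> y = \<tau>' y" if "y < n" for y
    using that by (metis \<rho>_def comp_apply p(2) permutes_inverses(1))
  then show ?thesis using p by (metis ext lessThan_iff permutes_not_in)
qed

section \<open>Merging a word with a cyclic word\<close>

text \<open>For \<open>0 < l\<close> the shift by \<open>l\<close> itself qualifies, and the least
  one divides \<open>l\<close>: it is the length of the primitive root of the cyclic word.\<close>

definition cyc_period :: "nat \<Rightarrow> (nat \<Rightarrow> 'a) \<Rightarrow> nat" where
  "cyc_period l v = (LEAST e. 0 < e \<and> (\<forall>t. v ((t + e) mod l) = v (t mod l)))"

context
  fixes l :: nat and v :: "nat \<Rightarrow> 'a"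
  assumes l: "0 < l"
begin

lemma cyc_period_pos: "0 < cyc_period l v"
  and cyc_period_shift: "v ((t + cyc_period l v) mod l) = v (t mod l)"
proof -
  have "0 < l \<and> (\<forall>t. v ((t + l) mod l) = v (t mod l))" using l by simp
  then have "0 < cyc_period l v \<and> (\<forall>t. v ((t + cyc_period l v) mod l) = v (t mod l))"
    unfolding cyc_period_def by (rule LeastI)
  then show "0 < cyc_period l v" "v ((t + cyc_period l v) mod l) = v (t mod l)" by auto
qed

lemma cyc_period_least:
  "0 < e \<Longrightarrow> (\<And>t. v ((t + e) mod l) = v (t mod l)) \<Longrightarrow> cyc_period l v \<le> e"
  unfolding cyc_period_def by (rule Least_le) simp

lemma cyc_period_shift_mult: "v ((t + cyc_period l v * q) mod l) = v (t mod l)"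
proof (induction q)
  case (Suc q)
  have "v ((t + cyc_period l v * Suc q) mod l) = v (((t + cyc_period l v * q) + cyc_period l v) mod l)"
    by (simp add: algebra_simps)
  then show ?case using Suc cyc_period_shift by simp
qed simp

lemma cyc_period_mod: "v ((t mod cyc_period l v) mod l) = v (t mod l)"
  using cyc_period_shift_mult[of "t mod cyc_period l v" "t div cyc_period l v"] by simp

lemma cyc_period_dvd: "cyc_period l v dvd l"
proof (rule ccontr)
  assume "\<not> ?thesis"
  then have r: "0 < l mod cyc_period l v" by (simp add: mod_greater_zero_iff_not_dvd)
  have "v ((t + l mod cyc_period l v) mod l) = v (t mod l)" for t
  proof -
    have "v ((t + l mod cyc_period l v) mod l) =
        v (((t + l mod cyc_period l v) + cyc_period l v * (l div cyc_period l v)) mod l)"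
      by (rule cyc_period_shift_mult[symmetric])
    also have "(t + l mod cyc_period l v) + cyc_period l v * (l div cyc_period l v) = t + l" by simp
    finally show ?thesis by simp
  qed
  from cyc_period_least[OF r this] show False
    using mod_less_divisor[OF cyc_period_pos, of l] by linarith
qed

lemma cyc_period_le: "cyc_period l v \<le> l"
  using cyc_period_dvd l by (rule dvd_imp_le)

text \<open>If the offsets differed, \<open>c' - c\<close> would be a shift smaller than the least
  one.\<close>

lemma cyc_period_offset_eq:
  assumes c: "c \<le> c'" "c' < cyc_period l v" and eq: "\<And>t. v ((c + Suc t) mod l) = v ((c' + Suc t) mod l)"
  shows "c = c'"
proof (rule ccontr)
  assume "c \<noteq> c'"
  then have e: "0 < c' - c" using c by simp
  have "v ((t + (c' - c)) mod l) = v (t mod l)" for t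
  proof -
    \<comment> \<open>Chosen so that \<open>c + Suc s\<close> is congruent to \<open>t\<close>
      modulo \<open>l\<close>; the added multiple of \<open>l\<close> keeps the subtraction from
      being truncated.\<close>
    define s where "s = t + l * Suc c - Suc c"
    have "Suc c \<le> l * Suc c" using mult_le_mono1[of 1 l "Suc c"] l by simp
    then have s: "c + Suc s = t + l * Suc c" "c' + Suc s = t + (c' - c) + l * Suc c"
      unfolding s_def using c by auto
    show ?thesis using eq[of s] unfolding s by (simp only: mod_mult_self2)
  qed
  from cyc_period_least[OF e this] show False using c by simp
qed

end

lemma cyc_period_cong: "(\<And>i. i < l \<Longrightarrow> v i = v' i) \<Longrightarrow> 0 < l \<Longrightarrow> cyc_period l v = cyc_period l v'"
  unfolding cyc_period_def by (intro arg_cong[where f = Least] ext) auto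

definition block_rot :: "nat \<Rightarrow> nat \<Rightarrow> nat \<Rightarrow> nat \<Rightarrow> nat" where
  "block_rot j n d y = (if j \<le> y \<and> y < n then j + d * ((y - j) div d) + Suc ((y - j) mod d) mod d else y)"

context
  fixes j n d :: nat
  assumes d: "0 < d" "d dvd n - j" and jn: "j < n"
begin

lemma block_less: "r < (n - j) div d \<Longrightarrow> c < d \<Longrightarrow> j + d * r + c < n"
proof -
  assume r: "r < (n - j) div d" and c: "c < d"
  have "d * r + c < d * Suc r" using c by simp
  also have "\<dots> \<le> d * ((n - j) div d)" using r by (intro mult_le_mono2) simp
  also have "\<dots> = n - j" using d by simp
  finally show ?thesis by simp
qed

lemma block_cases:
  assumes "j \<le> y" "y < n"
  obtains r c where "y = j + d * r + c" "r < (n - j) div d" "c < d"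
proof
  show "y = j + d * ((y - j) div d) + (y - j) mod d" using assms by simp
  show "(y - j) div d < (n - j) div d"
    using d assms by (metis diff_less_mono dvd_div_mult_self less_mult_imp_div_less)
qed (use d in simp)

lemma block_rot_eq: "r < (n - j) div d \<Longrightarrow> c < d \<Longrightarrow> block_rot j n d (j + d * r + c) = j + d * r + Suc c mod d"
  using block_less[of r c] by (simp add: block_rot_def)

lemma block_rot_funpow:
  "r < (n - j) div d \<Longrightarrow> c < d \<Longrightarrow> (block_rot j n d ^^ i) (j + d * r + c) = j + d * r + (c + i) mod d"
proof (induction i)
  case (Suc i)
  then show ?case using block_rot_eq[of r "(c + i) mod d"] d by (simp add: mod_Suc_eq)
qed simp

text \<open>Injective because the \<open>d\<close>-th iterate is the identity on
  \<open>{j..<n}\<close>.\<close>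

lemma block_rot_permutes: "block_rot j n d permutes {j..<n}"
proof (rule inj_imp_permutes)
  have id: "(block_rot j n d ^^ d) y = y" if "y \<in> {j..<n}" for y
  proof -
    from that obtain r c where "y = j + d * r + c" "r < (n - j) div d" "c < d" by (auto elim: block_cases)
    then show ?thesis using block_rot_funpow[of r c d] by simp
  qed
  show "inj_on (block_rot j n d) {j..<n}"
  proof (rule inj_onI)
    fix y z assume yz: "y \<in> {j..<n}" "z \<in> {j..<n}" "block_rot j n d y = block_rot j n d z"
    obtain e where e: "d = Suc e" using d by (cases d) auto
    have "(block_rot j n d ^^ d) u = (block_rot j n d ^^ e) (block_rot j n d u)" for u
      by (subst e) (simp only: funpow_Suc_right o_apply)
    then have "(block_rot j n d ^^ d) y = (block_rot j n d ^^ d) z" using yz(3) by metis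
    then show "y = z" using id[OF yz(1)] id[OF yz(2)] by simp
  qed
  fix y assume "y \<in> {j..<n}"
  then obtain r c where y: "y = j + d * r + c" "r < (n - j) div d" "c < d" by (auto elim: block_cases)
  have "Suc c mod d < d" using d by simp
  from block_less[OF y(2) this] show "block_rot j n d y \<in> {j..<n}" using y block_rot_eq[of r c] by simp
qed (auto simp: block_rot_def)

end

section \<open>The permutation made of a standardized head and a rotated tail\<close>

definition the_inv_std :: "nat \<Rightarrow> (nat \<Rightarrow> real) \<Rightarrow> nat \<Rightarrow> nat" where
  "the_inv_std n w = (THE \<tau>. inv_std n w \<tau>)"

lemma inv_std_the: "inv_std n w (the_inv_std n w)"
  unfolding the_inv_std_def using inv_std_exists inv_std_unique by (metis theI)

lemma the_inv_std_eqI: "inv_std n w \<tau> \<Longrightarrow> the_inv_std n w = \<tau>"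
  using inv_std_the inv_std_unique by blast

lemma inv_std_cong:
  assumes "\<And>i. i < n \<Longrightarrow> w i = w' i" shows "inv_std n w \<tau> \<longleftrightarrow> inv_std n w' \<tau>"
  unfolding inv_std_def using assms permutes_lessThan_less[of \<tau> n] by (metis (no_types, lifting))

lemma the_inv_std_cong: "(\<And>i. i < n \<Longrightarrow> w i = w' i) \<Longrightarrow> the_inv_std n w = the_inv_std n w'"
  by (rule the_inv_std_eqI) (use inv_std_cong[of n w w'] inv_std_the in blast)

lemma the_inv_std_permutes: "the_inv_std n w permutes {..<n}"
  using inv_std_the[of n w] by (simp add: inv_std_def)

definition tail_period :: "nat \<Rightarrow> nat \<Rightarrow> (nat \<Rightarrow> real) \<Rightarrow> nat" where
  "tail_period n j x = cyc_period (n - j) (\<lambda>i. x (j + i))"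

text \<open>The tail is cut into blocks of the length of its period, each of which is rotated. Rotating
  the tail as one cycle would give the same label sequences, but would not preserve the order of tied positions.\<close>

definition split_perm :: "nat \<Rightarrow> nat \<Rightarrow> (nat \<Rightarrow> real) \<Rightarrow> nat \<Rightarrow> nat" where
  "split_perm n j x = the_inv_std j x \<circ> block_rot j n (tail_period n j x)"

context
  fixes n j :: nat and x :: "nat \<Rightarrow> real"
  assumes jn: "j < n"
begin

lemma tail_period_pos: "0 < tail_period n j x"
  and tail_period_dvd: "tail_period n j x dvd n - j"
  unfolding tail_period_def using jn by (simp_all add: cyc_period_pos cyc_period_dvd)

lemmas tail_block = tail_period_pos tail_period_dvd jn

lemma tail_letter_eq:
  assumes "r < (n - j) div tail_period n j x" "c < tail_period n j x"
  shows "x (j + tail_period n j x * r + c) = x (j + c)"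
proof -
  have "tail_period n j x * r + c < n - j" "c < n - j"
    using block_less[OF tail_block assms] block_less[OF tail_block _ assms(2), of 0] assms(1) by auto
  then show ?thesis
    using cyc_period_shift_mult[of "n - j" "\<lambda>i. x (j + i)" c r] jn
    by (simp add: tail_period_def add_ac)
qed

lemma split_perm_permutes: "split_perm n j x permutes {..<n}"
  unfolding split_perm_def
proof (rule permutes_compose)
  show "the_inv_std j x permutes {..<n}"
    by (rule permutes_subset[OF the_inv_std_permutes]) (use jn in auto)
  show "block_rot j n (tail_period n j x) permutes {..<n}"
    by (rule permutes_subset[OF block_rot_permutes[OF tail_block]]) auto
qed

lemma split_perm_head: "y < j \<Longrightarrow> split_perm n j x y = the_inv_std j x y"
  by (simp add: split_perm_def block_rot_def)

lemma split_perm_tail: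
  assumes "j \<le> y" "y < n" shows "split_perm n j x y = block_rot j n (tail_period n j x) y"
proof -
  have "block_rot j n (tail_period n j x) y \<in> {j..<n}"
    using permutes_in_image[OF block_rot_permutes[OF tail_block]] assms by auto
  then show ?thesis
    using permutes_not_in[OF the_inv_std_permutes[of j x]] by (simp add: split_perm_def)
qed

lemma split_perm_funpow_head: "y < j \<Longrightarrow> (split_perm n j x ^^ i) y = (the_inv_std j x ^^ i) y"
  by (induction i) (simp_all add: split_perm_head permutes_funpow_less[OF the_inv_std_permutes])

lemma split_perm_funpow_tail:
  assumes "r < (n - j) div tail_period n j x" "c < tail_period n j x"
  shows "(split_perm n j x ^^ i) (j + tail_period n j x * r + c) =
    j + tail_period n j x * r + (c + i) mod tail_period n j x"
proof (induction i)
  case (Suc i)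
  have lt: "(c + i) mod tail_period n j x < tail_period n j x" using tail_period_pos by simp
  have "(split_perm n j x ^^ Suc i) (j + tail_period n j x * r + c) =
    block_rot j n (tail_period n j x) (j + tail_period n j x * r + (c + i) mod tail_period n j x)"
    using Suc split_perm_tail block_less[OF tail_block assms(1) lt] by simp
  also have "\<dots> = j + tail_period n j x * r + (c + Suc i) mod tail_period n j x"
    using block_rot_eq[OF tail_block assms(1) lt] by (simp add: mod_Suc_eq)
  finally show ?case .
qed (use assms in simp)

lemma label_seq_head: "y < j \<Longrightarrow> label_seq x (split_perm n j x) y = label_seq x (the_inv_std j x) y"
  unfolding label_seq_def by (intro ext) (simp only: split_perm_funpow_head)

text \<open>The block number \<open>r\<close> is absent from the right-hand side: all blocks carry
  the same label sequences, namely those of the tail read as one uncut cyclic word.\<close>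

lemma label_seq_tail:
  assumes "r < (n - j) div tail_period n j x" "c < tail_period n j x"
  shows "label_seq x (split_perm n j x) (j + tail_period n j x * r + c) t =
    x (j + (c + Suc t) mod (n - j))"
proof -
  let ?d = "tail_period n j x"
  have lt: "(c + Suc t) mod ?d < ?d" using tail_period_pos by simp
  then have "(c + Suc t) mod ?d < n - j"
    using block_less[OF tail_block _ lt, of 0] assms(1) by auto
  then have "x (j + (c + Suc t) mod ?d) = x (j + (c + Suc t) mod (n - j))"
    using cyc_period_mod[of "n - j" "\<lambda>i. x (j + i)" "c + Suc t"] jn by (simp add: tail_period_def)
  then show ?thesis
    unfolding label_seq_def split_perm_funpow_tail[OF assms] tail_letter_eq[OF assms(1) lt] .
qed

text \<open>Inside the head this is the tie-break of standardization; between head and tail it holds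
  since both are invariant. Two tied tail positions have the same offset in their blocks, because
  the block length is the least period, so only the block number orders them, and rotation does not
  change it.\<close>

lemma keeps_ties_split_perm: "keeps_ties n x (split_perm n j x)"
  unfolding keeps_ties_def
proof (intro conjI allI impI split_perm_permutes)
  let ?\<tau> = "split_perm n j x" and ?d = "tail_period n j x"
  fix y z assume yz: "y < n" "z < n" "label_seq x ?\<tau> y = label_seq x ?\<tau> z" "y < z"
  consider "z < j" | "y < j" "j \<le> z" | "j \<le> y" using yz by linarith
  then show "?\<tau> y < ?\<tau> z"
  proof cases
    case 1
    then have "y < j" using yz by simp
    have "x (the_inv_std j x y) = x (the_inv_std j x z)"
      using fun_cong[OF yz(3), of 0] 1 \<open>y < j\<close> by (simp add: label_seq_0 split_perm_head)
    moreover have "y < z \<longleftrightarrow> x (the_inv_std j x y) < x (the_inv_std j x z) \<or>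
        (x (the_inv_std j x y) = x (the_inv_std j x z) \<and> the_inv_std j x y < the_inv_std j x z)"
      using inv_std_the[of j x] 1 \<open>y < j\<close> unfolding inv_std_def by blast
    ultimately have "the_inv_std j x y < the_inv_std j x z"
      using yz(4) by simp
    then show ?thesis using 1 \<open>y < j\<close> by (simp add: split_perm_head)
  next
    case 2
    have "?\<tau> y < j" using 2 permutes_lessThan_less[OF the_inv_std_permutes] by (simp add: split_perm_head)
    moreover have "j \<le> ?\<tau> z"
      using permutes_in_image[OF block_rot_permutes[OF tail_block], of z] 2 yz by (simp add: split_perm_tail)
    ultimately show ?thesis by simp
  next
    case 3
    obtain r c where y: "y = j + ?d * r + c" "r < (n - j) div ?d" "c < ?d"
      using 3 yz(1) by (rule block_cases[OF tail_block])
    have "j \<le> z" using 3 yz by simp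
    from this yz(2) obtain r' c' where z: "z = j + ?d * r' + c'" "r' < (n - j) div ?d" "c' < ?d"
      by (rule block_cases[OF tail_block])
    have seq: "x (j + (c + Suc t) mod (n - j)) = x (j + (c' + Suc t) mod (n - j))" for t
      using fun_cong[OF yz(3), of t] label_seq_tail y z by simp
    have "c = c'"
    proof (cases "c \<le> c'")
      case True
      then show ?thesis
        using cyc_period_offset_eq[of "n - j" c c' "\<lambda>i. x (j + i)"] jn z(3) seq
        by (simp add: tail_period_def)
    next
      case False
      then show ?thesis
        using cyc_period_offset_eq[of "n - j" c' c "\<lambda>i. x (j + i)"] jn y(3) seq
        by (simp add: tail_period_def)
    qed
    then have "?\<tau> y = j + ?d * r + Suc c mod ?d" "?\<tau> z = j + ?d * r' + Suc c mod ?d"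
      using y z split_perm_funpow_tail[of _ _ 1] by auto
    then show ?thesis using yz(4) \<open>c = c'\<close> y z by simp
  qed
qed

end

section \<open>The sorted word and the recovery of the original pair\<close>

definition std_sort :: "nat \<Rightarrow> nat \<Rightarrow> (nat \<Rightarrow> real) \<Rightarrow> nat \<Rightarrow> nat" where
  "std_sort n j x = sort_perm n x (split_perm n j x)"

text \<open>For \<open>j < n\<close> this is the inverse standardization of
  \<open>std_word n j x\<close>, by \<open>inv_std_std_word\<close>.\<close>

definition std_conj :: "nat \<Rightarrow> nat \<Rightarrow> (nat \<Rightarrow> real) \<Rightarrow> nat \<Rightarrow> nat" where
  "std_conj n j x = std_sort n j x \<circ> split_perm n j x \<circ> inv (std_sort n j x)"

definition std_word :: "nat \<Rightarrow> nat \<Rightarrow> (nat \<Rightarrow> real) \<Rightarrow> nat \<Rightarrow> real" where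
  "std_word n j x = x \<circ> inv (std_sort n j x)"

lemma std_sort_permutes: "std_sort n j x permutes {..<n}"
  unfolding std_sort_def by (rule sort_perm_permutes)

lemma inv_std_std_word: "j < n \<Longrightarrow> inv_std n (std_word n j x) (std_conj n j x)"
  unfolding std_word_def std_conj_def std_sort_def by (rule inv_std_sorted[OF keeps_ties_split_perm])

lemma std_conj_funpow:
  "(std_conj n j x ^^ i) (std_sort n j x y) = std_sort n j x ((split_perm n j x ^^ i) y)"
  by (induction i) (simp_all add: std_conj_def permutes_inverses(2)[OF std_sort_permutes])

lemma label_seq_std_word:
  "label_seq (std_word n j x) (std_conj n j x) (std_sort n j x y) = label_seq x (split_perm n j x) y"
  unfolding label_seq_def std_conj_funpow by (simp add: std_word_def permutes_inverses(2)[OF std_sort_permutes])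

text \<open>The right-hand side depends only on the sorted word and on the image of \<open>j\<close>. This is why the tail,
  and then the whole pair, can be recovered from them.\<close>

lemma std_sort_tail_image:
  assumes jn: "j < n"
  shows "std_sort n j x ` {j..<n} =
    {(std_conj n j x ^^ i) u | i u. u < n \<and> std_sort n j x j \<le> u \<and>
       label_seq (std_word n j x) (std_conj n j x) u =
       label_seq (std_word n j x) (std_conj n j x) (std_sort n j x j)}" (is "?L = ?R")
proof (intro set_eqI iffI)
  let ?\<tau> = "split_perm n j x" and ?d = "tail_period n j x" and ?\<theta> = "std_sort n j x"
  note blk = tail_period_pos[OF jn, of x] tail_period_dvd[OF jn, of x] jn
  have m: "0 < (n - j) div ?d" using blk jn by (simp add: dvd_imp_le div_greater_zero_iff)
  {
    fix u assume "u \<in> ?L"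
    then obtain y where u: "u = ?\<theta> y" "j \<le> y" "y < n" by auto
    obtain r c where y: "y = j + ?d * r + c" "r < (n - j) div ?d" "c < ?d"
      using u(2,3) by (rule block_cases[OF blk])
    \<comment> \<open>The start of the block of \<open>y\<close>: it shares the label sequence of
      \<open>j\<close>, and \<open>y\<close> is reached from it by \<open>c\<close>
      rotations.\<close>
    let ?z = "j + ?d * r"
    have lz: "label_seq x ?\<tau> ?z = label_seq x ?\<tau> j"
      using label_seq_tail[OF jn y(2), of 0] label_seq_tail[OF jn m, of 0] blk(1) by (intro ext) simp
    have zn: "?z < n" using y u by simp
    have "\<not> ?\<theta> ?z < ?\<theta> j"
      unfolding std_sort_def using sort_perm_less_iff[OF zn jn] lz by (simp add: seq_before_def lexless_irrefl)
    moreover have "u = (std_conj n j x ^^ c) (?\<theta> ?z)"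
      using split_perm_funpow_tail[OF jn y(2), of 0 c] blk(1) y u by (simp add: std_conj_funpow)
    moreover have "?\<theta> ?z < n" by (rule permutes_lessThan_less[OF std_sort_permutes zn])
    ultimately show "u \<in> ?R" using lz
      by - (rule CollectI, rule exI[of _ c], rule exI[of _ "?\<theta> ?z"], simp add: label_seq_std_word)
  next
    fix u assume "u \<in> ?R"
    then obtain i v where v: "u = (std_conj n j x ^^ i) v" "v < n" "?\<theta> j \<le> v"
      "label_seq (std_word n j x) (std_conj n j x) v = label_seq (std_word n j x) (std_conj n j x) (?\<theta> j)"
      by blast
    define y where "y = inv ?\<theta> v"
    have vy: "v = ?\<theta> y" by (simp add: y_def permutes_inverses(1)[OF std_sort_permutes])
    have yn: "y < n" unfolding y_def by (rule permutes_lessThan_less[OF permutes_inv[OF std_sort_permutes] v(2)])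
    have "label_seq x ?\<tau> y = label_seq x ?\<tau> j" using v(4) vy by (simp add: label_seq_std_word)
    moreover have "\<not> seq_before x ?\<tau> y j"
      using v(3) sort_perm_less_iff[OF yn jn, of x ?\<tau>] unfolding vy std_sort_def by simp
    \<comment> \<open>A head position with the label sequence of \<open>j\<close> would come before
      \<open>j\<close> in \<open>seq_before\<close>, as ties are broken by position.\<close>
    ultimately have "j \<le> y" by (simp add: seq_before_def)
    obtain r c where y: "y = j + ?d * r + c" "r < (n - j) div ?d" "c < ?d"
      using \<open>j \<le> y\<close> yn by (rule block_cases[OF blk])
    have "(c + i) mod ?d < ?d" using blk(1) by simp
    from block_less[OF blk y(2) this] have "(?\<tau> ^^ i) y \<in> {j..<n}"
      using split_perm_funpow_tail[OF jn y(2,3)] y(1) by simp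
    then show "u \<in> ?L" unfolding v(1) vy std_conj_funpow by blast
  }
qed

text \<open>The sorted word determines its inverse standardization. Together with the image of
  \<open>j\<close> this gives the image of the tail, whose size gives \<open>j\<close>. The head
  fills the complement in increasing order, and the tail is read off the label sequence at the image
  of \<open>j\<close>.\<close>

lemma std_word_inj:
  assumes jn: "j < n" "j' < n"
    and w: "\<And>i. i < n \<Longrightarrow> std_word n j x i = std_word n j' x' i"
    and k: "std_sort n j x j = std_sort n j' x' j'"
  shows "j = j'" "i < n \<Longrightarrow> x i = x' i"
proof -
  have conj: "std_conj n j x = std_conj n j' x'"
    using inv_std_std_word[OF jn(1), of x] inv_std_std_word[OF jn(2), of x'] inv_std_cong[of n "std_word n j x" "std_word n j' x'"]
      w inv_std_unique by blast
  have perm: "std_conj n j x permutes {..<n}" using inv_std_std_word[OF jn(1)] by (simp add: inv_std_def)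
  have lab: "label_seq (std_word n j x) (std_conj n j x) u = label_seq (std_word n j' x') (std_conj n j' x') u"
    if "u < n" for u
    unfolding label_seq_def conj[symmetric] using w permutes_funpow_less[OF perm that] by (intro ext) blast
  have Kn: "std_sort n j x j < n" by (rule permutes_lessThan_less[OF std_sort_permutes jn(1)])
  have A: "std_sort n j x ` {j..<n} = std_sort n j' x' ` {j'..<n}"
    unfolding std_sort_tail_image[OF jn(1)] std_sort_tail_image[OF jn(2)]
    using conj k lab Kn by (intro Collect_cong) (metis (no_types, lifting))
  have inj: "inj (std_sort n j x)" for j x by (rule permutes_inj[OF std_sort_permutes])
  have "n - j = card (std_sort n j x ` {j..<n})" by (simp add: card_image inj_on_subset[OF inj])
  also have "\<dots> = n - j'" unfolding A by (simp add: card_image inj_on_subset[OF inj])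
  finally show jj: "j = j'" using jn by simp
  have head: "std_sort n j x y = std_sort n j x' y" if "y < j" for y
  proof (rule strict_mono_bij_lessThan_unique[OF _ _ _ that])
    \<comment> \<open>In the head, sorting never changes the relative order, because there the label
      sequences come from a standardization.\<close>
    have mono: "std_sort n j x y < std_sort n j x z" if "y < z" "z < j" for y z x
    proof -
      have "seq_before x (the_inv_std j x) y z"
        using inv_std_seq_before_iff[OF inv_std_the, of y j z x] that by simp
      then have "seq_before x (split_perm n j x) y z"
        using that label_seq_head[OF jn(1)] by (simp add: seq_before_def)
      then show ?thesis using sort_perm_less_iff[of y n z] that jn by (simp add: std_sort_def)
    qed
    show "std_sort n j x y < std_sort n j x z" "std_sort n j x' y < std_sort n j x' z"
      if "y < z" "z < j" for y z using mono that by auto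
    have "{..<j} = {..<n} - {j..<n}" using jn by auto
    then have "std_sort n j x ` {..<j} = {..<n} - std_sort n j x ` {j..<n}" for x
      using image_set_diff[OF inj] permutes_image[OF std_sort_permutes] by metis
    then show "std_sort n j x ` {..<j} = std_sort n j x' ` {..<j}" using A jj by simp
  qed
  show "x i = x' i" if i: "i < n"
  proof (cases "i < j")
    case True
    have "x i = std_word n j x (std_sort n j x i)" for x
      by (simp add: std_word_def permutes_inverses(2)[OF std_sort_permutes])
    then show ?thesis
      using head[OF True] w[OF permutes_lessThan_less[OF std_sort_permutes i]] jj by metis
  next
    case False
    have lx: "label_seq x (split_perm n j x) j t = x (j + Suc t mod (n - j))" for x t
    proof -
      have "0 < (n - j) div tail_period n j x"
        using tail_period_pos[OF jn(1), of x] tail_period_dvd[OF jn(1), of x] jn by (simp add: dvd_imp_le div_greater_zero_iff)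
      then show ?thesis using label_seq_tail[OF jn(1), of 0 x 0 t] tail_period_pos[OF jn(1), of x] by simp
    qed
    have "label_seq x (split_perm n j x) j = label_seq x' (split_perm n j x') j"
      using lab[OF Kn] k unfolding jj[symmetric] by (metis label_seq_std_word)
    then have "x (j + Suc t mod (n - j)) = x' (j + Suc t mod (n - j))" for t using lx by metis
    \<comment> \<open>The index \<open>t\<close> with \<open>Suc t = i - j + (n - j)\<close>,
      congruent to \<open>i - j\<close>; the extra \<open>n - j\<close> is needed because
      \<open>i - j\<close> may be 0.\<close>
    note this[of "i - j + (n - j) - 1"]
    moreover have "Suc (i - j + (n - j) - 1) = i - j + (n - j)" using jn by simp
    moreover have "i - j < n - j" using False i by simp
    then have "(i - j + (n - j)) mod (n - j) = i - j" by (simp only: mod_add_self2 mod_less)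
    ultimately show ?thesis using False by simp
  qed
qed

section \<open>Cycle types\<close>

definition cycle_type :: "nat \<Rightarrow> (nat \<Rightarrow> nat) \<Rightarrow> nat multiset" where
  "cycle_type n \<tau> = image_mset card (mset_set (orbit \<tau> ` {..<n}))"

definition word_cycles :: "nat \<Rightarrow> (nat \<Rightarrow> real) \<Rightarrow> nat multiset" where
  "word_cycles n w = cycle_type n (the_inv_std n w)"

lemma word_cycles_cong: "(\<And>i. i < n \<Longrightarrow> w i = w' i) \<Longrightarrow> word_cycles n w = word_cycles n w'"
  unfolding word_cycles_def using the_inv_std_cong by metis

lemma image_mset_card_image:
  assumes "inj h"
  shows "image_mset card (mset_set ((`) h ` X)) = image_mset card (mset_set X)"
proof -
  have "inj_on ((`) h) X" using assms by (simp add: inj_on_def inj_image_eq_iff)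
  then have "image_mset card (mset_set ((`) h ` X)) = image_mset (card \<circ> (`) h) (mset_set X)"
    by (simp flip: image_mset_mset_set add: image_mset.compositionality)
  also have "\<dots> = image_mset card (mset_set X)"
    by (rule image_mset_cong) (simp add: card_image inj_on_subset[OF assms])
  finally show ?thesis .
qed

lemma orbit_semiconj:
  assumes "\<And>y. f (h y) = h (g y)" shows "orbit f (h y) = h ` orbit g y"
proof -
  have "(f ^^ i) (h y) = h ((g ^^ i) y)" for i by (induction i) (simp_all add: assms)
  then show ?thesis by (auto simp: orbit_altdef)
qed

lemma cycle_type_conj:
  assumes "\<theta> permutes {..<n}"
  shows "cycle_type n (\<theta> \<circ> \<tau> \<circ> inv \<theta>) = cycle_type n \<tau>"
proof -
  have "orbit (\<theta> \<circ> \<tau> \<circ> inv \<theta>) (\<theta> y) = \<theta> ` orbit \<tau> y" for y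
    by (rule orbit_semiconj) (simp add: permutes_inverses(2)[OF assms])
  then have "(\<lambda>y. orbit (\<theta> \<circ> \<tau> \<circ> inv \<theta>) (\<theta> y)) ` {..<n} = (`) \<theta> ` orbit \<tau> ` {..<n}"
    by (simp add: image_image)
  then have "orbit (\<theta> \<circ> \<tau> \<circ> inv \<theta>) ` {..<n} = (`) \<theta> ` orbit \<tau> ` {..<n}"
    using permutes_image[OF assms] by (metis image_image)
  then show ?thesis
    unfolding cycle_type_def using image_mset_card_image[OF permutes_inj[OF assms]] by simp
qed

lemma permutes_orbit_le:
  "\<tau> permutes {..<n} \<Longrightarrow> y < n \<Longrightarrow> orbit \<tau> y \<subseteq> {..<n::nat}"
  by (auto simp: orbit_altdef permutes_funpow_less)

text \<open>Head positions keep the orbits of the standardized head, and every block of the tail is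
  exactly one orbit.\<close>

lemma cycle_type_split_perm:
  assumes jn: "j < n"
  shows "cycle_type n (split_perm n j x) =
    word_cycles j x + replicate_mset ((n - j) div tail_period n j x) (tail_period n j x)"
proof -
  let ?\<tau> = "split_perm n j x" and ?d = "tail_period n j x"
  note blk = tail_period_pos[OF jn, of x] tail_period_dvd[OF jn, of x] jn
  define m where "m = (n - j) div ?d"
  define B where "B r = {j + ?d * r ..< j + ?d * r + ?d}" for r
  have head: "orbit ?\<tau> y = orbit (the_inv_std j x) y" if "y < j" for y
    using split_perm_funpow_head[OF jn that] by (simp add: orbit_altdef)
  have tail: "orbit ?\<tau> (j + ?d * r + c) = B r" if rc: "r < m" "c < ?d" for r c
  proof (intro set_eqI iffI)
    fix y assume "y \<in> orbit ?\<tau> (j + ?d * r + c)"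
    then obtain i where "y = (?\<tau> ^^ i) (j + ?d * r + c)" by (auto simp: orbit_altdef)
    then show "y \<in> B r" using split_perm_funpow_tail[OF jn] rc blk(1) by (auto simp: B_def m_def)
  next
    fix y assume "y \<in> B r"
    define e where "e = y - (j + ?d * r)"
    have e: "y = j + ?d * r + e" "e < ?d" using \<open>y \<in> B r\<close> by (auto simp: B_def e_def)
    \<comment> \<open>This many rotations lead from offset \<open>c\<close> to offset
      \<open>e\<close>; the added \<open>?d\<close> makes the number positive, as an orbit consists
      of positive iterates only.\<close>
    have "(?\<tau> ^^ (?d + e - c)) (j + ?d * r + c) = y"
      using split_perm_funpow_tail[OF jn] rc e by (simp add: m_def)
    moreover have "0 < ?d + e - c" using rc by simp
    ultimately show "y \<in> orbit ?\<tau> (j + ?d * r + c)" unfolding orbit_altdef by blast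
  qed
  have "orbit ?\<tau> ` {j..<n} = B ` {..<m}"
  proof (intro set_eqI iffI)
    fix S assume "S \<in> orbit ?\<tau> ` {j..<n}"
    then obtain y where y: "S = orbit ?\<tau> y" "j \<le> y" "y < n" by auto
    obtain r c where "y = j + ?d * r + c" "r < (n - j) div ?d" "c < ?d"
      using y(2,3) by (rule block_cases[OF blk])
    then show "S \<in> B ` {..<m}" using y tail by (simp add: m_def)
  next
    fix S assume "S \<in> B ` {..<m}"
    then obtain r where r: "S = B r" "r < m" by auto
    then have "S = orbit ?\<tau> (j + ?d * r)" using tail[of r 0] blk by simp
    moreover have "j + ?d * r < n" using block_less[OF blk _ blk(1), of r] r by (simp add: m_def)
    ultimately show "S \<in> orbit ?\<tau> ` {j..<n}" by auto
  qed
  moreover have "{..<n} = {..<j} \<union> {j..<n}" using jn by auto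
  ultimately have U: "orbit ?\<tau> ` {..<n} = orbit (the_inv_std j x) ` {..<j} \<union> B ` {..<m}"
    using head by (simp add: image_Un)
  have disj: "orbit (the_inv_std j x) ` {..<j} \<inter> B ` {..<m} = {}"
  proof -
    have "orbit (the_inv_std j x) y \<noteq> B r" if "y < j" for y r
    proof
      assume "orbit (the_inv_std j x) y = B r"
      then have "j + ?d * r \<in> orbit (the_inv_std j x) y" using blk(1) by (simp add: B_def)
      then show False using permutes_orbit_le[OF the_inv_std_permutes that, of x] by auto
    qed
    then show ?thesis by auto
  qed
  \<comment> \<open>The orbits form a set, so the blocks have to be distinct for their equal sizes
    to be counted \<open>m\<close> times; their minima tell them apart.\<close>
  have injB: "inj_on B {..<m}"
  proof (rule inj_onI)
    fix r s assume "B r = B s"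
    then have "Min (B r) = Min (B s)" by simp
    moreover have "Min (B r) = j + ?d * r" for r using blk(1) by (intro Min_eqI) (auto simp: B_def)
    ultimately show "r = s" using blk(1) by simp
  qed
  have "image_mset card (mset_set (B ` {..<m})) = image_mset (card \<circ> B) (mset_set {..<m})"
    using injB by (simp flip: image_mset_mset_set add: image_mset.compositionality)
  also have "\<dots> = image_mset (\<lambda>_. ?d) (mset_set {..<m})"
    by (rule image_mset_cong) (simp add: B_def)
  also have "\<dots> = replicate_mset m ?d" by (simp add: image_mset_const_eq)
  finally show ?thesis
    unfolding cycle_type_def word_cycles_def U
    by (subst mset_set_Union[OF _ _ disj]) (auto simp: m_def)
qed

lemma word_cycles_std_word:
  assumes "j < n"
  shows "word_cycles n (std_word n j x) =
    word_cycles j x + replicate_mset ((n - j) div tail_period n j x) (tail_period n j x)"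
proof -
  have "the_inv_std n (std_word n j x) = std_conj n j x"
    by (rule the_inv_std_eqI[OF inv_std_std_word[OF assms]])
  then have "word_cycles n (std_word n j x) = cycle_type n (split_perm n j x)"
    using cycle_type_conj[OF std_sort_permutes] by (simp add: word_cycles_def std_conj_def)
  then show ?thesis using cycle_type_split_perm[OF assms] by simp
qed

text \<open>The orbits partition \<open>{..<n}\<close>. This is what puts the normalized cycle
  lengths into \<open>Delta_infty\<close>.\<close>

lemma sum_mset_word_cycles: "sum_mset (word_cycles n w) = n"
proof -
  have p: "permutation (the_inv_std n w)"
    using the_inv_std_permutes permutation_permutes by blast
  have eq: "orbit (the_inv_std n w) z = orbit (the_inv_std n w) y" if "z \<in> orbit (the_inv_std n w) y" for y z
    using orbit_cyclic_eq3[OF cyclic_on_orbit[OF the_inv_std_permutes finite_lessThan] that] .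
  have "sum_mset (word_cycles n w) = (\<Sum>S\<in>orbit (the_inv_std n w) ` {..<n}. card S)"
    by (simp add: word_cycles_def cycle_type_def sum_unfold_sum_mset)
  also have "\<dots> = card (\<Union>(orbit (the_inv_std n w) ` {..<n}))"
  proof (rule card_Union_disjoint[symmetric])
    show "pairwise disjnt (orbit (the_inv_std n w) ` {..<n})"
    proof (rule pairwiseI)
      fix S T assume ST: "S \<in> orbit (the_inv_std n w) ` {..<n}" "T \<in> orbit (the_inv_std n w) ` {..<n}" "S \<noteq> T"
      then obtain a b where ab: "S = orbit (the_inv_std n w) a" "T = orbit (the_inv_std n w) b" by blast
      show "disjnt S T"
      proof (rule ccontr)
        assume "\<not> disjnt S T"
        then obtain z where "z \<in> orbit (the_inv_std n w) a" "z \<in> orbit (the_inv_std n w) b"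
          by (auto simp: disjnt_def ab)
        then show False using eq ab ST(3) by metis
      qed
    qed
    show "finite S" if "S \<in> orbit (the_inv_std n w) ` {..<n}" for S
      using that finite_subset[OF permutes_orbit_le[OF the_inv_std_permutes] finite_lessThan] by auto
  qed
  also have "\<Union>(orbit (the_inv_std n w) ` {..<n}) = {..<n}"
  proof
    show "\<Union>(orbit (the_inv_std n w) ` {..<n}) \<subseteq> {..<n}"
      by (rule UN_least) (rule permutes_orbit_le[OF the_inv_std_permutes], simp)
    show "{..<n} \<subseteq> \<Union>(orbit (the_inv_std n w) ` {..<n})"
      using permutation_self_in_orbit[OF p] by (intro subsetI UN_I)
  qed
  finally show ?thesis by simp
qed

text \<open>Links the definite description with \<open>the_inv_std\<close>: invert, and move the
  indices by one with 0 fixed. Uniqueness holds because the value at \<open>k\<close> must be one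
  more than the number of positions that precede \<open>k\<close>.\<close>

lemma std_perm_eq:
  fixes g :: "nat \<Rightarrow> real" and n :: nat
  defines "\<tau> \<equiv> the_inv_std n (\<lambda>i. g (Suc i))"
  shows "std_perm n g = (\<lambda>k. case k of 0 \<Rightarrow> 0 | Suc i \<Rightarrow> Suc (inv \<tau> i))"
proof -
  define s where "s k = (case k of 0 \<Rightarrow> 0 | Suc i \<Rightarrow> Suc (inv \<tau> i))" for k
  have s_simps: "s 0 = 0" "s (Suc i) = Suc (inv \<tau> i)" for i by (simp_all add: s_def)
  define lt where "lt j k \<longleftrightarrow> g j < g k \<or> (g j = g k \<and> j < k)" for j k :: nat
  have \<tau>: "inv_std n (\<lambda>i. g (Suc i)) \<tau>" unfolding \<tau>_def by (rule inv_std_the)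
  then have perm: "\<tau> permutes {..<n}" by (simp add: inv_std_def)
  note iperm = permutes_inv[OF perm]
  have "s permutes {1..n}"
  proof (rule inj_imp_permutes)
    show "inj_on s {1..n}"
    proof (rule inj_onI)
      fix j k assume "j \<in> {1..n}" "k \<in> {1..n}" "s j = s k"
      then show "j = k" using injD[OF permutes_inj[OF iperm]] by (cases j; cases k) (auto simp: s_simps)
    qed
    show "s k \<in> {1..n}" if "k \<in> {1..n}" for k
      using that permutes_lessThan_less[OF iperm, of "k - 1"] by (cases k) (auto simp: s_simps)
    show "s k = k" if "k \<notin> {1..n}" for k
      using that permutes_not_in[OF iperm, of "k - 1"] by (cases k) (auto simp: s_simps)
  qed simp
  moreover have "s j < s k \<longleftrightarrow> lt j k" if jk: "j \<in> {1..n}" "k \<in> {1..n}" for j k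
  proof -
    obtain y z where yz: "j = Suc y" "k = Suc z" "y < n" "z < n"
      using jk by (cases j; cases k) auto
    have "inv \<tau> y < n" "inv \<tau> z < n" using yz permutes_lessThan_less[OF iperm] by auto
    then have "inv \<tau> y < inv \<tau> z \<longleftrightarrow> g (Suc y) < g (Suc z) \<or> (g (Suc y) = g (Suc z) \<and> y < z)"
      using \<tau> unfolding inv_std_def by (simp add: permutes_inverses(1)[OF perm])
    then show ?thesis by (simp add: yz lt_def s_simps)
  qed
  moreover have "\<sigma> = \<sigma>'" if "\<sigma> permutes {1..n}" "\<forall>j\<in>{1..n}. \<forall>k\<in>{1..n}. \<sigma> j < \<sigma> k \<longleftrightarrow> lt j k"
    "\<sigma>' permutes {1..n}" "\<forall>j\<in>{1..n}. \<forall>k\<in>{1..n}. \<sigma>' j < \<sigma>' k \<longleftrightarrow> lt j k" for \<sigma> \<sigma>'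
  proof -
    have pred: "{i\<in>{1..n}. i < \<sigma> k} = \<sigma> ` {j\<in>{1..n}. lt j k}"
      if "\<sigma> permutes {1..n}" "\<forall>j\<in>{1..n}. \<forall>k\<in>{1..n}. \<sigma> j < \<sigma> k \<longleftrightarrow> lt j k" "k \<in> {1..n}" for \<sigma> k
    proof -
      have "{i\<in>\<sigma> ` {1..n}. i < \<sigma> k} = \<sigma> ` {j\<in>{1..n}. \<sigma> j < \<sigma> k}" by auto
      also have "{j\<in>{1..n}. \<sigma> j < \<sigma> k} = {j\<in>{1..n}. lt j k}" using that by blast
      finally show ?thesis unfolding permutes_image[OF that(1)] .
    qed
    have val: "\<sigma> k = Suc (card {j\<in>{1..n}. lt j k})"
      if "\<sigma> permutes {1..n}" "\<forall>j\<in>{1..n}. \<forall>k\<in>{1..n}. \<sigma> j < \<sigma> k \<longleftrightarrow> lt j k" "k \<in> {1..n}" for \<sigma> k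
    proof -
      have in1: "\<sigma> k \<in> {1..n}" using permutes_in_image[OF that(1)] that(3) by simp
      then have "{i\<in>{1..n}. i < \<sigma> k} = {1..<\<sigma> k}" by auto
      then have "card {i\<in>{1..n}. i < \<sigma> k} = \<sigma> k - 1" by simp
      moreover have "card (\<sigma> ` {j\<in>{1..n}. lt j k}) = card {j\<in>{1..n}. lt j k}"
        by (rule card_image) (rule inj_on_subset[OF permutes_inj[OF that(1)]], simp)
      ultimately show ?thesis using pred[OF that] in1 by auto
    qed
    show ?thesis
    proof
      fix k show "\<sigma> k = \<sigma>' k"
        using val[OF that(1,2)] val[OF that(3,4)] permutes_not_in[OF that(1)] permutes_not_in[OF that(3)]
        by (cases "k \<in> {1..n}") auto
    qed
  qed
  ultimately have "std_perm n g = s"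
    unfolding std_perm_def lt_def[symmetric] by (intro the_equality) blast+
  then show ?thesis by (simp add: s_def[abs_def])
qed

text \<open>A permutation and its inverse have the same orbits, so the inverse standardization
  yields the same cycle sizes.\<close>

lemma cycle_sizes_std_perm:
  "cycle_sizes n (std_perm n g) = rev (sorted_list_of_multiset (word_cycles n (\<lambda>i. g (Suc i))))"
proof -
  let ?\<tau> = "the_inv_std n (\<lambda>i. g (Suc i))"
  have p: "permutation ?\<tau>" using the_inv_std_permutes permutation_permutes by blast
  have "orbit (std_perm n g) (Suc y) = Suc ` orbit ?\<tau> y" for y
    unfolding orbit_inv_eq[OF p, symmetric] by (rule orbit_semiconj) (simp add: std_perm_eq)
  then have "orbit (std_perm n g) ` Suc ` {..<n} = (`) Suc ` orbit ?\<tau> ` {..<n}"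
    by (simp add: image_image)
  moreover have "Suc ` {..<n} = {1..n}" by (simp add: image_Suc_lessThan)
  ultimately show ?thesis
    unfolding cycle_sizes_def word_cycles_def cycle_type_def
    using image_mset_card_image[of Suc "orbit ?\<tau> ` {..<n}"] by simp
qed

section \<open>Test functions on the space of decreasing sequences\<close>

text \<open>Rational thresholds separate points, and their countability makes the Borel sets of
  \<^typ>\<open>rat \<Rightarrow> real\<close> those of the product.\<close>

definition excess :: "rat \<Rightarrow> real \<Rightarrow> real" where
  "excess c t = max 0 (t - of_rat c)"

lemma excess_nonneg: "0 \<le> excess c t"
  by (simp add: excess_def)

lemma excess_le: "0 < c \<Longrightarrow> 0 \<le> t \<Longrightarrow> excess c t \<le> t"
  by (simp add: excess_def)

lemma excess_0: "0 < c \<Longrightarrow> excess c 0 = 0"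
  by (simp add: excess_def)

lemma excess_lipschitz: "\<bar>excess c t - excess c t'\<bar> \<le> \<bar>t - t'\<bar>"
  by (auto simp: excess_def max_def)

text \<open>Additivity over the entries is what suits the recursion: removing a cycle or a piece
  removes one term, so the past enters only through a function \<open>a\<close> of the
  threshold.\<close>

definition profile :: "(nat \<Rightarrow> real) \<Rightarrow> rat \<Rightarrow> real" where
  "profile x c = (\<Sum>j. excess c (x j))"

context
  fixes x :: "nat \<Rightarrow> real" and c :: rat
  assumes c: "0 < c" and x: "\<And>j. 0 \<le> x j" "summable x"
begin

lemma summable_excess: "summable (\<lambda>j. excess c (x j))"
  by (rule summable_comparison_test'[OF x(2)]) (simp add: excess_nonneg excess_le c x)

lemma profile_nonneg: "0 \<le> profile x c"
  unfolding profile_def by (intro suminf_nonneg summable_excess excess_nonneg)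

lemma profile_le_suminf: "profile x c \<le> suminf x"
  unfolding profile_def by (intro suminf_le summable_excess x excess_le c)

end

lemma profile_lipschitz:
  assumes c: "0 < c" and x: "\<And>j. 0 \<le> x j" "summable x" and y: "\<And>j. 0 \<le> y j" "summable y"
    and d: "summable (\<lambda>j. \<bar>x j - y j\<bar>)"
  shows "\<bar>profile x c - profile y c\<bar> \<le> (\<Sum>j. \<bar>x j - y j\<bar>)"
proof -
  have s: "summable (\<lambda>j. \<bar>excess c (x j) - excess c (y j)\<bar>)"
    by (rule summable_comparison_test'[OF d]) (simp add: excess_lipschitz)
  have "\<bar>profile x c - profile y c\<bar> = \<bar>\<Sum>j. excess c (x j) - excess c (y j)\<bar>"
    unfolding profile_def
    by (subst suminf_diff) (use summable_excess[OF c x] summable_excess[OF c y] in auto)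
  also have "\<dots> \<le> (\<Sum>j. \<bar>excess c (x j) - excess c (y j)\<bar>)" by (rule summable_rabs[OF s])
  also have "\<dots> \<le> (\<Sum>j. \<bar>x j - y j\<bar>)" by (intro suminf_le s d excess_lipschitz)
  finally show ?thesis .
qed

text \<open>One \<open>L\<close> serves as bound and as Lipschitz constant. Boundedness is required
  so that products are Lipschitz again, as an algebra of functions demands.\<close>

definition lip_test :: "real \<Rightarrow> rat set \<Rightarrow> ((rat \<Rightarrow> real) \<Rightarrow> real) \<Rightarrow> bool" where
  "lip_test L C Q \<longleftrightarrow> 0 \<le> L \<and> finite C \<and> (\<forall>c\<in>C. 0 < c) \<and> (\<forall>a. \<bar>Q a\<bar> \<le> L) \<and>
     (\<forall>a b. \<bar>Q a - Q b\<bar> \<le> L * (\<Sum>c\<in>C. \<bar>a c - b c\<bar>))"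

lemma lip_testD:
  assumes "lip_test L C Q"
  shows "0 \<le> L" "finite C" "\<And>c. c \<in> C \<Longrightarrow> 0 < c" "\<bar>Q a\<bar> \<le> L" "\<bar>Q a - Q b\<bar> \<le> L * (\<Sum>c\<in>C. \<bar>a c - b c\<bar>)"
  using assms by (auto simp: lip_test_def)

lemma lip_test_const: "lip_test \<bar>k\<bar> {} (\<lambda>_. k)"
  by (simp add: lip_test_def)

text \<open>The truncation makes the coordinate bounded; profiles of elements of
  \<open>Delta_infty\<close> lie in \<open>[0, 1]\<close> and are not affected.\<close>

lemma lip_test_coord: "0 < c \<Longrightarrow> lip_test 1 {c} (\<lambda>a. max 0 (min 1 (a c)))"
  by (auto simp: lip_test_def)

lemma lip_test_add:
  assumes "lip_test L C Q" "lip_test L' C' Q'"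
  shows "lip_test (L + L') (C \<union> C') (\<lambda>a. Q a + Q' a)"
proof -
  note Q = lip_testD[OF assms(1)] and Q' = lip_testD[OF assms(2)]
  have "\<bar>Q a + Q' a - (Q b + Q' b)\<bar> \<le> (L + L') * (\<Sum>c\<in>C \<union> C'. \<bar>a c - b c\<bar>)" for a b
  proof -
    have "\<bar>Q a + Q' a - (Q b + Q' b)\<bar> \<le> \<bar>Q a - Q b\<bar> + \<bar>Q' a - Q' b\<bar>" by simp
    also have "\<dots> \<le> L * (\<Sum>c\<in>C. \<bar>a c - b c\<bar>) + L' * (\<Sum>c\<in>C'. \<bar>a c - b c\<bar>)"
      by (intro add_mono Q Q')
    also have "\<dots> \<le> L * (\<Sum>c\<in>C \<union> C'. \<bar>a c - b c\<bar>) + L' * (\<Sum>c\<in>C \<union> C'. \<bar>a c - b c\<bar>)"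
      using Q(1,2) Q'(1,2) by (intro add_mono mult_left_mono sum_mono2) auto
    finally show ?thesis by (simp add: algebra_simps)
  qed
  moreover have "\<bar>Q a + Q' a\<bar> \<le> L + L'" for a
    using Q(4)[of a] Q'(4)[of a] by linarith
  ultimately show ?thesis using Q(1-3) Q'(1-3) unfolding lip_test_def by auto
qed

lemma lip_test_mult:
  assumes "lip_test L C Q" "lip_test L' C' Q'"
  shows "lip_test (2 * L * L') (C \<union> C') (\<lambda>a. Q a * Q' a)"
proof -
  note Q = lip_testD[OF assms(1)] and Q' = lip_testD[OF assms(2)]
  have "\<bar>Q a * Q' a - Q b * Q' b\<bar> \<le> 2 * L * L' * (\<Sum>c\<in>C \<union> C'. \<bar>a c - b c\<bar>)" for a b
  proof -
    let ?S = "\<Sum>c\<in>C \<union> C'. \<bar>a c - b c\<bar>"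
    have S: "0 \<le> ?S" by (simp add: sum_nonneg)
    have "Q a * Q' a - Q b * Q' b = Q a * (Q' a - Q' b) + (Q a - Q b) * Q' b" by (simp add: algebra_simps)
    then have "\<bar>Q a * Q' a - Q b * Q' b\<bar> \<le> \<bar>Q a\<bar> * \<bar>Q' a - Q' b\<bar> + \<bar>Q a - Q b\<bar> * \<bar>Q' b\<bar>"
      by (metis abs_mult abs_triangle_ineq)
    also have "\<dots> \<le> L * (L' * ?S) + (L * ?S) * L'"
    proof (intro add_mono mult_mono)
      show "\<bar>Q' a - Q' b\<bar> \<le> L' * ?S"
        by (rule order_trans[OF Q'(5)]) (use Q(2) Q'(1,2) in \<open>auto intro!: mult_left_mono sum_mono2\<close>)
      show "\<bar>Q a - Q b\<bar> \<le> L * ?S"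
        by (rule order_trans[OF Q(5)]) (use Q(1,2) Q'(2) in \<open>auto intro!: mult_left_mono sum_mono2\<close>)
    qed (use Q Q' S in auto)
    finally show ?thesis by (simp add: algebra_simps)
  qed
  moreover have "\<bar>Q a * Q' a\<bar> \<le> 2 * L * L'" for a
  proof -
    have "\<bar>Q a * Q' a\<bar> \<le> L * L'" unfolding abs_mult using Q Q' by (intro mult_mono) auto
    also have "\<dots> \<le> 2 * L * L'" using mult_nonneg_nonneg[OF Q(1) Q'(1)] by simp
    finally show ?thesis .
  qed
  ultimately show ?thesis using Q(1-3) Q'(1-3) unfolding lip_test_def by auto
qed

lemma lip_test_cong:
  assumes "lip_test L C Q" "\<And>c. c \<in> C \<Longrightarrow> a c = b c" shows "Q a = Q b"
proof -
  have "\<bar>Q a - Q b\<bar> \<le> L * (\<Sum>c\<in>C. \<bar>a c - b c\<bar>)" using assms(1) by (rule lip_testD)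
  also have "\<dots> = 0" using assms(2) by (simp add: sum.neutral)
  finally show ?thesis by simp
qed

lemma lip_test_bound:
  assumes "lip_test L C Q" "\<And>c. c \<in> C \<Longrightarrow> \<bar>a c - b c\<bar> \<le> e"
  shows "\<bar>Q a - Q b\<bar> \<le> L * card C * e"
proof -
  have "\<bar>Q a - Q b\<bar> \<le> L * (\<Sum>c\<in>C. \<bar>a c - b c\<bar>)" using assms(1) by (rule lip_testD)
  also have "\<dots> \<le> L * (\<Sum>c\<in>C. e)" using lip_testD(1)[OF assms(1)] assms(2) by (intro mult_left_mono sum_mono) auto
  finally show ?thesis by simp
qed

lemma lip_test_continuous_on:
  assumes "lip_test L C Q" "\<And>c. c \<in> C \<Longrightarrow> continuous_on S (\<lambda>x. F x c)"
  shows "continuous_on S (\<lambda>x. Q (F x))"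
  unfolding continuous_on_def
proof
  fix x assume x: "x \<in> S"
  have "((\<lambda>y. \<Sum>c\<in>C. \<bar>F y c - F x c\<bar>) \<longlongrightarrow> (\<Sum>c\<in>C. \<bar>F x c - F x c\<bar>)) (at x within S)"
    using assms(2) x by (intro tendsto_intros) (auto simp: continuous_on_def)
  then have "((\<lambda>y. L * (\<Sum>c\<in>C. \<bar>F y c - F x c\<bar>)) \<longlongrightarrow> 0) (at x within S)"
    by (intro tendsto_mult_right_zero) simp
  then have "((\<lambda>y. Q (F y) - Q (F x)) \<longlongrightarrow> 0) (at x within S)"
    by (rule Lim_null_comparison[rotated]) (intro always_eventually allI, use lip_testD(5)[OF assms(1)] in simp)
  then show "((\<lambda>x. Q (F x)) \<longlongrightarrow> Q (F x)) (at x within S)" by (simp add: LIM_zero_iff)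
qed

lemma lip_test_measurable [measurable]:
  assumes "lip_test L C Q" shows "Q \<in> borel_measurable borel"
proof (rule borel_measurable_continuous_onI)
  show "continuous_on UNIV Q"
    using lip_test_continuous_on[OF assms, of UNIV "\<lambda>x. x"] by simp
qed

text \<open>Bounding all partial sums expresses the condition on the infinite sum through finitely
  many coordinates at a time, which is a closed condition for pointwise convergence.\<close>

lemma Delta_infty_iff:
  "x \<in> Delta_infty \<longleftrightarrow> (\<forall>j. 0 \<le> x j \<and> x j \<le> 1) \<and> (\<forall>j. x (Suc j) \<le> x j) \<and> (\<forall>n. (\<Sum>j<n. x j) \<le> 1)"
proof -
  have "(summable x \<and> suminf x \<le> 1) \<longleftrightarrow> (\<forall>n. (\<Sum>j<n. x j) \<le> 1)" if "\<forall>j. 0 \<le> x j"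
  proof
    assume "summable x \<and> suminf x \<le> 1"
    then show "\<forall>n. (\<Sum>j<n. x j) \<le> 1"
      using that by (meson order_trans sum_le_suminf finite_lessThan)
  next
    assume R: "\<forall>n. (\<Sum>j<n. x j) \<le> 1"
    then have "summable x" using that by (intro summableI_nonneg_bounded) auto
    then show "summable x \<and> suminf x \<le> 1" using R by (auto intro: suminf_le_const)
  qed
  then show ?thesis by (auto simp: Delta_infty_def decseq_Suc_iff)
qed

lemma Delta_inftyD:
  assumes "x \<in> Delta_infty" shows "0 \<le> x j" "decseq x" "summable x" "suminf x \<le> 1"
  using assms by (auto simp: Delta_infty_def)

text \<open>A closed subset of the cube, which is compact as a product of compact intervals.\<close>

lemma compact_Delta_infty: "compact Delta_infty"
proof -
  let ?K = "PiE UNIV (\<lambda>_ :: nat. {0..1 :: real})"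
  have "compact ?K"
    using compactin_PiE[of "\<lambda>_. euclidean" UNIV "\<lambda>_ :: nat. {0..1 :: real}"]
    by (simp add: euclidean_product_topology)
  moreover have "closed ({x :: nat \<Rightarrow> real. \<forall>j. x (Suc j) \<le> x j} \<inter> {x. \<forall>n. (\<Sum>j<n. x j) \<le> 1})"
  proof (intro closed_Int closed_Collect_all)
    show "closed {x :: nat \<Rightarrow> real. x (Suc j) \<le> x j}" for j
      by (rule closed_Collect_le) (rule continuous_on_product_coordinates)+
    have "continuous_on UNIV (\<lambda>x :: nat \<Rightarrow> real. \<Sum>j<n. x j)" for n
      by (rule continuous_on_sum) (rule continuous_on_product_coordinates)
    then show "closed {x :: nat \<Rightarrow> real. (\<Sum>j<n. x j) \<le> 1}" for n
      by (rule closed_Collect_le) (rule continuous_on_const)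
  qed
  ultimately have "compact (?K \<inter> ({x. \<forall>j. x (Suc j) \<le> x j} \<inter> {x. \<forall>n. (\<Sum>j<n. x j) \<le> 1}))"
    by (rule compact_Int_closed)
  also have "?K \<inter> ({x. \<forall>j. x (Suc j) \<le> x j} \<inter> {x. \<forall>n. (\<Sum>j<n. x j) \<le> 1}) = Delta_infty"
    by (auto simp: Delta_infty_iff PiE_def Pi_def)
  finally show ?thesis .
qed

text \<open>The first \<open>j + 1\<close> entries are all at least \<open>x j\<close> and sum to at
  most 1.\<close>

lemma Delta_infty_small:
  assumes x: "x \<in> Delta_infty" and J: "1 / real (Suc J) \<le> r" and j: "J \<le> j" shows "x j \<le> r"
proof -
  have "real (Suc j) * x j = (\<Sum>i<Suc j. x j)" by simp
  also have "\<dots> \<le> (\<Sum>i<Suc j. x i)"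
    using Delta_inftyD(2)[OF x] by (intro sum_mono) (auto simp: decseq_def)
  also have "\<dots> \<le> 1" using x by (simp add: Delta_infty_iff del: sum.lessThan_Suc)
  finally have "x j \<le> 1 / real (Suc j)" by (simp add: field_simps)
  also have "\<dots> \<le> 1 / real (Suc J)" using j by (simp add: frac_le)
  finally show ?thesis using J by simp
qed

text \<open>Here the positive threshold is essential: beyond an index \<open>J\<close> common to all
  of \<open>Delta_infty\<close> the entries are at most \<open>c\<close>, so the profile is a finite
  sum. The sum of all entries is not continuous for pointwise convergence.\<close>

lemma continuous_on_profile:
  assumes "0 < c" shows "continuous_on Delta_infty (\<lambda>x. profile x c)"
proof -
  have "0 < (of_rat c :: real)" using assms by simp
  then obtain J where J: "1 / real (Suc J) < of_rat c" using nat_approx_posE by blast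
  have "profile x c = (\<Sum>j<J. excess c (x j))" if "x \<in> Delta_infty" for x
    unfolding profile_def
    by (rule suminf_finite) (use Delta_infty_small[OF that, of J "of_rat c"] J in \<open>auto simp: excess_def not_less\<close>)
  then have "continuous_on Delta_infty (\<lambda>x. profile x c) \<longleftrightarrow>
      continuous_on Delta_infty (\<lambda>x. \<Sum>j<J. excess c (x j))"
    by (intro continuous_on_cong refl)
  moreover have "continuous_on Delta_infty (\<lambda>x. \<Sum>j<J. excess c (x j))"
    unfolding excess_def
    by (intro continuous_on_sum continuous_on_max continuous_intros
        continuous_on_subset[OF continuous_on_product_coordinates]) auto
  ultimately show ?thesis by simp
qed

text \<open>A threshold strictly between \<open>y j\<close> and \<open>x j\<close> cuts off all
  entries of \<open>y\<close> from \<open>j\<close> on but leaves a positive part of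
  \<open>x j\<close>, while the earlier terms agree.\<close>

lemma profile_separates:
  assumes xy: "x \<in> Delta_infty" "y \<in> Delta_infty" and eq: "\<And>i. i < j \<Longrightarrow> x i = y i" and lt: "y j < x j"
  shows "\<exists>c>0. profile y c < profile x c"
proof -
  obtain c where c: "y j < of_rat c" "of_rat c < x j" using of_rat_dense[OF lt] by blast
  have "0 < (of_rat c :: real)" using c(1) Delta_inftyD(1)[OF xy(2), of j] by linarith
  then have c0: "0 < c" by simp
  have "y i < of_rat c" if "j \<le> i" for i
    using c(1) decseqD[OF Delta_inftyD(2)[OF xy(2)] that] by linarith
  then have "profile y c = (\<Sum>i<j. excess c (y i))"
    unfolding profile_def by (intro suminf_finite) (auto simp: excess_def not_less less_imp_le)
  also have "\<dots> = (\<Sum>i<j. excess c (x i))" using eq by (intro sum.cong) auto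
  also have "\<dots> < (\<Sum>i<Suc j. excess c (x i))" using c(2) by (simp add: excess_def)
  also have "\<dots> \<le> profile x c"
    unfolding profile_def
    by (intro sum_le_suminf summable_excess c0 Delta_inftyD[OF xy(1)]) (auto simp: excess_nonneg)
  finally show ?thesis using c0 by blast
qed

lemma lip_test_dense:
  assumes f: "continuous_on Delta_infty f" and e: "0 < e"
  obtains L C Q where "lip_test L C Q" "\<And>x. x \<in> Delta_infty \<Longrightarrow> \<bar>f x - Q (profile x)\<bar> < e"
proof -
  define T where "T g \<longleftrightarrow> (\<exists>L C Q. lip_test L C Q \<and> (\<forall>x\<in>Delta_infty. g x = Q (profile x)))"
    for g :: "(nat \<Rightarrow> real) \<Rightarrow> real"
  have TI: "T g" if "lip_test L C Q" "\<And>x. x \<in> Delta_infty \<Longrightarrow> g x = Q (profile x)" for L C Q g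
    unfolding T_def using that by (intro exI[of _ L] exI[of _ C] exI[of _ Q]) auto
  have "\<exists>g. T g \<and> (\<forall>x\<in>Delta_infty. \<bar>f x - g x\<bar> < e)"
  proof (rule Stone_Weierstrass_HOL[OF compact_Delta_infty _ _ _ _ _ f e])
    show "T (\<lambda>x. k)" for k by (rule TI[OF lip_test_const]) simp
    show "continuous_on Delta_infty g" if Tg: "T g" for g
    proof -
      obtain L C Q where Q: "lip_test L C Q" "\<forall>x\<in>Delta_infty. g x = Q (profile x)"
        using Tg unfolding T_def by auto
      have "continuous_on Delta_infty (\<lambda>x. Q (profile x))"
        by (intro lip_test_continuous_on[OF Q(1)] continuous_on_profile lip_testD[OF Q(1)])
      then show ?thesis using Q(2) by (simp cong: continuous_on_cong)
    qed
    fix g h assume "T g \<and> T h"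
    then obtain L C Q L' C' Q' where
      Q: "lip_test L C Q" "\<forall>x\<in>Delta_infty. g x = Q (profile x)" and
      Q': "lip_test L' C' Q'" "\<forall>x\<in>Delta_infty. h x = Q' (profile x)"
      unfolding T_def by auto
    show "T (\<lambda>x. g x + h x)" by (rule TI[OF lip_test_add[OF Q(1) Q'(1)]]) (simp add: Q(2) Q'(2))
    show "T (\<lambda>x. g x * h x)" by (rule TI[OF lip_test_mult[OF Q(1) Q'(1)]]) (simp add: Q(2) Q'(2))
  next
    show "\<exists>g. T g \<and> g x \<noteq> g y" if xy: "x \<in> Delta_infty \<and> y \<in> Delta_infty \<and> x \<noteq> y" for x y
    proof -
      from xy obtain k where "x k \<noteq> y k" by auto
      then obtain j where j: "x j \<noteq> y j" "\<forall>i<j. \<not> x i \<noteq> y i"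
        using exists_least_iff[of "\<lambda>i. x i \<noteq> y i"] by auto
      then have "\<exists>c>0. profile x c \<noteq> profile y c"
        using profile_separates[of x y j] profile_separates[of y x j] xy
        by (cases "x j" "y j" rule: linorder_cases) fastforce+
      then obtain c where c: "0 < c" "profile x c \<noteq> profile y c" by blast
      have in01: "0 \<le> profile z c" "profile z c \<le> 1" if "z \<in> Delta_infty" for z
        using profile_nonneg[OF c(1) Delta_inftyD(1,3)[OF that]]
          profile_le_suminf[OF c(1) Delta_inftyD(1,3)[OF that]] Delta_inftyD(4)[OF that] by auto
      have "T (\<lambda>z. max 0 (min 1 (profile z c)))"
        by (rule TI[OF lip_test_coord[OF c(1)]]) simp
      moreover have "max 0 (min 1 (profile x c)) \<noteq> max 0 (min 1 (profile y c))"
        using in01[of x] in01[of y] xy c(2) by simp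
      ultimately show ?thesis by (intro exI conjI)
    qed
  qed
  then obtain g where g: "T g" "\<And>x. x \<in> Delta_infty \<Longrightarrow> \<bar>f x - g x\<bar> < e" by blast
  obtain L C Q where "lip_test L C Q" "\<forall>x\<in>Delta_infty. g x = Q (profile x)"
    using g(1) unfolding T_def by auto
  then show ?thesis using that[of L C Q] g(2) by simp
qed

section \<open>Random words\<close>

text \<open>The weight of a word depends only on its length and its multiset of letters, so
  rearranging letters does not change it.\<close>

lemma pmf_replicate_pmf:
  "pmf (replicate_pmf n p) xs = (if length xs = n then prod_list (map (pmf p) xs) else 0)"
proof (induction n arbitrary: xs)
  case 0
  then show ?case by (cases xs) auto
next
  case (Suc n)
  have eq: "replicate_pmf (Suc n) p = map_pmf (\<lambda>(x, xs). x # xs) (pair_pmf p (replicate_pmf n p))"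
    by (simp add: pair_pmf_def map_bind_pmf)
  show ?case
  proof (cases xs)
    case Nil
    have "[] \<notin> set_pmf (replicate_pmf (Suc n) p)" unfolding set_replicate_pmf by simp
    then show ?thesis unfolding Nil by (simp add: set_pmf_iff del: replicate_pmf.simps)
  next
    case (Cons y ys)
    have "pmf (map_pmf (\<lambda>(x, xs). x # xs) (pair_pmf p (replicate_pmf n p))) ((\<lambda>(x, xs). x # xs) (y, ys)) =
      pmf (pair_pmf p (replicate_pmf n p)) (y, ys)"
      by (rule pmf_map_inj') (auto simp: inj_on_def)
    then show ?thesis using Suc Cons by (simp add: eq pmf_pair del: replicate_pmf.simps)
  qed
qed

text \<open>The self-bijection. Its second component, the new place of position \<open>j\<close>, is
  the extra information on which \<open>std_word_inj\<close> relies.\<close>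

definition sort_pair :: "nat \<Rightarrow> real list \<times> nat \<Rightarrow> real list \<times> nat" where
  "sort_pair n = (\<lambda>(ws, j). (map (std_word n j ((!) ws)) [0..<n], std_sort n j ((!) ws) j))"

lemma mset_sort_pair:
  assumes "length ws = n" shows "mset (fst (sort_pair n (ws, j))) = mset ws"
proof -
  let ?\<theta> = "std_sort n j ((!) ws)"
  have p: "inv ?\<theta> permutes {..<n}" by (rule permutes_inv[OF std_sort_permutes])
  have "mset (fst (sort_pair n (ws, j))) = image_mset ((!) ws) (image_mset (inv ?\<theta>) (mset_set {..<n}))"
    by (simp add: sort_pair_def std_word_def image_mset.compositionality atLeast0LessThan)
  also have "image_mset (inv ?\<theta>) (mset_set {..<n}) = mset_set {..<n}"
    by (simp add: image_mset_mset_set permutes_inj_on[OF p] permutes_image[OF p])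
  also have "image_mset ((!) ws) (mset_set {..<n}) = mset (map ((!) ws) [0..<n])"
    by (simp add: atLeast0LessThan)
  also have "\<dots> = mset ws" using map_nth[of ws] assms by simp
  finally show ?thesis .
qed

text \<open>Surjectivity is free: the map preserves the multiset of letters, so it acts on finite sets.\<close>

lemma sort_pair_bij: "bij_betw (sort_pair n) ({ws. length ws = n} \<times> {..<n}) ({ws. length ws = n} \<times> {..<n})"
proof -
  let ?S = "{ws :: real list. length ws = n} \<times> {..<n}"
  have sub: "sort_pair n y \<in> ?S" if "y \<in> ?S" for y
    using that permutes_lessThan_less[OF std_sort_permutes] by (auto simp: sort_pair_def)
  have inj: "inj_on (sort_pair n) ?S"
  proof (rule inj_onI)
    fix y z assume yz: "y \<in> ?S" "z \<in> ?S" "sort_pair n y = sort_pair n z"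
    obtain ws j vs k where eq: "y = (ws, j)" "z = (vs, k)" by fastforce
    have l: "length ws = n" "length vs = n" "j < n" "k < n" using yz eq by auto
    have w: "std_word n j ((!) ws) i = std_word n k ((!) vs) i" if "i < n" for i
      using yz(3) that by (auto simp: eq sort_pair_def)
    have k: "std_sort n j ((!) ws) j = std_sort n k ((!) vs) k"
      using yz(3) by (auto simp: eq sort_pair_def)
    show "y = z"
      using std_word_inj[OF l(3,4) w k] l by (auto simp: eq intro: nth_equalityI)
  qed
  have surj: "\<exists>y\<in>?S. sort_pair n y = z" if z: "z \<in> ?S" for z
  proof -
    let ?C = "{ws. mset ws = mset (fst z)} \<times> {..<n}"
    have C: "?C \<subseteq> ?S" using z by (auto dest: mset_eq_length)
    have "finite ?C" by (simp add: mset_eq_finite)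
    moreover have "sort_pair n ` ?C \<subseteq> ?C"
    proof
      fix u assume "u \<in> sort_pair n ` ?C"
      then obtain ws j where u: "u = sort_pair n (ws, j)" "(ws, j) \<in> ?C" by auto
      then have "(ws, j) \<in> ?S" using C by blast
      then show "u \<in> ?C" using u sub[of "(ws, j)"] mset_sort_pair[of ws n j] by (auto simp: mem_Times_iff)
    qed
    ultimately have "sort_pair n ` ?C = ?C" by (rule endo_inj_surj[OF _ _ inj_on_subset[OF inj C]])
    moreover have "z \<in> ?C" using z by (auto simp: mem_Times_iff)
    ultimately show ?thesis using C by (metis (no_types, lifting) imageE subsetD)
  qed
  have "?S \<subseteq> sort_pair n ` ?S"
  proof
    fix z assume "z \<in> ?S"
    from surj[OF this] obtain y where "y \<in> ?S" "sort_pair n y = z" ..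
    then show "z \<in> sort_pair n ` ?S" by (intro image_eqI[OF sym])
  qed
  moreover have "sort_pair n ` ?S \<subseteq> ?S" using sub by (rule image_subsetI)
  ultimately show ?thesis using inj by (intro bij_betw_imageI equalityI)
qed

text \<open>A bijection that preserves point weights leaves the law invariant: the letters are
  permuted, and all values of the number have equal weight.\<close>

lemma map_sort_pair:
  assumes "0 < n"
  shows "map_pmf (sort_pair n) (pair_pmf (replicate_pmf n P) (pmf_of_set {..<n})) =
    pair_pmf (replicate_pmf n P) (pmf_of_set {..<n})" (is "map_pmf _ ?X = ?X")
proof (rule pmf_eqI)
  let ?S = "{ws :: real list. length ws = n} \<times> {..<n}"
  have U: "set_pmf (pmf_of_set {..<n}) = {..<n}" using assms by (intro set_pmf_of_set) auto
  have supp: "set_pmf ?X \<subseteq> ?S" by (auto simp: set_replicate_pmf U)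
  have inj: "inj_on (sort_pair n) ?S" and surj: "sort_pair n ` ?S = ?S"
    using sort_pair_bij[of n] by (auto simp: bij_betw_def)
  have w: "pmf ?X (sort_pair n y) = pmf ?X y" if y: "y \<in> ?S" for y
  proof -
    have unif: "pmf (pmf_of_set {..<n}) i = 1 / real n" if "i < n" for i
      using that by (subst pmf_of_set) auto
    obtain ws j where y': "y = (ws, j)" "length ws = n" "j < n" using y by auto
    obtain vs k where z: "sort_pair n y = (vs, k)" "length vs = n" "k < n" using surj y by blast
    have "mset vs = mset ws" using mset_sort_pair[OF y'(2), of j] z y' by simp
    then have "prod_list (map (pmf P) vs) = prod_list (map (pmf P) ws)"
      by (metis mset_map prod_mset_prod_list)
    then show ?thesis using z y' by (simp add: pmf_pair pmf_replicate_pmf unif)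
  qed
  fix z
  show "pmf (map_pmf (sort_pair n) ?X) z = pmf ?X z"
  proof (cases "z \<in> ?S")
    case True
    then obtain y where y: "y \<in> ?S" "z = sort_pair n y" using surj by blast
    show ?thesis
    proof (cases "y \<in> set_pmf ?X")
      case True
      then show ?thesis unfolding y(2) by (subst pmf_map_inj[OF inj_on_subset[OF inj supp]]) (auto simp: w[OF y(1)])
    next
      case False
      then have "z \<notin> sort_pair n ` set_pmf ?X" using inj supp y by (auto dest: inj_onD)
      then have "pmf (map_pmf (sort_pair n) ?X) z = 0" by (rule pmf_map_outside)
      moreover have "pmf ?X z = 0"
        unfolding y(2) w[OF y(1)] pmf_eq_0_set_pmf by (rule False)
      ultimately show ?thesis by simp
    qed
  next
    case False
    then have "z \<notin> set_pmf ?X" "z \<notin> sort_pair n ` set_pmf ?X" using supp surj by auto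
    then show ?thesis by (metis pmf_eq_0_set_pmf pmf_map_outside)
  qed
qed

text \<open>For \<open>0 < l\<close> this is a single cycle exactly when \<open>ys\<close> is
  primitive as a cyclic word.\<close>

definition word_block :: "nat \<Rightarrow> real list \<Rightarrow> nat multiset" where
  "word_block l ys = replicate_mset (l div cyc_period l ((!) ys)) (cyc_period l ((!) ys))"

text \<open>The word and a uniform number may be replaced by their image under
  \<open>sort_pair\<close>, which has the same law; and the head and the tail of a random word are
  independent random words.\<close>

lemma word_cycles_recursion:
  assumes n: "0 < n"
  shows "map_pmf (\<lambda>ws. word_cycles n ((!) ws)) (replicate_pmf n P) =
    do {
      j \<leftarrow> pmf_of_set {..<n};
      xs \<leftarrow> replicate_pmf j P;
      ys \<leftarrow> replicate_pmf (n - j) P;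
      return_pmf (word_cycles j ((!) xs) + word_block (n - j) ys)
    }"
proof -
  let ?X = "pair_pmf (replicate_pmf n P) (pmf_of_set {..<n})"
  have U: "set_pmf (pmf_of_set {..<n}) = {..<n}" using n by (intro set_pmf_of_set) auto
  define h where "h = (\<lambda>(ws, j). word_cycles j ((!) ws) +
    replicate_mset ((n - j) div tail_period n j ((!) ws)) (tail_period n j ((!) ws)))"
  have "map_pmf (\<lambda>ws. word_cycles n ((!) ws)) (replicate_pmf n P) = map_pmf (\<lambda>y. word_cycles n ((!) (fst y))) ?X"
    by (subst map_fst_pair_pmf[of "replicate_pmf n P" "pmf_of_set {..<n}", symmetric])
      (simp only: pmf.map_comp o_def)
  also have "\<dots> = map_pmf (\<lambda>y. word_cycles n ((!) (fst (sort_pair n y)))) ?X"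
    by (subst map_sort_pair[OF n, symmetric]) (simp add: pmf.map_comp o_def)
  also have "\<dots> = map_pmf h ?X"
  proof (rule map_pmf_cong[OF refl])
    fix y assume "y \<in> set_pmf ?X"
    then obtain ws j where y: "y = (ws, j)" "length ws = n" "j < n"
      by (auto simp: set_replicate_pmf U)
    have "word_cycles n ((!) (fst (sort_pair n y))) = word_cycles n (std_word n j ((!) ws))"
      by (rule word_cycles_cong) (simp add: y sort_pair_def)
    then show "word_cycles n ((!) (fst (sort_pair n y))) = h y"
      using word_cycles_std_word[OF y(3)] by (simp add: h_def y)
  qed
  also have "\<dots> = do {j \<leftarrow> pmf_of_set {..<n}; ws \<leftarrow> replicate_pmf n P; return_pmf (h (ws, j))}"
    by (simp add: pair_pmf_def map_bind_pmf bind_commute_pmf[of "replicate_pmf n P"])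
  also have "\<dots> = do {j \<leftarrow> pmf_of_set {..<n}; xs \<leftarrow> replicate_pmf j P; ys \<leftarrow> replicate_pmf (n - j) P;
      return_pmf (word_cycles j ((!) xs) + word_block (n - j) ys)}"
  proof (rule bind_pmf_cong[OF refl])
    fix j assume "j \<in> set_pmf (pmf_of_set {..<n})"
    then have j: "j < n" by (simp add: U)
    have "replicate_pmf n P = replicate_pmf (j + (n - j)) P" using j by simp
    also have "\<dots> = do {xs \<leftarrow> replicate_pmf j P; ys \<leftarrow> replicate_pmf (n - j) P; return_pmf (xs @ ys)}"
      by (rule replicate_pmf_distrib)
    finally have "do {ws \<leftarrow> replicate_pmf n P; return_pmf (h (ws, j))} =
      do {xs \<leftarrow> replicate_pmf j P; ys \<leftarrow> replicate_pmf (n - j) P; return_pmf (h (xs @ ys, j))}"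
      by (simp add: bind_assoc_pmf bind_return_pmf)
    also have "\<dots> = do {xs \<leftarrow> replicate_pmf j P; ys \<leftarrow> replicate_pmf (n - j) P;
      return_pmf (word_cycles j ((!) xs) + word_block (n - j) ys)}"
    proof (intro bind_pmf_cong refl)
      fix xs ys assume "xs \<in> set_pmf (replicate_pmf j P)" "ys \<in> set_pmf (replicate_pmf (n - j) P)"
      then have l: "length xs = j" "length ys = n - j" by (auto simp: set_replicate_pmf)
      have "word_cycles j ((!) (xs @ ys)) = word_cycles j ((!) xs)"
        by (rule word_cycles_cong) (simp add: nth_append l)
      moreover have "tail_period n j ((!) (xs @ ys)) = cyc_period (n - j) ((!) ys)"
        unfolding tail_period_def by (rule cyc_period_cong) (use j in \<open>simp_all add: nth_append l\<close>)
      ultimately show "return_pmf (h (xs @ ys, j)) = return_pmf (word_cycles j ((!) xs) + word_block (n - j) ys)"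
        by (simp add: h_def word_block_def)
    qed
    finally show "do {ws \<leftarrow> replicate_pmf n P; return_pmf (h (ws, j))} = \<dots>" .
  qed
  finally show ?thesis .
qed

section \<open>Periodic words are rare\<close>

lemma pmf_replicate_pmf_le:
  assumes "\<And>i. pmf P i \<le> R" shows "pmf (replicate_pmf k P) zs \<le> R ^ k"
proof -
  have R: "0 \<le> R" using pmf_nonneg[of P undefined] assms[of undefined] by linarith
  have "prod_list (map (pmf P) zs) \<le> R ^ length zs"
    by (induction zs) (auto intro!: mult_mono assms R prod_list_nonneg)
  then show ?thesis using R by (auto simp: pmf_replicate_pmf)
qed

text \<open>Given the first \<open>d\<close> letters, the other \<open>l - d\<close> are forced, and
  any fixed word of that length has probability at most \<open>R ^ (l - d)\<close>.\<close>

lemma prob_periodic_le: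
  assumes R: "\<And>i. pmf P i \<le> R" and d: "0 < d" "d \<le> l"
  shows "measure_pmf.prob (replicate_pmf l P) {ys. \<forall>t<l. ys ! t = ys ! (t mod d)} \<le> R ^ (l - d)"
proof -
  let ?D = "{ys. \<forall>t<l. ys ! t = ys ! (t mod d)}"
  have R0: "0 \<le> R" using pmf_nonneg[of P undefined] R(1)[of undefined] by linarith
  have "replicate_pmf l P = replicate_pmf (d + (l - d)) P" using d by simp
  also have "\<dots> = do {xs \<leftarrow> replicate_pmf d P; map_pmf ((@) xs) (replicate_pmf (l - d) P)}"
    by (simp add: replicate_pmf_distrib map_pmf_def)
  finally have "emeasure (replicate_pmf l P) ?D =
      (\<integral>\<^sup>+xs. emeasure (map_pmf ((@) xs) (replicate_pmf (l - d) P)) ?D \<partial>replicate_pmf d P)"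
    by simp
  also have "\<dots> \<le> (\<integral>\<^sup>+xs. ennreal (R ^ (l - d)) \<partial>replicate_pmf d P)"
  proof (rule nn_integral_mono_AE, rule AE_pmfI)
    fix xs assume "xs \<in> set_pmf (replicate_pmf d P)"
    then have lx: "length xs = d" by (simp add: set_replicate_pmf)
    let ?z = "map (\<lambda>t. xs ! ((t + d) mod d)) [0..<l - d]"
    have "zs = ?z" if "zs \<in> set_pmf (replicate_pmf (l - d) P)" "xs @ zs \<in> ?D" for zs
    proof (rule nth_equalityI)
      show len: "length zs = length ?z" using that(1) by (simp add: set_replicate_pmf)
      fix t assume t: "t < length zs"
      then have "t + d < l" using len by simp
      then have "(xs @ zs) ! (t + d) = (xs @ zs) ! ((t + d) mod d)" using that(2) by blast
      moreover have "(xs @ zs) ! (t + d) = zs ! t" using nth_append_length_plus[of xs zs t] lx by (simp add: add.commute)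
      moreover have "(xs @ zs) ! ((t + d) mod d) = xs ! ((t + d) mod d)"
        using d lx by (simp add: nth_append)
      ultimately show "zs ! t = ?z ! t" using t len by simp
    qed
    then have "emeasure (replicate_pmf (l - d) P) ((@) xs -` ?D) \<le> emeasure (replicate_pmf (l - d) P) {?z}"
      by (intro emeasure_mono_AE AE_pmfI) auto
    also have "\<dots> = ennreal (pmf (replicate_pmf (l - d) P) ?z)" by (simp add: emeasure_pmf_single)
    also have "\<dots> \<le> ennreal (R ^ (l - d))" by (intro ennreal_leI pmf_replicate_pmf_le R)
    finally show "emeasure (map_pmf ((@) xs) (replicate_pmf (l - d) P)) ?D \<le> ennreal (R ^ (l - d))"
      by simp
  qed
  also have "\<dots> = ennreal (R ^ (l - d))" by simp
  finally show ?thesis using R0 by (simp add: measure_pmf.emeasure_eq_measure)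
qed

text \<open>A period below \<open>l\<close> is a proper divisor of \<open>l\<close>, hence at most
  \<open>l div 2\<close>. Then \<open>l - d\<close> is at least \<open>l / 2\<close>, so each term
  of the union bound is at most \<open>sqrt R ^ l\<close>.\<close>

lemma prob_cyc_period_less:
  fixes P :: "'a pmf"
  assumes R: "\<And>i. pmf P i \<le> R" "R \<le> 1" and l: "0 < l"
  shows "measure_pmf.prob (replicate_pmf l P) {ys. cyc_period l ((!) ys) < l} \<le> real l * sqrt R ^ l"
proof -
  have R0: "0 \<le> R" using pmf_nonneg[of P undefined] R(1)[of undefined] by linarith
  define D where "D d = {ys :: 'a list. \<forall>t<l. ys ! t = ys ! (t mod d)}" for d
  have "{ys. cyc_period l ((!) ys) < l} \<subseteq> (\<Union>d\<in>{1..l div 2}. D d)"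
  proof
    fix ys :: "'a list" assume "ys \<in> {ys. cyc_period l ((!) ys) < l}"
    define d where "d = cyc_period l ((!) ys)"
    have d: "0 < d" "d dvd l" "d < l"
      using cyc_period_pos[OF l] cyc_period_dvd[OF l] \<open>ys \<in> _\<close> by (auto simp: d_def)
    obtain q where q: "l = d * q" using d by blast
    then have "q \<noteq> 0" "q \<noteq> 1" using d by auto
    then have "2 \<le> q" by simp
    then have "d * 2 \<le> l" unfolding q by (rule mult_le_mono2)
    then have "d \<le> l div 2" by linarith
    moreover have "ys ! t = ys ! (t mod d)" if "t < l" for t
    proof -
      have "t mod d < l" using mod_less_eq_dividend[of t d] that by linarith
      then show ?thesis using cyc_period_mod[OF l, of "(!) ys" t] that by (simp add: d_def)
    qed
    ultimately show "ys \<in> (\<Union>d\<in>{1..l div 2}. D d)" using d by (auto simp: D_def Suc_le_eq)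
  qed
  then have "measure_pmf.prob (replicate_pmf l P) {ys. cyc_period l ((!) ys) < l} \<le>
      measure_pmf.prob (replicate_pmf l P) (\<Union>d\<in>{1..l div 2}. D d)"
    by (intro measure_pmf.finite_measure_mono) auto
  also have "\<dots> \<le> (\<Sum>d\<in>{1..l div 2}. measure_pmf.prob (replicate_pmf l P) (D d))"
    by (rule measure_pmf.finite_measure_subadditive_finite) auto
  also have "\<dots> \<le> (\<Sum>d\<in>{1..l div 2}. sqrt R ^ l)"
  proof (rule sum_mono)
    fix d assume d: "d \<in> {1..l div 2}"
    have "measure_pmf.prob (replicate_pmf l P) (D d) \<le> R ^ (l - d)"
      unfolding D_def by (rule prob_periodic_le[OF R(1)]) (use d in auto)
    also have "\<dots> = sqrt R ^ (2 * (l - d))" using R0 by (simp add: power_mult)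
    also have "\<dots> \<le> sqrt R ^ l" using R0 R(2) d by (intro power_decreasing) auto
    finally show "measure_pmf.prob (replicate_pmf l P) (D d) \<le> sqrt R ^ l" .
  qed
  also have "\<dots> = real (l div 2) * sqrt R ^ l" by simp
  also have "\<dots> \<le> real l * sqrt R ^ l" using R0 by (intro mult_right_mono) auto
  finally show ?thesis .
qed

section \<open>Stick breaking\<close>

text \<open>Order the indices by decreasing value, then by index. Since \<open>y\<close> tends to 0
  and \<open>y k\<close> is positive, each \<open>k\<close> has finitely many predecessors, and
  their number is a bijection of the natural numbers.\<close>

lemma ex_decreasing_rearrangement:
  fixes y :: "nat \<Rightarrow> real"
  assumes pos: "\<And>k. 0 < y k" and lim: "y \<longlonglongrightarrow> 0"
  obtains \<pi> where "bij \<pi>" "decseq (y \<circ> \<pi>)"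
proof -
  define b where "b i k \<longleftrightarrow> y i > y k \<or> (y i = y k \<and> i < k)" for i k
  have tr: "b i k \<Longrightarrow> b k l \<Longrightarrow> b i l" for i k l unfolding b_def by auto
  have tot: "i \<noteq> k \<Longrightarrow> b i k \<or> b k i" for i k unfolding b_def by auto
  have irr: "\<not> b k k" for k unfolding b_def by auto
  have fin: "finite {i. b i k}" for k
  proof -
    obtain N where "\<forall>n\<ge>N. y n < y k"
      using order_tendstoD(2)[OF lim pos[of k]] by (auto simp: eventually_sequentially)
    then have "{i. b i k} \<subseteq> {..<N}" unfolding b_def by (auto simp: not_less[symmetric])
    then show ?thesis by (rule finite_subset) simp
  qed
  define r where "r k = card {i. b i k}" for k
  have r_mono: "r i < r k" if "b i k" for i k
    unfolding r_def using that tr irr by (intro psubset_card_mono[OF fin]) blast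
  have r_inj: "inj r" by (rule injI) (metis r_mono tot less_irrefl)
  have r_surj: "m \<in> range r" for m
  proof -
    have "infinite (range r)" using r_inj by (simp add: range_inj_infinite)
    then obtain k where k: "m < r k" using infinite_nat_iff_unbounded[of "range r"] by auto
    \<comment> \<open>The predecessors of \<open>k\<close> have distinct ranks below
      \<open>r k\<close>, and there are \<open>r k\<close> of them, so no smaller rank is
      skipped.\<close>
    have "r ` {i. b i k} \<subseteq> {..<r k}" using r_mono by auto
    moreover have "card (r ` {i. b i k}) = card {..<r k}"
      using card_image[OF inj_on_subset[OF r_inj subset_UNIV]] by (simp add: r_def)
    ultimately have "r ` {i. b i k} = {..<r k}" by (intro card_subset_eq) auto
    then show ?thesis using k by auto
  qed
  have r_bij: "bij r" using r_inj r_surj by (auto simp: bij_def)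
  have "y (inv r j) \<le> y (inv r i)" if "i \<le> j" for i j
  proof (cases "i = j")
    case False
    have ri: "r (inv r n) = n" for n by (rule surj_f_inv_f) (use r_bij in \<open>simp add: bij_def\<close>)
    have "inv r i \<noteq> inv r j" using ri False by metis
    moreover have "\<not> b (inv r j) (inv r i)" using r_mono[of "inv r j" "inv r i"] ri that by auto
    ultimately show ?thesis using tot unfolding b_def by fastforce
  qed simp
  then have "decseq (y \<circ> inv r)" by (auto simp: decseq_def)
  then show ?thesis using that[OF bij_imp_bij_inv[OF r_bij]] by blast
qed

text \<open>The right-hand side does not involve \<open>\<pi>\<close>. It yields the uniqueness of
  the rearrangement and, as a countable union over finite sets \<open>K\<close>, its
  measurability.\<close>

lemma decreasing_gt_iff:
  fixes y :: "nat \<Rightarrow> real"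
  assumes \<pi>: "bij \<pi>" and dec: "decseq (y \<circ> \<pi>)"
  shows "t < (y \<circ> \<pi>) j \<longleftrightarrow> (\<exists>K. finite K \<and> card K = Suc j \<and> (\<forall>k\<in>K. t < y k))"
proof
  assume t: "t < (y \<circ> \<pi>) j"
  have "t < y (\<pi> i)" if "i \<le> j" for i using t decseqD[OF dec that] by simp
  moreover have "card (\<pi> ` {..j}) = Suc j"
    by (subst card_image) (use \<pi> in \<open>auto simp: bij_def intro: inj_on_subset\<close>)
  ultimately show "\<exists>K. finite K \<and> card K = Suc j \<and> (\<forall>k\<in>K. t < y k)"
    by (intro exI[of _ "\<pi> ` {..j}"]) auto
next
  assume "\<exists>K. finite K \<and> card K = Suc j \<and> (\<forall>k\<in>K. t < y k)"
  then obtain K where K: "finite K" "card K = Suc j" "\<forall>k\<in>K. t < y k" by blast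
  have "card (inv \<pi> ` K) = Suc j"
    using K(2) card_image[OF inj_on_subset[OF bij_is_inj[OF bij_imp_bij_inv[OF \<pi>]] subset_UNIV], of K] by simp
  then have "\<not> inv \<pi> ` K \<subseteq> {..<j}" using card_mono[of "{..<j}" "inv \<pi> ` K"] by auto
  then obtain k where "k \<in> K" "\<not> inv \<pi> k < j" by auto
  then have k: "k \<in> K" "j \<le> inv \<pi> k" by simp_all
  have "t < y k" using K k by blast
  also have "y k = (y \<circ> \<pi>) (inv \<pi> k)" using \<pi> by (simp add: bij_def surj_f_inv_f)
  also have "\<dots> \<le> (y \<circ> \<pi>) j" by (rule decseqD[OF dec k(2)])
  finally show "t < (y \<circ> \<pi>) j" .
qed

lemma decreasing_rearrangement_ex:
  assumes "\<And>k. 0 < y k" "y \<longlonglongrightarrow> 0"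
  obtains \<pi> where "bij \<pi>" "decseq (y \<circ> \<pi>)" "decreasing_rearrangement y = y \<circ> \<pi>"
proof -
  obtain \<pi> where \<pi>: "bij \<pi>" "decseq (y \<circ> \<pi>)" using ex_decreasing_rearrangement[of y] assms by blast
  have "decreasing_rearrangement y = y \<circ> \<pi>"
    unfolding decreasing_rearrangement_def
  proof (rule the_equality)
    show "decseq (y \<circ> \<pi>) \<and> (\<exists>\<pi>'. bij \<pi>' \<and> y \<circ> \<pi> = y \<circ> \<pi>')" using \<pi> by blast
    fix z assume "decseq z \<and> (\<exists>\<pi>'. bij \<pi>' \<and> z = y \<circ> \<pi>')"
    then obtain \<pi>' where \<pi>': "bij \<pi>'" "decseq (y \<circ> \<pi>')" "z = y \<circ> \<pi>'" by blast
    have "t < z j \<longleftrightarrow> t < (y \<circ> \<pi>) j" for t j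
      unfolding \<pi>'(3) using decreasing_gt_iff[OF \<pi>] decreasing_gt_iff[OF \<pi>'(1,2)] by simp
    then show "z = y \<circ> \<pi>" by (intro ext) (metis less_irrefl linorder_neqE)
  qed
  then show ?thesis using that \<pi> by blast
qed

section \<open>The measure on break fractions and the law of the sorted pieces\<close>

definition unif01 :: "real measure" where
  "unif01 = restrict_space lborel {0<..<1}"

definition stick_measure :: "(nat \<Rightarrow> real) measure" where
  "stick_measure = (\<Pi>\<^sub>M k\<in>UNIV. unif01)"

lemma space_unif01: "space unif01 = {0<..<1}"
  by (simp add: unif01_def space_restrict_space)

lemma prob_space_unif01: "prob_space unif01"
  by (rule prob_spaceI) (simp add: unif01_def space_restrict_space emeasure_restrict_space)

interpretation unif01: prob_space unif01
  by (rule prob_space_unif01)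

interpretation sticks: sequence_space unif01 ..

lemma prob_space_stick_measure: "prob_space stick_measure"
  unfolding stick_measure_def by (rule sticks.P.prob_space_axioms)

interpretation stick_measure: prob_space stick_measure
  by (rule prob_space_stick_measure)

lemma measurable_unif01 [measurable]: "(\<lambda>x. x) \<in> borel_measurable unif01"
  unfolding unif01_def by (rule measurable_restrict_space1) simp

lemma measurable_stick_coord [measurable]: "(\<lambda>U. U k) \<in> borel_measurable stick_measure"
  by (rule measurable_compose[OF _ measurable_unif01]) (simp add: stick_measure_def)

lemma measurable_stick_rest [measurable]: "(\<lambda>U. stick_rest U k) \<in> borel_measurable stick_measure"
  by (induction k) simp_all

lemma measurable_stick_piece [measurable]: "(\<lambda>U. stick_piece U k) \<in> borel_measurable stick_measure"
  unfolding stick_piece_def by simp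

text \<open>Self-similarity: after the first break, what remains is a stick of length
  \<open>1 - u\<close> broken by the remaining fractions.\<close>

lemma stick_piece_case_nat:
  "stick_piece (case_nat u U) 0 = u" "stick_piece (case_nat u U) (Suc k) = (1 - u) * stick_piece U k"
proof -
  have "stick_rest (case_nat u U) (Suc k) = (1 - u) * stick_rest U k"
    by (induction k) simp_all
  then show "stick_piece (case_nat u U) 0 = u" "stick_piece (case_nat u U) (Suc k) = (1 - u) * stick_piece U k"
    by (simp_all add: stick_piece_def)
qed

lemma stick_space: "U \<in> space stick_measure \<Longrightarrow> 0 < U k \<and> U k < 1"
  by (auto simp: stick_measure_def space_PiM space_unif01 PiE_iff)

context
  fixes U :: "nat \<Rightarrow> real"
  assumes U: "U \<in> space stick_measure"
begin

lemma stick_rest_pos: "0 < stick_rest U k"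
  using stick_space[OF U] by (induction k) simp_all

lemma stick_piece_pos: "0 < stick_piece U k"
  using stick_rest_pos stick_space[OF U] by (simp add: stick_piece_def)

lemma sum_stick_piece: "(\<Sum>k<n. stick_piece U k) = 1 - stick_rest U n"
  by (induction n) (simp_all add: stick_piece_def algebra_simps)

lemma summable_stick_piece: "summable (stick_piece U)"
  by (rule summableI_nonneg_bounded[where x = 1])
    (use stick_piece_pos stick_rest_pos in \<open>auto simp: sum_stick_piece less_imp_le\<close>)

lemma suminf_stick_piece: "suminf (stick_piece U) \<le> 1"
  by (rule suminf_le_const[OF summable_stick_piece]) (use stick_rest_pos in \<open>simp add: sum_stick_piece less_imp_le\<close>)

lemma stick_rearrangement:
  obtains \<pi> where "bij \<pi>" "decseq (stick_piece U \<circ> \<pi>)"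
    "decreasing_rearrangement (stick_piece U) = stick_piece U \<circ> \<pi>"
  using decreasing_rearrangement_ex[OF stick_piece_pos summable_LIMSEQ_zero[OF summable_stick_piece]] by blast

lemma rearrangement_in_Delta: "decreasing_rearrangement (stick_piece U) \<in> Delta_infty"
proof -
  obtain \<pi> where \<pi>: "bij \<pi>" "decseq (stick_piece U \<circ> \<pi>)"
    "decreasing_rearrangement (stick_piece U) = stick_piece U \<circ> \<pi>" by (rule stick_rearrangement)
  have inj: "inj \<pi>" using \<pi>(1) by (simp add: bij_def)
  have s: "summable (stick_piece U \<circ> \<pi>)" "suminf (stick_piece U \<circ> \<pi>) \<le> suminf (stick_piece U)"
    using summable_reindex[OF summable_stick_piece inj] suminf_reindex_mono[OF summable_stick_piece inj]
      stick_piece_pos by (auto simp: less_imp_le)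
  have "stick_piece U k \<le> 1" for k
    using sum_le_suminf[OF summable_stick_piece, of "{k}"] suminf_stick_piece stick_piece_pos
    by (simp add: less_imp_le)
  then show ?thesis
    unfolding \<pi>(3) Delta_infty_def using s \<pi>(2) suminf_stick_piece stick_piece_pos
    by (auto simp: less_imp_le)
qed

lemma profile_rearrangement:
  assumes c: "0 < c"
  shows "profile (decreasing_rearrangement (stick_piece U)) c = profile (stick_piece U) c"
proof -
  obtain \<pi> where \<pi>: "bij \<pi>" "decreasing_rearrangement (stick_piece U) = stick_piece U \<circ> \<pi>"
    by (rule stick_rearrangement)
  have "suminf ((\<lambda>j. excess c (stick_piece U j)) \<circ> \<pi>) = (\<Sum>j. excess c (stick_piece U j))"
    by (rule suminf_reindex)
      (use \<pi>(1) summable_excess[OF c _ summable_stick_piece] stick_piece_pos in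
        \<open>auto simp: bij_def excess_nonneg less_imp_le\<close>)
  then show ?thesis unfolding \<pi>(2) profile_def by (simp add: o_def)
qed

end

lemma measurable_rearrangement:
  "(\<lambda>U. decreasing_rearrangement (stick_piece U)) \<in> measurable stick_measure (restrict_space borel Delta_infty)"
proof (rule measurable_restrict_space2)
  show "(\<lambda>U. decreasing_rearrangement (stick_piece U)) \<in> space stick_measure \<rightarrow> Delta_infty"
    using rearrangement_in_Delta by blast
  show "(\<lambda>U. decreasing_rearrangement (stick_piece U)) \<in> borel_measurable stick_measure"
  proof (rule measurable_coordinatewise_then_product)
    fix j
    show "(\<lambda>U. decreasing_rearrangement (stick_piece U) j) \<in> borel_measurable stick_measure"
      unfolding borel_measurable_iff_greater
    proof
      fix t
      let ?T = "{K :: nat set. finite K \<and> card K = Suc j}"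
      have eq: "{U \<in> space stick_measure. t < decreasing_rearrangement (stick_piece U) j} =
        (\<Union>K\<in>?T. {U \<in> space stick_measure. \<forall>k\<in>K. t < stick_piece U k})"
      proof -
        have "t < decreasing_rearrangement (stick_piece U) j \<longleftrightarrow>
            (\<exists>K. finite K \<and> card K = Suc j \<and> (\<forall>k\<in>K. t < stick_piece U k))"
          if U: "U \<in> space stick_measure" for U
          using stick_rearrangement[OF U] decreasing_gt_iff by metis
        then show ?thesis by blast
      qed
      have "?T \<subseteq> Collect finite" by auto
      then have "countable ?T" using countable_Collect_finite by (rule countable_subset)
      then show "{U \<in> space stick_measure. t < decreasing_rearrangement (stick_piece U) j} \<in> sets stick_measure"
        unfolding eq
      proof (rule sets.countable_UN'')
        fix K :: "nat set" assume "K \<in> ?T"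
        then show "{U \<in> space stick_measure. \<forall>k\<in>K. t < stick_piece U k} \<in> sets stick_measure"
          by (intro sets.sets_Collect_finite_All') (auto simp: borel_measurable_less)
      qed
    qed
  qed
qed

lemma poisson_dirichlet_1_eq:
  "poisson_dirichlet_1 = distr stick_measure (restrict_space borel Delta_infty)
     (\<lambda>U. decreasing_rearrangement (stick_piece U))"
  by (simp add: poisson_dirichlet_1_def stick_measure_def unif01_def)

lemma prob_space_poisson_dirichlet_1: "prob_space poisson_dirichlet_1"
  unfolding poisson_dirichlet_1_eq by (rule stick_measure.prob_space_distr[OF measurable_rearrangement])

text \<open>The continuous counterpart of \<open>word_mean\<close>: \<open>s\<close> is the length
  still to be broken, and \<open>a\<close> the profile of the pieces already broken off.\<close>

definition stick_mean :: "((rat \<Rightarrow> real) \<Rightarrow> real) \<Rightarrow> real \<Rightarrow> (rat \<Rightarrow> real) \<Rightarrow> real" where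
  "stick_mean Q s a = (\<integral>U. Q (\<lambda>c. a c + profile (\<lambda>j. s * stick_piece U j) c) \<partial>stick_measure)"

context
  fixes L :: real and C :: "rat set" and Q :: "(rat \<Rightarrow> real) \<Rightarrow> real"
  assumes Q: "lip_test L C Q"
begin

lemma measurable_stick_test [measurable]:
  "(\<lambda>U. Q (\<lambda>c. a c + profile (\<lambda>j. s * stick_piece U j) c)) \<in> borel_measurable stick_measure"
proof (rule measurable_compose[OF _ lip_test_measurable[OF Q]])
  show "(\<lambda>U c. a c + profile (\<lambda>j. s * stick_piece U j) c) \<in> borel_measurable stick_measure"
    by (rule measurable_coordinatewise_then_product) (simp add: profile_def excess_def)
qed

lemma integrable_stick_test:
  "integrable stick_measure (\<lambda>U. Q (\<lambda>c. a c + profile (\<lambda>j. s * stick_piece U j) c))"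
  by (rule stick_measure.integrable_const_bound[where B = L])
    (use lip_testD(4)[OF Q] in \<open>auto intro!: measurable_stick_test\<close>)

lemma integral_poisson_dirichlet_1:
  assumes f: "f \<in> borel_measurable (restrict_space borel Delta_infty)"
    and eq: "\<And>x. x \<in> Delta_infty \<Longrightarrow> f x = Q (profile x)"
  shows "(\<integral>x. f x \<partial>poisson_dirichlet_1) = stick_mean Q 1 (\<lambda>_. 0)"
proof -
  have "(\<integral>x. f x \<partial>poisson_dirichlet_1) = (\<integral>U. f (decreasing_rearrangement (stick_piece U)) \<partial>stick_measure)"
    unfolding poisson_dirichlet_1_eq by (rule integral_distr[OF measurable_rearrangement f])
  also have "\<dots> = stick_mean Q 1 (\<lambda>_. 0)"
    unfolding stick_mean_def
  proof (rule Bochner_Integration.integral_cong[OF refl])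
    fix U assume U: "U \<in> space stick_measure"
    show "f (decreasing_rearrangement (stick_piece U)) = Q (\<lambda>c. 0 + profile (\<lambda>j. 1 * stick_piece U j) c)"
      unfolding eq[OF rearrangement_in_Delta[OF U]]
      by (rule lip_test_cong[OF Q]) (simp add: profile_rearrangement[OF U] lip_testD(3)[OF Q])
  qed
  finally show ?thesis .
qed

text \<open>The pieces of a unit stick sum to at most 1, so passing from length \<open>s\<close> to
  \<open>s'\<close> moves each profile value by at most \<open>\<bar>s - s'\<bar>\<close>.\<close>

lemma stick_mean_lipschitz:
  assumes "0 \<le> s" "0 \<le> s'" "\<And>c. c \<in> C \<Longrightarrow> \<bar>a c - a' c\<bar> \<le> e"
  shows "\<bar>stick_mean Q s a - stick_mean Q s' a'\<bar> \<le> L * card C * (e + \<bar>s - s'\<bar>)"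
proof -
  let ?f = "\<lambda>s a U. Q (\<lambda>c. a c + profile (\<lambda>j. s * stick_piece U j) c)"
  have pt: "\<bar>?f s a U - ?f s' a' U\<bar> \<le> L * card C * (e + \<bar>s - s'\<bar>)" if U: "U \<in> space stick_measure" for U
  proof (rule lip_test_bound[OF Q])
    fix c assume c: "c \<in> C"
    let ?y = "stick_piece U"
    have y: "0 \<le> ?y j" "summable ?y" for j
      using stick_piece_pos[OF U, of j] summable_stick_piece[OF U] by auto
    have d: "(\<lambda>j. \<bar>s * ?y j - s' * ?y j\<bar>) = (\<lambda>j. \<bar>s - s'\<bar> * ?y j)"
      using y by (intro ext) (simp add: abs_mult flip: left_diff_distrib)
    have "\<bar>profile (\<lambda>j. s * ?y j) c - profile (\<lambda>j. s' * ?y j) c\<bar> \<le> (\<Sum>j. \<bar>s * ?y j - s' * ?y j\<bar>)"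
      by (rule profile_lipschitz) (use y assms(1,2) lip_testD(3)[OF Q c] in \<open>auto simp: d summable_mult\<close>)
    also have "\<dots> = \<bar>s - s'\<bar> * suminf ?y" unfolding d by (rule suminf_mult[OF y(2)])
    also have "\<dots> \<le> \<bar>s - s'\<bar>" using mult_left_mono[OF suminf_stick_piece[OF U], of "\<bar>s - s'\<bar>"] by simp
    finally show "\<bar>a c + profile (\<lambda>j. s * ?y j) c - (a' c + profile (\<lambda>j. s' * ?y j) c)\<bar> \<le> e + \<bar>s - s'\<bar>"
      using assms(3)[OF c] by linarith
  qed
  have "\<bar>stick_mean Q s a - stick_mean Q s' a'\<bar> = \<bar>\<integral>U. ?f s a U - ?f s' a' U \<partial>stick_measure\<bar>"
    unfolding stick_mean_def by (simp add: integrable_stick_test)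
  also have "\<dots> \<le> (\<integral>U. \<bar>?f s a U - ?f s' a' U\<bar> \<partial>stick_measure)" by (rule integral_abs_bound)
  also have "\<dots> \<le> (\<integral>U. L * card C * (e + \<bar>s - s'\<bar>) \<partial>stick_measure)"
    by (intro integral_mono) (use pt in \<open>auto intro!: integrable_stick_test\<close>)
  also have "\<dots> = L * card C * (e + \<bar>s - s'\<bar>)" using stick_measure.prob_space by simp
  finally show ?thesis .
qed

text \<open>The first coordinate of the product measure is split off, and
  \<open>stick_piece_case_nat\<close> identifies the rest as a rescaled independent stick.\<close>

lemma stick_mean_recursion:
  assumes s: "0 \<le> s"
  shows "stick_mean Q s a = (\<integral>u. stick_mean Q (s * (1 - u)) (\<lambda>c. a c + excess c (s * u)) \<partial>unif01)"
proof -
  let ?f = "\<lambda>s a U. Q (\<lambda>c. a c + profile (\<lambda>j. s * stick_piece U j) c)"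
  let ?g = "\<lambda>(u, U). case_nat u U :: nat \<Rightarrow> real"
  interpret pair_sigma_finite unif01 stick_measure ..
  interpret P: pair_prob_space unif01 stick_measure ..
  have g[measurable]: "?g \<in> measurable (unif01 \<Otimes>\<^sub>M stick_measure) stick_measure"
    unfolding stick_measure_def by measurable
  have "stick_mean Q s a = (\<integral>U. ?f s a U \<partial>distr (unif01 \<Otimes>\<^sub>M stick_measure) stick_measure ?g)"
    using sticks.PiM_iter by (simp add: stick_mean_def stick_measure_def)
  also have "\<dots> = (\<integral>z. ?f s a (?g z) \<partial>(unif01 \<Otimes>\<^sub>M stick_measure))"
    by (rule integral_distr[OF g measurable_stick_test])
  also have "\<dots> = (\<integral>u. \<integral>U. ?f s a (?g (u, U)) \<partial>stick_measure \<partial>unif01)"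
  proof (rule integral_fst'[symmetric])
    show "integrable (unif01 \<Otimes>\<^sub>M stick_measure) (\<lambda>z. ?f s a (?g z))"
      by (rule P.integrable_const_bound[where B = L])
        (use lip_testD(4)[OF Q] in \<open>auto intro!: measurable_compose[OF g measurable_stick_test]\<close>)
  qed
  also have "\<dots> = (\<integral>u. stick_mean Q (s * (1 - u)) (\<lambda>c. a c + excess c (s * u)) \<partial>unif01)"
    unfolding stick_mean_def
  proof (intro Bochner_Integration.integral_cong refl)
    fix u U assume u: "u \<in> space unif01" and U: "U \<in> space stick_measure"
    show "?f s a (?g (u, U)) = ?f (s * (1 - u)) (\<lambda>c. a c + excess c (s * u)) U"
    proof (rule lip_test_cong[OF Q])
      fix c assume "c \<in> C"
      then have c: "0 < c" by (rule lip_testD[OF Q])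
      have u': "0 < u" "u < 1" using u by (auto simp: space_unif01)
      let ?y = "\<lambda>j. s * stick_piece (case_nat u U) j"
      have tail: "?y (Suc j) = s * (1 - u) * stick_piece U j" for j by (simp add: stick_piece_case_nat)
      have nn: "0 \<le> ?y (Suc j)" for j
        unfolding tail using s u' stick_piece_pos[OF U, of j] by simp
      have sm: "summable (\<lambda>j. ?y (Suc j))"
        unfolding tail by (rule summable_mult[OF summable_stick_piece[OF U]])
      have "summable (\<lambda>j. excess c (?y j))"
        using summable_excess[OF c nn sm] by (subst (asm) summable_Suc_iff)
      then have "profile ?y c = (\<Sum>j. excess c (?y (Suc j))) + excess c (?y 0)"
        unfolding profile_def
        using suminf_split_head[of "\<lambda>j. excess c (?y j)"] by simp
      then show "a c + profile (\<lambda>j. s * stick_piece (?g (u, U)) j) c =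
        a c + excess c (s * u) + profile (\<lambda>j. s * (1 - u) * stick_piece U j) c"
        by (simp add: tail stick_piece_case_nat(1)) (simp add: profile_def)
    qed
  qed
  finally show ?thesis .
qed

end

section \<open>Comparison of words and sticks\<close>

lemma integral_bind_pmf_bounded:
  fixes f :: "'b \<Rightarrow> real"
  assumes "\<And>x. \<bar>f x\<bar> \<le> B"
  shows "measure_pmf.expectation (bind_pmf M N) f =
    measure_pmf.expectation M (\<lambda>x. measure_pmf.expectation (N x) f)"
  unfolding measure_pmf_bind
  by (rule integral_bind[where K = "count_space UNIV" and B = B and B' = 1])
    (use assms in \<open>auto simp: measure_pmf_in_subprob_space\<close>)

lemma integrable_pmf_bounded:
  fixes f :: "'b \<Rightarrow> real"
  assumes "\<And>x. \<bar>f x\<bar> \<le> B"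
  shows "integrable (measure_pmf M) f"
  by (rule measure_pmf.integrable_const_bound[where B = B]) (use assms in auto)

lemma expectation_pmf_diff_le:
  fixes f g :: "'b \<Rightarrow> real"
  assumes f: "\<And>x. \<bar>f x\<bar> \<le> B" and g: "\<And>x. \<bar>g x\<bar> \<le> B"
    and d: "\<And>x. x \<in> set_pmf M \<Longrightarrow> \<bar>f x - g x\<bar> \<le> e * indicator X x"
  shows "\<bar>measure_pmf.expectation M f - measure_pmf.expectation M g\<bar> \<le> e * measure_pmf.prob M X"
proof -
  note int = integrable_pmf_bounded[of f B, OF f] integrable_pmf_bounded[of g B, OF g]
  have "\<bar>measure_pmf.expectation M f - measure_pmf.expectation M g\<bar> =
      \<bar>measure_pmf.expectation M (\<lambda>x. f x - g x)\<bar>" using int by simp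
  also have "\<dots> \<le> measure_pmf.expectation M (\<lambda>x. \<bar>f x - g x\<bar>)" by (rule integral_abs_bound)
  also have "\<dots> \<le> measure_pmf.expectation M (\<lambda>x. e * indicator X x)"
  proof (rule integral_mono_AE)
    show "integrable (measure_pmf M) (\<lambda>x. e * indicator X x)"
      by (rule integrable_pmf_bounded[of _ "\<bar>e\<bar>"]) (simp add: indicator_def)
  qed (use int d in \<open>auto simp: AE_measure_pmf_iff\<close>)
  also have "\<dots> = e * measure_pmf.prob M X" by simp
  finally show ?thesis .
qed

section \<open>The two recursions and the induction that compares them\<close>

definition mset_profile :: "real \<Rightarrow> nat multiset \<Rightarrow> rat \<Rightarrow> real" where
  "mset_profile N S c = (\<Sum>s\<in>#S. excess c (real s / N))"

lemma mset_profile_add: "mset_profile N (S + T) c = mset_profile N S c + mset_profile N T c"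
  by (simp add: mset_profile_def)

lemma mset_profile_bounds:
  assumes "0 < c" "0 < N"
  shows "0 \<le> mset_profile N S c" "mset_profile N S c \<le> real (sum_mset S) / N"
proof -
  show "0 \<le> mset_profile N S c"
    unfolding mset_profile_def by (induction S) (auto simp: excess_nonneg)
  show "mset_profile N S c \<le> real (sum_mset S) / N"
    unfolding mset_profile_def
  proof (induction S)
    case (add s S)
    then show ?case using excess_le[OF assms(1), of "real s / N"] assms(2) by (simp add: add_divide_distrib)
  qed simp
qed

text \<open>\<open>N\<close> is the length of the initial word, \<open>k\<close> the number of remaining letters, and \<open>a\<close> the
  profile of the cycles removed so far.\<close>

definition word_mean :: "real \<Rightarrow> ((rat \<Rightarrow> real) \<Rightarrow> real) \<Rightarrow> real pmf \<Rightarrow> nat \<Rightarrow> (rat \<Rightarrow> real) \<Rightarrow> real" where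
  "word_mean N Q P k a = measure_pmf.expectation (replicate_pmf k P)
     (\<lambda>ws. Q (\<lambda>c. a c + mset_profile N (word_cycles k ((!) ws)) c))"

lemma sum_word_block: "0 < l \<Longrightarrow> sum_mset (word_block l ys) = l"
  using cyc_period_dvd[of l "(!) ys"] by (simp add: word_block_def)

text \<open>Putting one cycle of length \<open>l = k - j\<close> in place of the block matters only
  if the tail has a period below \<open>l\<close>. Both contributions to a profile then lie between
  0 and \<open>l / N\<close>, so the cost is \<open>l / N\<close> times the probability of such a
  tail, which \<open>C0\<close> controls for every \<open>l\<close>.\<close>

lemma word_mean_step:
  assumes Q: "lip_test L C Q" and N: "0 < N" and k: "0 < k"
    and C0: "\<And>l. 0 < l \<Longrightarrow> real l * measure_pmf.prob (replicate_pmf l P) {ys. cyc_period l ((!) ys) < l} \<le> C0"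
  shows "\<bar>word_mean N Q P k a - (\<Sum>j<k. word_mean N Q P j (\<lambda>c. a c + excess c (real (k - j) / N))) / k\<bar>
    \<le> L * card C * C0 / N"
proof -
  define h where "h S = Q (\<lambda>c. a c + mset_profile N S c)" for S
  have hB: "\<bar>h S\<bar> \<le> L" for S unfolding h_def by (rule lip_testD[OF Q])
  let ?E = "measure_pmf.expectation"
  define E where "E j = ?E (replicate_pmf j P) (\<lambda>xs. ?E (replicate_pmf (k - j) P)
    (\<lambda>ys. h (word_cycles j ((!) xs) + word_block (k - j) ys)))" for j
  have "word_mean N Q P k a = ?E (map_pmf (\<lambda>ws. word_cycles k ((!) ws)) (replicate_pmf k P)) h"
    by (simp add: word_mean_def h_def)
  also have "\<dots> = ?E (pmf_of_set {..<k}) E"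
    unfolding word_cycles_recursion[OF k] E_def
    by (simp add: integral_bind_pmf_bounded[of h L, OF hB])
  also have "\<dots> = (\<Sum>j<k. E j) / k" using k by (subst integral_pmf_of_set) auto
  finally have wm: "word_mean N Q P k a = (\<Sum>j<k. E j) / k" .
  have Ej: "\<bar>E j - word_mean N Q P j (\<lambda>c. a c + excess c (real (k - j) / N))\<bar> \<le> L * card C * C0 / N"
    if j: "j < k" for j
  proof -
    let ?l = "k - j"
    define g where "g xs = Q (\<lambda>c. a c + excess c (real ?l / N) + mset_profile N (word_cycles j ((!) xs)) c)" for xs
    have gB: "\<bar>g xs\<bar> \<le> L" for xs unfolding g_def by (rule lip_testD[OF Q])
    let ?e = "L * card C * (real ?l / N)"
    have inner: "\<bar>?E (replicate_pmf ?l P) (\<lambda>ys. h (word_cycles j ((!) xs) + word_block ?l ys)) - g xs\<bar>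
        \<le> L * card C * C0 / N" for xs
    proof -
      have "\<bar>?E (replicate_pmf ?l P) (\<lambda>ys. h (word_cycles j ((!) xs) + word_block ?l ys)) -
          ?E (replicate_pmf ?l P) (\<lambda>_. g xs)\<bar>
        \<le> ?e * measure_pmf.prob (replicate_pmf ?l P) {ys. cyc_period ?l ((!) ys) < ?l}"
      proof (rule expectation_pmf_diff_le[OF hB gB])
        fix ys
        let ?W = "word_cycles j ((!) xs)"
        show "\<bar>h (?W + word_block ?l ys) - g xs\<bar> \<le> ?e * indicator {ys. cyc_period ?l ((!) ys) < ?l} ys"
        proof (cases "cyc_period ?l ((!) ys) < ?l")
          case True
          have "\<bar>h (?W + word_block ?l ys) - g xs\<bar> \<le> ?e"
            unfolding h_def g_def
          proof (rule lip_test_bound[OF Q])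
            fix c assume "c \<in> C"
            then have c: "0 < c" by (rule lip_testD[OF Q])
            have "0 \<le> mset_profile N (word_block ?l ys) c" "mset_profile N (word_block ?l ys) c \<le> real ?l / N"
              using mset_profile_bounds[OF c N, of "word_block ?l ys"] sum_word_block[of ?l ys] j by auto
            moreover have "0 \<le> excess c (real ?l / N)" "excess c (real ?l / N) \<le> real ?l / N"
              using N by (auto intro!: excess_nonneg excess_le[OF c])
            ultimately show "\<bar>a c + mset_profile N (?W + word_block ?l ys) c -
              (a c + excess c (real ?l / N) + mset_profile N ?W c)\<bar> \<le> real ?l / N"
              by (simp only: mset_profile_add) linarith
          qed
          then show ?thesis using True by simp
        next
          case False
          then have "cyc_period ?l ((!) ys) = ?l" using cyc_period_le[of ?l "(!) ys"] j by linarith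
          then have "word_block ?l ys = {#?l#}" using j by (simp add: word_block_def)
          then have "h (?W + word_block ?l ys) = g xs"
            unfolding h_def g_def by (simp add: mset_profile_def add_ac)
          then show ?thesis using False by simp
        qed
      qed
      also have "?e * measure_pmf.prob (replicate_pmf ?l P) {ys. cyc_period ?l ((!) ys) < ?l} =
          L * card C / N * (real ?l * measure_pmf.prob (replicate_pmf ?l P) {ys. cyc_period ?l ((!) ys) < ?l})"
        by simp
      also have "\<dots> \<le> L * card C / N * C0"
        using C0[of ?l] j N lip_testD(1)[OF Q] by (intro mult_left_mono) auto
      finally show ?thesis by simp
    qed
    have "\<bar>E j - ?E (replicate_pmf j P) g\<bar> \<le> L * card C * C0 / N * measure_pmf.prob (replicate_pmf j P) UNIV"
      unfolding E_def
    proof (rule expectation_pmf_diff_le[where B = L])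
      show "\<bar>?E (replicate_pmf ?l P) (\<lambda>ys. h (word_cycles j ((!) xs) + word_block ?l ys))\<bar> \<le> L" for xs
      proof -
        have "\<bar>?E (replicate_pmf ?l P) (\<lambda>ys. h (word_cycles j ((!) xs) + word_block ?l ys))\<bar> \<le>
          ?E (replicate_pmf ?l P) (\<lambda>ys. \<bar>h (word_cycles j ((!) xs) + word_block ?l ys)\<bar>)"
          by (rule integral_abs_bound)
        also have "\<dots> \<le> ?E (replicate_pmf ?l P) (\<lambda>ys. L)"
          by (intro integral_mono integrable_pmf_bounded[of _ L]) (use hB lip_testD(1)[OF Q] in auto)
        finally show ?thesis by simp
      qed
    qed (use gB inner in auto)
    moreover have "word_mean N Q P j (\<lambda>c. a c + excess c (real ?l / N)) = ?E (replicate_pmf j P) g"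
      by (simp add: word_mean_def g_def[abs_def])
    ultimately show ?thesis by simp
  qed
  have "\<bar>(\<Sum>j<k. E j) / k - (\<Sum>j<k. word_mean N Q P j (\<lambda>c. a c + excess c (real (k - j) / N))) / k\<bar> =
      \<bar>\<Sum>j<k. E j - word_mean N Q P j (\<lambda>c. a c + excess c (real (k - j) / N))\<bar> / k"
    by (simp add: sum_subtractf flip: diff_divide_distrib)
  also have "\<dots> \<le> (\<Sum>j<k. L * card C * C0 / N) / k"
    by (intro divide_right_mono order_trans[OF sum_abs] sum_mono Ej) auto
  also have "\<dots> = L * card C * C0 / N" using k by simp
  finally show ?thesis unfolding wm .
qed

text \<open>On each of the \<open>k\<close> intervals, \<open>b\<close> differs from its value at
  the right end by at most \<open>K / k\<close>; the index \<open>j\<close> runs through these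
  intervals from right to left.\<close>

lemma riemann_sum_lipschitz:
  fixes b :: "real \<Rightarrow> real"
  assumes lip: "\<And>x y. x \<in> {0..1} \<Longrightarrow> y \<in> {0..1} \<Longrightarrow> \<bar>b x - b y\<bar> \<le> K * \<bar>x - y\<bar>"
    and K: "0 \<le> K" and k: "0 < k"
  shows "\<bar>(\<Sum>j<k. b (real (k - j) / k)) / k - (\<integral>u. b u \<partial>unif01)\<bar> \<le> K / k"
proof -
  have "K-lipschitz_on {0..1} b" using lip K by (intro lipschitz_onI) (auto simp: dist_real_def)
  then have cont: "continuous_on {0..1} b" by (rule lipschitz_on_continuous_on)
  have "set_integrable lborel {0<..<1} b"
    by (rule set_integrable_subset[OF borel_integrable_atLeastAtMost'[OF cont]]) auto
  then have "(LINT u:{0<..<1}|lborel. b u) = integral {0<..<1} b" by (rule set_borel_integral_eq_integral)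
  then have unif: "(\<integral>u. b u \<partial>unif01) = integral {0..1} b"
    unfolding unif01_def set_lebesgue_integral_def
    by (simp add: integral_restrict_space integral_open_interval_real)
  have "\<bar>integral {0..real i / k} b - (\<Sum>m<i. b (real (Suc m) / k)) / k\<bar> \<le> real i * (K / k\<^sup>2)" if "i \<le> k" for i
    using that
  proof (induction i)
    case (Suc i)
    let ?p = "real i / k" and ?q = "real (Suc i) / k"
    have pq: "0 \<le> ?p" "?p \<le> ?q" "?q \<le> 1" "?q - ?p = 1 / k"
      using Suc k by (auto simp: field_simps)
    have sub: "{?p..?q} \<subseteq> {0..1}" "{0..?q} \<subseteq> {0..1}"
      unfolding atLeastatMost_subset_iff using pq by auto
    have int: "b integrable_on {?p..?q}" "b integrable_on {0..?q}"
      by (intro integrable_continuous_real continuous_on_subset[OF cont] sub)+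
    have split: "integral {0..?q} b = integral {0..?p} b + integral {?p..?q} b"
      using Henstock_Kurzweil_Integration.integral_combine[of 0 ?p ?q b] pq int by simp
    have "integral {?p..?q} (\<lambda>t. b t - b ?q) = integral {?p..?q} b - integral {?p..?q} (\<lambda>t. b ?q)"
      using int by (intro Henstock_Kurzweil_Integration.integral_diff) auto
    then have const: "integral {?p..?q} (\<lambda>t. b t - b ?q) = integral {?p..?q} b - b ?q / k"
      using pq by simp
    have "norm (integral {?p..?q} (\<lambda>t. b t - b ?q)) \<le> K * (1 / k) * (?q - ?p)"
    proof (rule integral_bound[OF pq(2)])
      show "continuous_on {?p..?q} (\<lambda>t. b t - b ?q)"
        by (intro continuous_intros continuous_on_subset[OF cont] sub)
      fix t assume t: "t \<in> {?p..?q}"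
      then have "\<bar>b t - b ?q\<bar> \<le> K * \<bar>t - ?q\<bar>" by (intro lip subsetD[OF sub(1)]) (use pq(2) in auto)
      also have "\<dots> \<le> K * (1 / k)" using t pq K by (intro mult_left_mono) auto
      finally show "norm (b t - b ?q) \<le> K * (1 / k)" by simp
    qed
    then have "\<bar>integral {?p..?q} b - b ?q / k\<bar> \<le> K / k\<^sup>2"
      unfolding const pq(4) by (simp add: power2_eq_square)
    moreover have "\<bar>integral {0..?p} b - (\<Sum>m<i. b (real (Suc m) / k)) / k\<bar> \<le> real i * (K / k\<^sup>2)"
      using Suc by simp
    moreover have "(\<Sum>m<Suc i. b (real (Suc m) / k)) / k = (\<Sum>m<i. b (real (Suc m) / k)) / k + b ?q / k"
      by (simp add: add_divide_distrib)
    moreover have "real (Suc i) * (K / k\<^sup>2) = real i * (K / k\<^sup>2) + K / k\<^sup>2"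
      by (simp only: of_nat_Suc distrib_right mult_1_left add.commute)
    ultimately show ?case unfolding split by linarith
  qed simp
  from this[OF order.refl] have "\<bar>integral {0..1} b - (\<Sum>m<k. b (real (Suc m) / k)) / k\<bar> \<le> K / k"
    using k by (simp add: power2_eq_square)
  moreover have "(\<Sum>m<k. b (real (Suc m) / k)) = (\<Sum>j<k. b (real (k - j) / k))"
    by (subst sum.nat_diff_reindex[symmetric]) (rule sum.cong, auto simp: Suc_diff_Suc)
  ultimately show ?thesis unfolding unif by (simp add: abs_minus_commute)
qed

text \<open>Divided by \<open>k\<close>, this says that the mean of \<open>harm j\<close> over
  \<open>j < k\<close> is \<open>harm k - 1\<close>: averaging loses exactly 1, which pays for the
  error of one step of the recursion.\<close>

lemma sum_harm: "(\<Sum>j<k. harm j) = real k * harm k - real k"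
proof (induction k)
  case (Suc k)
  have "real (Suc k) * harm (Suc k) = real (Suc k) * harm k + 1"
    by (simp add: harm_Suc distrib_left del: of_nat_Suc)
  then show ?case using Suc by (simp add: algebra_simps)
qed simp

text \<open>Strong induction on \<open>k\<close>, for all \<open>a\<close> since \<open>a\<close>
  grows along the recursion. With \<open>K = L * card C\<close>, one step costs
  \<open>K * C0 / N\<close> for periodic tails and \<open>2 * K / N\<close> for the Riemann sum; by
  \<open>sum_harm\<close> the averaged earlier errors leave exactly this room.\<close>

lemma word_mean_close_stick_mean:
  assumes Q: "lip_test L C Q" and N: "0 < N" and C0: "0 \<le> C0"
    "\<And>l. 0 < l \<Longrightarrow> real l * measure_pmf.prob (replicate_pmf l P) {ys. cyc_period l ((!) ys) < l} \<le> C0"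
  shows "\<bar>word_mean N Q P k a - stick_mean Q (real k / N) a\<bar> \<le> L * card C * (C0 + 2) * harm k / N"
proof (induction k arbitrary: a rule: less_induct)
  case (less k)
  define K where "K = L * card C"
  have K: "0 \<le> K" using lip_testD(1)[OF Q] by (simp add: K_def)
  show ?case
  proof (cases "k = 0")
    case True
    have "profile (\<lambda>j. 0 * stick_piece U j) c = 0" if "c \<in> C" for U c
      using excess_0[OF lip_testD(3)[OF Q that]] by (simp add: profile_def)
    then have "Q (\<lambda>c. a c + profile (\<lambda>j. 0 * stick_piece U j) c) = Q a" for U
      by (intro lip_test_cong[OF Q]) simp
    then have "stick_mean Q 0 a = Q a" unfolding stick_mean_def using stick_measure.prob_space by simp
    moreover have "word_cycles 0 w = {#}" for w by (simp add: word_cycles_def cycle_type_def)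
    then have "word_mean N Q P 0 a = Q a" by (simp add: word_mean_def mset_profile_def)
    ultimately show ?thesis using True by (simp add: harm_expand)
  next
    case False
    then have k: "0 < k" by simp
    define s where "s = real k / N"
    have s: "0 \<le> s" using N by (simp add: s_def)
    \<comment> \<open>Here \<open>u\<close> is the fraction of the remaining length taken by the
      removed piece; \<open>u = (k - j) / k\<close> corresponds to the term of
      \<open>j\<close>.\<close>
    define b where "b u = stick_mean Q (s * (1 - u)) (\<lambda>c. a c + excess c (s * u))" for u
    define aj where "aj j = (\<lambda>c. a c + excess c (real (k - j) / N))" for j
    have b_eq: "b (real (k - j) / k) = stick_mean Q (real j / N) (aj j)" if "j < k" for j
    proof -
      have "s * (1 - real (k - j) / k) = real j / N" "s * (real (k - j) / k) = real (k - j) / N"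
        using that k N by (auto simp: s_def field_simps)
      then show ?thesis by (simp only: b_def aj_def)
    qed
    \<comment> \<open>One \<open>K * s\<close> comes from the removed piece \<open>s * u\<close>,
      the other from the remaining length \<open>s * (1 - u)\<close>.\<close>
    have "\<bar>b u - b v\<bar> \<le> 2 * K * s * \<bar>u - v\<bar>" if "u \<in> {0..1}" "v \<in> {0..1}" for u v
    proof -
      have d: "\<bar>s * u - s * v\<bar> = s * \<bar>u - v\<bar>" "\<bar>s * (1 - u) - s * (1 - v)\<bar> = s * \<bar>u - v\<bar>"
        using s by (simp_all add: abs_mult abs_minus_commute flip: right_diff_distrib)
      have "\<bar>b u - b v\<bar> \<le> K * (s * \<bar>u - v\<bar> + \<bar>s * (1 - u) - s * (1 - v)\<bar>)"
        unfolding b_def K_def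
        by (rule stick_mean_lipschitz[OF Q])
          (use that s excess_lipschitz[of _ "s * u" "s * v"] d in auto)
      then show ?thesis unfolding d by (simp add: algebra_simps)
    qed
    then have "\<bar>(\<Sum>j<k. b (real (k - j) / k)) / k - (\<integral>u. b u \<partial>unif01)\<bar> \<le> 2 * K * s / k"
      by (rule riemann_sum_lipschitz) (use K s k in auto)
    moreover have "(\<integral>u. b u \<partial>unif01) = stick_mean Q s a"
      unfolding b_def by (rule stick_mean_recursion[OF Q s, symmetric])
    moreover have "2 * K * s / k = K * 2 / N" using k by (simp add: s_def)
    moreover have "(\<Sum>j<k. b (real (k - j) / k)) = (\<Sum>j<k. stick_mean Q (real j / N) (aj j))"
      using b_eq by (intro sum.cong) auto
    ultimately have r1: "\<bar>(\<Sum>j<k. stick_mean Q (real j / N) (aj j)) / k - stick_mean Q s a\<bar> \<le> K * 2 / N"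
      by simp
    have r2: "\<bar>word_mean N Q P k a - (\<Sum>j<k. word_mean N Q P j (aj j)) / k\<bar> \<le> K * C0 / N"
      unfolding aj_def K_def by (rule word_mean_step[OF Q N k C0(2)])
    have "\<bar>(\<Sum>j<k. word_mean N Q P j (aj j)) / k - (\<Sum>j<k. stick_mean Q (real j / N) (aj j)) / k\<bar> =
        \<bar>\<Sum>j<k. word_mean N Q P j (aj j) - stick_mean Q (real j / N) (aj j)\<bar> / k"
      by (simp add: sum_subtractf flip: diff_divide_distrib)
    also have "\<dots> \<le> (\<Sum>j<k. K * (C0 + 2) * harm j / N) / k"
      by (intro divide_right_mono order_trans[OF sum_abs] sum_mono) (auto simp: K_def less.IH)
    also have "(\<Sum>j<k. K * (C0 + 2) * harm j / N) = K * (C0 + 2) / N * (real k * harm k - real k)"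
      unfolding sum_harm[symmetric] by (simp add: sum_distrib_left)
    also have "\<dots> / k = K * (C0 + 2) * harm k / N - (K * C0 / N + K * 2 / N)"
      using k N by (simp add: field_simps)
    finally show ?thesis using r1 r2 unfolding s_def K_def[symmetric] by linarith
  qed
qed

text \<open>The product \<open>l * l * sqrt R ^ l\<close> is the square of \<open>l * q ^ l\<close>
  with \<open>q = sqrt (sqrt R)\<close>, which tends to 0. The constant depends on \<open>R\<close>
  alone, so it serves distributions that vary with \<open>n\<close>.\<close>

lemma nonprimitive_bound:
  assumes "0 \<le> R" "R < 1"
  obtains C0 where "0 \<le> C0" "\<And>(P :: real pmf) l. (\<And>i. pmf P i \<le> R) \<Longrightarrow> 0 < l \<Longrightarrow>
    real l * measure_pmf.prob (replicate_pmf l P) {ys. cyc_period l ((!) ys) < l} \<le> C0"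
proof -
  let ?q = "sqrt (sqrt R)"
  have "(\<lambda>l. real l * ?q ^ l) \<longlonglongrightarrow> 0"
    by (rule powser_times_n_limit_0) (use assms in auto)
  then have "Bseq (\<lambda>l. real l * ?q ^ l)" by (intro convergent_imp_Bseq convergentI)
  then obtain B where B: "0 < B" "\<And>l. \<bar>real l * ?q ^ l\<bar> \<le> B" by (auto simp: Bseq_def)
  have "real l * measure_pmf.prob (replicate_pmf l P) {ys. cyc_period l ((!) ys) < l} \<le> B\<^sup>2"
    if P: "\<And>i. pmf P i \<le> R" and l: "0 < l" for P :: "real pmf" and l
  proof -
    have "real l * measure_pmf.prob (replicate_pmf l P) {ys. cyc_period l ((!) ys) < l} \<le>
        real l * (real l * sqrt R ^ l)"
      using prob_cyc_period_less[OF P _ l] assms by (intro mult_left_mono) auto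
    also have "sqrt R ^ l = (?q ^ l)\<^sup>2" using assms by (simp flip: power_mult_distrib add: power2_eq_square)
    also have "real l * (real l * (?q ^ l)\<^sup>2) = (real l * ?q ^ l)\<^sup>2"
      by (simp add: power2_eq_square)
    also have "\<dots> \<le> B\<^sup>2" using power_mono[OF B(2)[of l] abs_ge_zero, of 2] by simp
    finally show ?thesis .
  qed
  then show ?thesis using that[of "B\<^sup>2"] by simp
qed

lemma harm_over_n_tendsto_0: "(\<lambda>n. harm n / real n :: real) \<longlonglongrightarrow> 0"
proof -
  have "(\<lambda>n. harm n - ln (real n) :: real) \<longlonglongrightarrow> euler_mascheroni"
    using euler_mascheroni_LIMSEQ by simp
  moreover have "(\<lambda>n. 1 / real n) \<longlonglongrightarrow> 0" by (rule lim_1_over_n)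
  ultimately have "(\<lambda>n. (harm n - ln (real n)) * (1 / real n)) \<longlonglongrightarrow> euler_mascheroni * 0"
    by (rule tendsto_mult)
  moreover have "(\<lambda>n. ln (real n) / real n) \<longlonglongrightarrow> 0" by (rule lim_ln_over_n)
  ultimately have "(\<lambda>n. (harm n - ln (real n)) * (1 / real n) + ln (real n) / real n) \<longlonglongrightarrow> euler_mascheroni * 0 + 0"
    by (rule tendsto_add)
  then show ?thesis by (simp add: diff_divide_distrib)
qed

section \<open>From random variables to random words\<close>

lemma nn_integral_count_space_has_sum:
  fixes p :: "'a \<Rightarrow> real"
  assumes "(p has_sum s) I" "\<And>i. i \<in> I \<Longrightarrow> 0 \<le> p i"
  shows "(\<integral>\<^sup>+i. ennreal (p i) \<partial>count_space I) = ennreal s"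
proof -
  have "p summable_on I" using assms(1) by (auto simp: summable_on_def)
  then have "Infinite_Set_Sum.abs_summable_on p I"
    using abs_summable_equivalent summable_on_iff_abs_summable_on_real by blast
  then show ?thesis
    using nn_integral_conv_infsetsum[of p I] infsetsum_infsum[of p I] infsumI[OF assms(1)] assms(2) by simp
qed

text \<open>The letters lie in \<open>I\<close> only almost surely. The word is therefore altered on
  a null set so as to take countably many values, and the law of the altered word is compared with
  the word pmf point by point.\<close>

lemma integral_indep_word:
  fixes X :: "nat \<Rightarrow> 'a \<Rightarrow> real" and p :: "real \<Rightarrow> real"
  assumes M: "prob_space M" and I: "countable I"
    and p: "\<And>i. i \<in> I \<Longrightarrow> 0 \<le> p i" "(p has_sum 1) I"
    and indep: "prob_space.indep_vars M (\<lambda>_. borel) X {1..n}"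
    and law: "\<And>j i. j \<in> {1..n} \<Longrightarrow> i \<in> I \<Longrightarrow> measure M {\<omega> \<in> space M. X j \<omega> = i} = p i"
    and P: "\<And>i. pmf P i = (if i \<in> I then p i else 0)"
    and f: "(\<lambda>\<omega>. f (map (\<lambda>j. X (Suc j) \<omega>) [0..<n])) \<in> borel_measurable M"
  shows "(\<integral>\<omega>. f (map (\<lambda>j. X (Suc j) \<omega>) [0..<n]) \<partial>M) = measure_pmf.expectation (replicate_pmf n P) (f :: real list \<Rightarrow> real)"
proof -
  interpret prob_space M by (rule M)
  have X [measurable]: "X (Suc j) \<in> borel_measurable M" if "j < n" for j
    using indep that by (auto simp: indep_vars_def)
  define W where "W \<omega> = map (\<lambda>j. X (Suc j) \<omega>) [0..<n]" for \<omega>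
  define D where "D = {ws \<in> lists I. length ws = n}"
  have D: "countable D"
    unfolding D_def by (rule countable_subset[OF _ countable_lists[OF I]]) auto
  \<comment> \<open>The default \<open>[]\<close> makes the range countable, so that
    \<open>V\<close> is measurable for the discrete sigma-algebra on lists.\<close>
  define V where "V \<omega> = (if W \<omega> \<in> D then W \<omega> else [])" for \<omega>
  have pre: "{\<omega> \<in> space M. W \<omega> = ws} = {\<omega> \<in> space M. \<forall>j\<in>{..<n}. X (Suc j) \<omega> = ws ! j}" if "length ws = n" for ws
    using that by (auto simp: W_def list_eq_iff_nth_eq)
  have sing [measurable]: "{\<omega> \<in> space M. W \<omega> = ws} \<in> sets M" if "ws \<in> D" for ws
  proof -
    have "{\<omega> \<in> space M. X (Suc j) \<omega> = ws ! j} \<in> sets M" if "j < n" for j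
      using that by measurable
    then have "{\<omega> \<in> space M. \<forall>j\<in>{..<n}. X (Suc j) \<omega> = ws ! j} \<in> sets M"
      by (intro sets.sets_Collect_finite_All) auto
    then show ?thesis using pre that by (simp add: D_def)
  qed
  have prob: "measure M {\<omega> \<in> space M. W \<omega> = ws} = pmf (replicate_pmf n P) ws" if ws: "ws \<in> D" for ws
  proof (cases "n = 0")
    case True
    then show ?thesis using ws prob_space by (auto simp: D_def W_def)
  next
    case False
    have wsI: "ws ! j \<in> I" if "j < n" for j using ws that by (auto simp: D_def in_lists_conv_set)
    have "{\<omega> \<in> space M. W \<omega> = ws} = (\<Inter>j\<in>{..<n}. X (Suc j) -` {ws ! j} \<inter> space M)"
      using pre[of ws] ws False by (auto simp: D_def)
    moreover have "prob (\<Inter>j\<in>{..<n}. X (Suc j) -` {ws ! j} \<inter> space M) = (\<Prod>j<n. prob (X (Suc j) -` {ws ! j} \<inter> space M))"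
    proof -
      define A where "A j = X j -` {ws ! (j - 1)} \<inter> space M" for j
      have S: "{1..n} = Suc ` {..<n}" by (simp add: image_Suc_lessThan)
      have "prob (\<Inter>j\<in>{1..n}. A j) = (\<Prod>j\<in>{1..n}. prob (A j))"
        unfolding A_def by (rule indep_varsD[OF indep]) (use False in auto)
      then have "prob (\<Inter>j\<in>{..<n}. A (Suc j)) = (\<Prod>j<n. prob (A (Suc j)))"
        unfolding S by (simp only: image_image prod.reindex[OF inj_on_subset[OF inj_Suc subset_UNIV]] o_def)
      then show ?thesis by (simp only: A_def diff_Suc_1)
    qed
    moreover have "X (Suc j) -` {ws ! j} \<inter> space M = {\<omega> \<in> space M. X (Suc j) \<omega> = ws ! j}" for j by auto
    ultimately have "measure M {\<omega> \<in> space M. W \<omega> = ws} = (\<Prod>j<n. p (ws ! j))"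
      using law wsI by simp
    also have "\<dots> = prod_list (map (pmf P) ws)"
      using ws wsI by (simp add: prod.list_conv_set_nth D_def P atLeast0LessThan)
    finally show ?thesis using ws by (simp add: pmf_replicate_pmf D_def)
  qed
  have ae: "AE \<omega> in M. W \<omega> \<in> D"
  proof -
    have "AE \<omega> in M. X (Suc j) \<omega> \<in> I" if j: "j < n" for j
    proof -
      have m: "{\<omega> \<in> space M. X (Suc j) \<omega> = i} \<in> sets M" for i using j by measurable
      have "emeasure M (\<Union>i\<in>I. {\<omega> \<in> space M. X (Suc j) \<omega> = i}) =
          (\<integral>\<^sup>+i. emeasure M {\<omega> \<in> space M. X (Suc j) \<omega> = i} \<partial>count_space I)"
        by (rule emeasure_UN_countable) (use m I in \<open>auto simp: disjoint_family_on_def\<close>)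
      also have "\<dots> = (\<integral>\<^sup>+i. ennreal (p i) \<partial>count_space I)"
        by (rule nn_integral_cong) (simp add: emeasure_eq_measure law[of "Suc j"] j Suc_leI)
      also have "\<dots> = 1" using nn_integral_count_space_has_sum[OF p(2,1)] by simp
      finally have "emeasure M (\<Union>i\<in>I. {\<omega> \<in> space M. X (Suc j) \<omega> = i}) = 1" .
      moreover have "(\<Union>i\<in>I. {\<omega> \<in> space M. X (Suc j) \<omega> = i}) \<in> sets M" using m I by (intro sets.countable_UN') auto
      ultimately have "AE \<omega> in M. \<omega> \<in> (\<Union>i\<in>I. {\<omega> \<in> space M. X (Suc j) \<omega> = i})"
        by (intro AE_prob_1) (simp add: measure_def)
      then show ?thesis by (rule AE_mp) auto
    qed
    then have "AE \<omega> in M. \<forall>j\<in>{..<n}. X (Suc j) \<omega> \<in> I" by (intro AE_finite_allI) auto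
    then show ?thesis by (rule AE_mp) (auto simp: D_def W_def in_lists_conv_set)
  qed
  have V: "V \<in> measurable M (count_space UNIV)"
  proof -
    have "V \<in> measurable M (count_space (insert [] D))"
    proof (subst measurable_count_space_eq_countable, use D in simp, intro conjI ballI)
      show "V \<in> space M \<rightarrow> insert [] D" by (auto simp: V_def)
      fix ws assume "ws \<in> insert [] D"
      have inD: "{\<omega> \<in> space M. W \<omega> \<in> D} \<in> sets M"
      proof -
        have "{\<omega> \<in> space M. W \<omega> \<in> D} = (\<Union>ws\<in>D. {\<omega> \<in> space M. W \<omega> = ws})" by auto
        then show ?thesis using sing D by (auto intro!: sets.countable_UN')
      qed
      have eqD: "{\<omega> \<in> space M. W \<omega> = ws \<and> ws \<in> D} \<in> sets M"
        using sing[of ws] by (cases "ws \<in> D") auto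
      have "V -` {ws} \<inter> space M = {\<omega> \<in> space M. W \<omega> = ws \<and> ws \<in> D} \<union>
          (if ws = [] then space M - {\<omega> \<in> space M. W \<omega> \<in> D} else {})"
        by (auto simp: V_def)
      then show "V -` {ws} \<inter> space M \<in> sets M" using inD eqD by auto
    qed
    then show ?thesis by (rule measurable_compose) simp
  qed
  have VW: "AE \<omega> in M. V \<omega> = W \<omega>" using ae by (rule AE_mp) (simp add: V_def)
  have "distr M (count_space UNIV) V = measure_pmf (replicate_pmf n P)"
  proof (rule measure_eqI_countable_AE[OF _ _ _ _ D])
    show "AE ws in distr M (count_space UNIV) V. ws \<in> D"
    proof (subst AE_distr_iff[OF V])
      show "AE \<omega> in M. V \<omega> \<in> D" using ae by (rule AE_mp) (simp add: V_def)
    qed simp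
    have "set_pmf P \<subseteq> I" using P by (auto simp: set_pmf_iff split: if_splits)
    then show "AE ws in measure_pmf (replicate_pmf n P). ws \<in> D"
      by (auto simp: AE_measure_pmf_iff set_replicate_pmf D_def)
    fix ws assume ws: "ws \<in> D"
    have "emeasure (distr M (count_space UNIV) V) {ws} = emeasure M (V -` {ws} \<inter> space M)"
      by (rule emeasure_distr[OF V]) simp
    also have "\<dots> = emeasure M {\<omega> \<in> space M. W \<omega> = ws}"
      using VW by (intro emeasure_eq_AE) (use measurable_sets[OF V, of "{ws}"] sing[OF ws] in auto)
    also have "\<dots> = emeasure (measure_pmf (replicate_pmf n P)) {ws}"
      by (simp add: emeasure_eq_measure prob[OF ws] emeasure_pmf_single)
    finally show "emeasure (distr M (count_space UNIV) V) {ws} = emeasure (measure_pmf (replicate_pmf n P)) {ws}" .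
  qed simp_all
  then have "measure_pmf.expectation (replicate_pmf n P) f = (\<integral>ws. f ws \<partial>distr M (count_space UNIV) V)"
    by simp
  also have "\<dots> = (\<integral>\<omega>. f (V \<omega>) \<partial>M)" by (rule integral_distr[OF V]) simp
  also have "\<dots> = (\<integral>\<omega>. f (W \<omega>) \<partial>M)"
  proof (rule integral_cong_AE)
    show "(\<lambda>\<omega>. f (V \<omega>)) \<in> borel_measurable M" by (rule measurable_compose[OF V]) simp
    show "(\<lambda>\<omega>. f (W \<omega>)) \<in> borel_measurable M" using f by (simp add: W_def)
    show "AE \<omega> in M. f (V \<omega>) = f (W \<omega>)" using VW by (rule AE_mp) simp
  qed
  finally show ?thesis by (simp add: W_def)
qed

lemma std_perm_cong:
  assumes "\<And>j k. j \<in> {1..n} \<Longrightarrow> k \<in> {1..n} \<Longrightarrow> g j < g k \<longleftrightarrow> g' j < g' k"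
  shows "std_perm n g = std_perm n g'"
proof -
  have "(g j < g k \<or> g j = g k \<and> j < k) \<longleftrightarrow> (g' j < g' k \<or> g' j = g' k \<and> j < k)"
    if "j \<in> {1..n}" "k \<in> {1..n}" for j k
    using assms[of j k] assms[of k j] that by auto
  then show ?thesis unfolding std_perm_def by (intro arg_cong[where f = The] ext) auto
qed

text \<open>The standardization depends only on the set of pairs with \<open>G j < G k\<close>, a
  tie being the failure of both strict comparisons; so it is a function of a variable with finitely
  many values.\<close>

lemma measurable_std_perm:
  fixes G :: "nat \<Rightarrow> 'a \<Rightarrow> real"
  assumes G: "\<And>j. j \<in> {1..n} \<Longrightarrow> G j \<in> borel_measurable M"
  shows "(\<lambda>\<omega>. std_perm n (\<lambda>k. G k \<omega>)) \<in> measurable M (count_space UNIV)"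
proof -
  let ?K = "{1..n} \<times> {1..n}"
  define r where "r \<omega> = {z \<in> ?K. G (fst z) \<omega> < G (snd z) \<omega>}" for \<omega>
  have r: "r \<in> measurable M (count_space (Pow ?K))"
  proof (subst measurable_count_space_eq_countable, simp add: countable_finite, intro conjI ballI)
    show "r \<in> space M \<rightarrow> Pow ?K" by (auto simp: r_def)
    fix A assume "A \<in> Pow ?K"
    then have "r \<omega> = A \<longleftrightarrow> (\<forall>z\<in>?K. (G (fst z) \<omega> < G (snd z) \<omega>) = (z \<in> A))" for \<omega>
      unfolding r_def by blast
    then have "r -` {A} \<inter> space M = {\<omega> \<in> space M. \<forall>z\<in>?K. (G (fst z) \<omega> < G (snd z) \<omega>) = (z \<in> A)}"
      by (simp add: vimage_def Int_def conj_commute)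
    also have "\<dots> \<in> sets M"
    proof (rule sets.sets_Collect_finite_All)
      fix z assume z: "z \<in> ?K"
      then have [measurable]: "G (fst z) \<in> borel_measurable M" "G (snd z) \<in> borel_measurable M"
        using G by auto
      show "{\<omega> \<in> space M. (G (fst z) \<omega> < G (snd z) \<omega>) = (z \<in> A)} \<in> sets M"
        by measurable
    qed auto
    finally show "r -` {A} \<inter> space M \<in> sets M" .
  qed
  define T where "T A g \<longleftrightarrow> (\<forall>j\<in>{1..n}. \<forall>k\<in>{1..n}. (g j < g k) = ((j, k) \<in> A))"
    for A and g :: "nat \<Rightarrow> real"
  have TD: "g j < g k \<longleftrightarrow> g' j < g' k" if "T A g" "T A g'" "j \<in> {1..n}" "k \<in> {1..n}" for A g g' j k
    using that by (simp add: T_def)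
  \<comment> \<open>By \<open>std_perm_cong\<close> any word with the comparison pattern
    \<open>A\<close> represents it; the pattern \<open>r \<omega>\<close> has one, namely the word
    at \<open>\<omega>\<close>.\<close>
  define h where "h A = std_perm n (SOME g. T A g)" for A
  have "std_perm n (\<lambda>k. G k \<omega>) = h (r \<omega>)" for \<omega>
  proof -
    have T: "T (r \<omega>) (\<lambda>k. G k \<omega>)" by (simp add: T_def r_def)
    then have TS: "T (r \<omega>) (SOME g. T (r \<omega>) g)" by (rule someI[of "T (r \<omega>)"])
    show ?thesis unfolding h_def by (rule std_perm_cong) (rule TD[OF T TS])
  qed
  moreover have "(\<lambda>\<omega>. h (r \<omega>)) \<in> measurable M (count_space UNIV)"
    by (rule measurable_compose[OF r]) simp
  ultimately show ?thesis by simp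
qed

text \<open>The zeros that pad the list contribute nothing to a profile with positive threshold, so
  the series reduces to a sum over the list.\<close>

lemma sorted_list_profile:
  fixes xs :: "nat list"
  assumes xs: "sorted_wrt (\<ge>) xs" and N: "0 < N" "sum_list xs = N"
  defines "x \<equiv> \<lambda>j. real (nth_default 0 xs j) / real N"
  shows "x \<in> Delta_infty" "0 < c \<Longrightarrow> profile x c = (\<Sum>s\<in>#mset xs. excess c (real s / real N))"
proof -
  have x_eq: "x j = (if j < length xs then real (xs ! j) / N else 0)" for j
    by (simp add: x_def nth_default_def)
  have part: "(\<Sum>j<m. x j) \<le> 1" for m
  proof -
    have "(\<Sum>j<m. x j) \<le> (\<Sum>j<m + length xs. x j)" by (intro sum_mono2) (auto simp: x_eq)
    also have "\<dots> = (\<Sum>j<length xs. x j)" by (intro sum.mono_neutral_right) (auto simp: x_eq)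
    also have "\<dots> = real (sum_list xs) / N"
      by (simp add: x_eq sum_list_sum_nth atLeast0LessThan sum_divide_distrib)
    finally show ?thesis using N by simp
  qed
  have nn: "0 \<le> x j" for j by (simp add: x_eq)
  have "x j \<le> 1" for j
    using member_le_sum[of j "{..<Suc j}" x] nn part[of "Suc j"] by (auto intro: order_trans)
  moreover have "x (Suc j) \<le> x j" for j
    using sorted_wrt_nth_less[OF xs, of j "Suc j"] by (auto simp: x_eq divide_right_mono)
  ultimately show "x \<in> Delta_infty" using nn part by (auto simp: Delta_infty_iff)
  assume c: "0 < c"
  have "profile x c = (\<Sum>j<length xs. excess c (x j))"
    unfolding profile_def by (rule suminf_finite) (auto simp: x_eq excess_0[OF c])
  also have "\<dots> = sum_list (map (\<lambda>s. excess c (real s / N)) xs)"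
    by (simp add: x_eq sum_list_sum_nth atLeast0LessThan)
  also have "\<dots> = (\<Sum>s\<in>#mset xs. excess c (real s / N))" by (metis mset_map sum_mset_sum_list)
  finally show "profile x c = (\<Sum>s\<in>#mset xs. excess c (real s / real N))" .
qed

lemma cycle_seq_profile:
  fixes g :: "nat \<Rightarrow> real"
  assumes n: "0 < n"
  defines "x \<equiv> \<lambda>j. real (cycle_seq n (std_perm n g) j) / real n"
  shows "x \<in> Delta_infty"
    and "0 < c \<Longrightarrow> profile x c = (\<Sum>s\<in>#word_cycles n (\<lambda>i. g (Suc i)). excess c (real s / real n))"
proof -
  let ?S = "word_cycles n (\<lambda>i. g (Suc i))"
  let ?xs = "rev (sorted_list_of_multiset ?S)"
  have "sorted (sorted_list_of_multiset ?S)" by simp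
  then have s: "sorted_wrt (\<ge>) ?xs" by (simp add: sorted_wrt_rev)
  have sum: "sum_list ?xs = n"
    using sum_mset_word_cycles[of n "\<lambda>i. g (Suc i)"]
    by (simp flip: sum_mset_sum_list)
  have x: "x = (\<lambda>j. real (nth_default 0 ?xs j) / real n)"
    by (simp add: x_def cycle_seq_def cycle_sizes_std_perm)
  show "x \<in> Delta_infty" unfolding x by (rule sorted_list_profile(1)[OF s n sum])
  show "profile x c = (\<Sum>s\<in>#?S. excess c (real s / real n))" if "0 < c"
    unfolding x using sorted_list_profile(2)[OF s n sum that] by simp
qed

theorem theorem1p5:
  fixes I :: "real set" and p :: "nat \<Rightarrow> real \<Rightarrow> real" and R :: real
    and M :: "nat \<Rightarrow> 'a measure" and G :: "nat \<Rightarrow> nat \<Rightarrow> 'a \<Rightarrow> real"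
  assumes "countable I"
    and "\<And>n i. n \<ge> 1 \<Longrightarrow> i \<in> I \<Longrightarrow> 0 \<le> p n i"
    and "\<And>n. n \<ge> 1 \<Longrightarrow> (p n has_sum 1) I"
    and "\<And>n. n \<ge> 1 \<Longrightarrow> prob_space (M n)"
    and "\<And>n. n \<ge> 1 \<Longrightarrow> prob_space.indep_vars (M n) (\<lambda>_. borel) (G n) {1..n}"
    and "\<And>n j i. n \<ge> 1 \<Longrightarrow> j \<in> {1..n} \<Longrightarrow> i \<in> I \<Longrightarrow>
           measure (M n) {\<omega> \<in> space (M n). G n j \<omega> = i} = p n i"
    and "0 < R" and "R < 1"
    and "\<And>n i. n \<ge> 1 \<Longrightarrow> i \<in> I \<Longrightarrow> p n i \<le> R"
  shows "converges_in_distribution Delta_infty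
           (\<lambda>n. distr (M n) (restrict_space borel Delta_infty)
              (\<lambda>\<omega> j. real (cycle_seq n (std_perm n (\<lambda>k. G n k \<omega>)) j) / real n))
           poisson_dirichlet_1"
proof -
  let ?B = "restrict_space borel Delta_infty :: (nat \<Rightarrow> real) measure"
  let ?X = "\<lambda>n \<omega> j. real (cycle_seq n (std_perm n (\<lambda>k. G n k \<omega>)) j) / real n"
  let ?\<mu> = "\<lambda>n. distr (M n) ?B (?X n)"
  have G: "G n j \<in> borel_measurable (M n)" if "n \<ge> 1" "j \<in> {1..n}" for n j
    using assms(5)[OF that(1)] that(2) by (simp add: prob_space.indep_vars_def[OF assms(4)[OF that(1)]])
  have X: "?X n \<in> measurable (M n) ?B" if n: "n \<ge> 1" for n
  proof (rule measurable_restrict_space2)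
    show "?X n \<in> space (M n) \<rightarrow> Delta_infty" using cycle_seq_profile(1)[of n] n by auto
    show "?X n \<in> borel_measurable (M n)"
      by (rule measurable_compose[OF measurable_std_perm[of n "G n"]]) (use G[OF n] in auto)
  qed
  \<comment> \<open>Carries a test integral from the given random variables over to the discrete
    model of random words.\<close>
  have mean: "(\<integral>\<omega>. Q (profile (?X n \<omega>)) \<partial>M n) = word_mean (real n) Q P n (\<lambda>_. 0)"
    if n: "n \<ge> 1" and Q: "lip_test L C Q" and P: "\<And>i. pmf P i = (if i \<in> I then p n i else 0)" for n L C Q P
  proof -
    define W where "W \<omega> = map (\<lambda>j. G n (Suc j) \<omega>) [0..<n]" for \<omega>
    define f where "f ws = Q (\<lambda>c. 0 + mset_profile (real n) (word_cycles n ((!) ws)) c)" for ws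
    have QX: "Q (profile (?X n \<omega>)) = f (W \<omega>)" for \<omega>
    proof -
      have "word_cycles n (\<lambda>i. G n (Suc i) \<omega>) = word_cycles n ((!) (W \<omega>))"
        by (rule word_cycles_cong) (simp add: W_def)
      then show ?thesis
        unfolding f_def using cycle_seq_profile(2)[of n _ "\<lambda>k. G n k \<omega>"] n lip_testD(3)[OF Q]
        by (intro lip_test_cong[OF Q]) (simp add: mset_profile_def)
    qed
    have "continuous_on Delta_infty (\<lambda>x. Q (profile x))"
      by (intro lip_test_continuous_on[OF Q] continuous_on_profile lip_testD[OF Q])
    then have "(\<lambda>x. Q (profile x)) \<in> borel_measurable ?B" by (rule borel_measurable_continuous_on_restrict)
    from measurable_compose[OF X[OF n] this] have "(\<lambda>\<omega>. f (W \<omega>)) \<in> borel_measurable (M n)" by (simp add: QX)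
    then have "(\<integral>\<omega>. f (W \<omega>) \<partial>M n) = measure_pmf.expectation (replicate_pmf n P) f"
      unfolding W_def
    proof (rule integral_indep_word[OF assms(4)[OF n] assms(1), rotated -1])
      show "prob_space.indep_vars (M n) (\<lambda>_. borel) (G n) {1..n}" by (rule assms(5)[OF n])
    qed (use assms n P in auto)
    then show ?thesis by (simp add: QX word_mean_def f_def[abs_def])
  qed
  obtain C0 where C0: "0 \<le> C0" "\<And>(P :: real pmf) l. (\<And>i. pmf P i \<le> R) \<Longrightarrow> 0 < l \<Longrightarrow>
    real l * measure_pmf.prob (replicate_pmf l P) {ys. cyc_period l ((!) ys) < l} \<le> C0"
    using nonprimitive_bound[OF less_imp_le[OF assms(7)] assms(8)] by blast
  have test_limit: "(\<lambda>n. \<integral>\<omega>. Q (profile (?X n \<omega>)) \<partial>M n) \<longlonglongrightarrow> stick_mean Q 1 (\<lambda>_. 0)"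
    if Q: "lip_test L C Q" for L C Q
  proof -
    have bnd: "\<bar>(\<integral>\<omega>. Q (profile (?X n \<omega>)) \<partial>M n) - stick_mean Q 1 (\<lambda>_. 0)\<bar> \<le> L * card C * (C0 + 2) * (harm n / n)"
      if n: "n \<ge> 1" for n
    proof -
      \<comment> \<open>The distribution \<open>p n\<close>, extended by 0 from \<open>I\<close> to
        all reals.\<close>
      define P where "P = embed_pmf (\<lambda>i. if i \<in> I then p n i else 0)"
      have P: "pmf P i = (if i \<in> I then p n i else 0)" for i
        unfolding P_def
      proof (rule pmf_embed_pmf)
        have "(\<integral>\<^sup>+i. ennreal (if i \<in> I then p n i else 0) \<partial>count_space UNIV) =
            (\<integral>\<^sup>+i. ennreal (p n i) \<partial>count_space I)"
          by (subst nn_integral_count_space_indicator[of I]) (auto intro!: nn_integral_cong split: split_indicator)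
        then show "(\<integral>\<^sup>+i. ennreal (if i \<in> I then p n i else 0) \<partial>count_space UNIV) = 1"
          using nn_integral_count_space_has_sum[OF assms(3)[OF n] assms(2)[OF n]] by simp
      qed (use assms(2)[OF n] in auto)
      have PR: "pmf P i \<le> R" for i
        unfolding P using assms(7) assms(9)[OF n, of i] by auto
      have bound: "real l * measure_pmf.prob (replicate_pmf l P) {ys. cyc_period l ((!) ys) < l} \<le> C0"
        if "0 < l" for l
        by (rule C0(2)[OF PR that])
      have "\<bar>word_mean (real n) Q P n (\<lambda>_. 0) - stick_mean Q (real n / real n) (\<lambda>_. 0)\<bar> \<le>
          L * card C * (C0 + 2) * harm n / n"
        by (rule word_mean_close_stick_mean[OF Q _ C0(1) bound]) (use n in auto)
      then show ?thesis unfolding mean[OF n Q P] using n by simp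
    qed
    have lim: "(\<lambda>n. L * card C * (C0 + 2) * (harm n / n)) \<longlonglongrightarrow> 0"
      by (rule tendsto_mult_right_zero[OF harm_over_n_tendsto_0])
    have "(\<lambda>n. (\<integral>\<omega>. Q (profile (?X n \<omega>)) \<partial>M n) - stick_mean Q 1 (\<lambda>_. 0)) \<longlonglongrightarrow> 0"
    proof (rule Lim_null_comparison[OF _ lim])
      show "\<forall>\<^sub>F n in sequentially. norm ((\<integral>\<omega>. Q (profile (?X n \<omega>)) \<partial>M n) - stick_mean Q 1 (\<lambda>_. 0))
        \<le> L * card C * (C0 + 2) * (harm n / n)"
        using eventually_ge_at_top[of 1] by eventually_elim (unfold real_norm_def, rule bnd)
    qed
    then show ?thesis by (simp add: LIM_zero_iff)
  qed
  \<comment> \<open>A uniform error of the test function costs at most \<open>e\<close> under any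
    probability law on \<open>Delta_infty\<close>. It is applied to both laws; with the limit for
    the test function this accounts for the three thirds below.\<close>
  have close: "\<bar>(\<integral>x. f x \<partial>\<nu>) - (\<integral>x. g x \<partial>\<nu>)\<bar> \<le> e"
    if \<nu>: "prob_space \<nu>" "sets \<nu> = sets ?B" and f: "continuous_on Delta_infty f" "bounded (f ` Delta_infty)"
      and g: "continuous_on Delta_infty g" "bounded (g ` Delta_infty)"
      and fg: "\<And>x. x \<in> Delta_infty \<Longrightarrow> \<bar>f x - g x\<bar> \<le> e"
    for \<nu> and f g :: "(nat \<Rightarrow> real) \<Rightarrow> real" and e
  proof -
    interpret prob_space \<nu> by (rule \<nu>(1))
    have sp: "space \<nu> = Delta_infty" using sets_eq_imp_space_eq[OF \<nu>(2)] by (simp add: space_restrict_space)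
    have int: "integrable \<nu> h" if h: "continuous_on Delta_infty h" "bounded (h ` Delta_infty)"
      for h :: "(nat \<Rightarrow> real) \<Rightarrow> real"
    proof -
      obtain b where "\<forall>x\<in>Delta_infty. norm (h x) \<le> b" using h(2) by (auto simp: bounded_iff)
      moreover have "h \<in> borel_measurable \<nu>"
        using borel_measurable_continuous_on_restrict[OF h(1)] \<nu>(2) by (simp cong: measurable_cong_sets)
      ultimately show ?thesis by (intro integrable_const_bound[where B = b]) (auto simp: sp)
    qed
    have "\<bar>(\<integral>x. f x \<partial>\<nu>) - (\<integral>x. g x \<partial>\<nu>)\<bar> = \<bar>\<integral>x. f x - g x \<partial>\<nu>\<bar>"
      using int f g by simp
    also have "\<dots> \<le> (\<integral>x. \<bar>f x - g x\<bar> \<partial>\<nu>)" by (rule integral_abs_bound)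
    also have "\<dots> \<le> (\<integral>x. e \<partial>\<nu>)"
      by (intro integral_mono) (use int f g fg sp in auto)
    finally show ?thesis using prob_space by simp
  qed
  have \<mu>: "prob_space (?\<mu> n)" "sets (?\<mu> n) = sets ?B" if "n \<ge> 1" for n
    using prob_space.prob_space_distr[OF assms(4)[OF that] X[OF that]] by auto
  have \<nu>: "prob_space poisson_dirichlet_1" "sets poisson_dirichlet_1 = sets ?B"
    using prob_space_poisson_dirichlet_1 by (auto simp: poisson_dirichlet_1_eq)
  have conv: "(\<lambda>n. \<integral>x. f x \<partial>?\<mu> n) \<longlonglongrightarrow> (\<integral>x. f x \<partial>poisson_dirichlet_1)"
    if f: "continuous_on Delta_infty f" "bounded (f ` Delta_infty)" for f :: "(nat \<Rightarrow> real) \<Rightarrow> real"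
  proof (rule tendstoI)
    fix e :: real assume e: "0 < e"
    then obtain L C Q where Q: "lip_test L C Q" "\<And>x. x \<in> Delta_infty \<Longrightarrow> \<bar>f x - Q (profile x)\<bar> < e / 3"
      using lip_test_dense[OF f(1), of "e / 3"] by auto
    let ?g = "\<lambda>x. Q (profile x)"
    have g: "continuous_on Delta_infty ?g" "bounded (?g ` Delta_infty)"
      using lip_testD(4)[OF Q(1)]
      by (auto intro!: lip_test_continuous_on[OF Q(1)] continuous_on_profile lip_testD[OF Q(1)] boundedI[of _ L])
    note gm = borel_measurable_continuous_on_restrict[OF g(1)]
    have fg: "\<bar>f x - ?g x\<bar> \<le> e / 3" if "x \<in> Delta_infty" for x using Q(2)[OF that] by simp
    have pd: "\<bar>(\<integral>x. f x \<partial>poisson_dirichlet_1) - stick_mean Q 1 (\<lambda>_. 0)\<bar> \<le> e / 3"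
      using close[OF \<nu> f g fg] integral_poisson_dirichlet_1[OF Q(1) gm refl] by simp
    have "\<forall>\<^sub>F n in sequentially. dist (\<integral>\<omega>. Q (profile (?X n \<omega>)) \<partial>M n) (stick_mean Q 1 (\<lambda>_. 0)) < e / 3"
      by (rule tendstoD[OF test_limit[OF Q(1)]]) (use e in simp)
    moreover have "\<forall>\<^sub>F n in sequentially. n \<ge> 1" by (rule eventually_ge_at_top)
    ultimately show "\<forall>\<^sub>F n in sequentially. dist (\<integral>x. f x \<partial>?\<mu> n) (\<integral>x. f x \<partial>poisson_dirichlet_1) < e"
    proof eventually_elim
      case (elim n)
      have "(\<integral>x. ?g x \<partial>?\<mu> n) = (\<integral>\<omega>. ?g (?X n \<omega>) \<partial>M n)" by (rule integral_distr[OF X[OF elim(2)] gm])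
      then show ?case
        using elim(1) pd close[OF \<mu>[OF elim(2)] f g fg] unfolding dist_real_def by linarith
    qed
  qed
  have ev: "\<forall>\<^sub>F n in sequentially. prob_space (?\<mu> n) \<and> sets (?\<mu> n) = sets ?B"
    using eventually_ge_at_top[of 1] by eventually_elim (intro conjI \<mu>)
  show ?thesis
    unfolding converges_in_distribution_def
  proof (intro conjI allI impI)
    show "\<forall>\<^sub>F n in sequentially. prob_space (?\<mu> n) \<and> sets (?\<mu> n) = sets ?B" by (rule ev)
    show "prob_space poisson_dirichlet_1" "sets poisson_dirichlet_1 = sets ?B" by (rule \<nu>)+
    fix f :: "(nat \<Rightarrow> real) \<Rightarrow> real"
    assume "continuous_on Delta_infty f \<and> bounded (f ` Delta_infty)"
    then show "(\<lambda>n. \<integral>x. f x \<partial>?\<mu> n) \<longlonglongrightarrow> (\<integral>x. f x \<partial>poisson_dirichlet_1)"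
      by (elim conjE) (rule conv)
  qed
qed

end
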